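(* Let $\vartheta$ be an inner function on $\mathbb{D}$, let $\varphi:\mathbb{D}\to\mathbb{D}$ be holomorphic, and let $p\ge2$. Let $\Phi$ be a positive (measurable) function on $\mathbb{D}$ such that the differentiation operator $f\mapsto f'$ is bounded from $K_\vartheta$ to $L^2(\mathbb{D},\Phi\,dA)$. If $$\int_{\mathbb{D}}\left(\frac{N_\varphi(z)}{\Phi(z)}\right)^{p/2}\Delta k(z,z)\,\Phi(z)\,dA(z)<\infty,$$ then the composition operator $C_\varphi:K_\vartheta\to H^2(\mathbb{D})$, $C_\varphi f=f\circ\varphi$, belongs to the Schatten class $\mathcal{S}_p$.
   Context: $\mathbb{D}$ is the open unit disk, $\mathbb{T}$ the unit circle, $H^2(\mathbb{D})$ the Hardy space, $A$ normalized area measure on $\mathbb{D}$. An inner function is a bounded analytic function in $\mathbb{D}$ with non-tangential boundary values of modulus $1$ a.e. on $\mathbb{T}$. The model space is $K_\vartheta=H^2(\mathbb{D})\ominus\vartheta H^2(\mathbb{D})$, with reproducing kernel $k(w,z)=\frac{1-\overline{\vartheta(w)}\vartheta(z)}{1-\bar wz}$; $\Delta k(z,z)$ is the Laplacian (in the real variables of $z$) of the function $z\mapsto k(z,z)=\frac{1-|\vartheta(z)|^2}{1-|z|^2}$. The Nevanlinna counting function is $N_\varphi(z)=\sum_{\varphi(\zeta)=z}\log\frac1{|\zeta|}$, the sum being over preimages $\zeta\in\mathbb{D}$ of $z$ counted with multiplicity. $\mathcal{S}_p$ denotes the compact operators between Hilbert spaces whose singular numbers form a sequence in $\ell^p$.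 *)

theory Defs
  imports "HOL-Complex_Analysis.Complex_Analysis" "HOL-Library.Function_Algebras"
begin

abbreviation unit_disk :: "complex set" (\<open>\<bbbD>\<close>)
  where "\<bbbD> \<equiv> ball 0 1"


subsection \<open>Operators between Hilbert spaces of functions\<close>

text \<open>
  A Hilbert space of complex-valued functions is given by its carrier and its inner product
  (linear in the first argument); the vector operations are pointwise.
\<close>

record 'x hspace =
  hcarrier :: "('x \<Rightarrow> complex) set"
  hinner :: "('x \<Rightarrow> complex) \<Rightarrow> ('x \<Rightarrow> complex) \<Rightarrow> complex"

definition hnorm :: "'x hspace \<Rightarrow> ('x \<Rightarrow> complex) \<Rightarrow> real"
  where "hnorm V f = sqrt (Re (hinner V f f))"

definition cfun_scale :: "complex \<Rightarrow> ('x \<Rightarrow> complex) \<Rightarrow> 'x \<Rightarrow> complex"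
  where "cfun_scale c f = (\<lambda>x. c * f x)"

global_interpretation cfun: vector_space cfun_scale
  by unfold_locales (auto simp: cfun_scale_def fun_eq_iff algebra_simps)

definition linear_operator ::
    "'x hspace \<Rightarrow> 'y hspace \<Rightarrow> (('x \<Rightarrow> complex) \<Rightarrow> 'y \<Rightarrow> complex) \<Rightarrow> bool"
  where "linear_operator V W T \<longleftrightarrow>
    T \<in> hcarrier V \<rightarrow> hcarrier W \<and>
    (\<forall>f\<in>hcarrier V. \<forall>g\<in>hcarrier V. T (f + g) = T f + T g) \<and>
    (\<forall>c. \<forall>f\<in>hcarrier V. T (cfun_scale c f) = cfun_scale c (T f))"

definition compact_operator ::
    "'x hspace \<Rightarrow> 'y hspace \<Rightarrow> (('x \<Rightarrow> complex) \<Rightarrow> 'y \<Rightarrow> complex) \<Rightarrow> bool"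
  where "compact_operator V W T \<longleftrightarrow>
    linear_operator V W T \<and>
    (\<forall>f :: nat \<Rightarrow> 'x \<Rightarrow> complex.
       (\<forall>n. f n \<in> hcarrier V \<and> hnorm V (f n) \<le> 1) \<longrightarrow>
       (\<exists>r g. strict_mono (r :: nat \<Rightarrow> nat) \<and> g \<in> hcarrier W \<and>
          (\<lambda>n. hnorm W (T (f (r n)) - g)) \<longlonglongrightarrow> 0))"

text \<open>The graph of the Hilbert space adjoint of \<open>T\<close>: the pairs \<open>(w, v)\<close> with \<open>v = T\<^sup>* w\<close>.\<close>

definition adjoint_graph ::
    "'x hspace \<Rightarrow> 'y hspace \<Rightarrow> (('x \<Rightarrow> complex) \<Rightarrow> 'y \<Rightarrow> complex)
      \<Rightarrow> (('y \<Rightarrow> complex) \<times> ('x \<Rightarrow> complex)) set"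
  where "adjoint_graph V W T =
    {(w, v). w \<in> hcarrier W \<and> v \<in> hcarrier V \<and>
       (\<forall>f\<in>hcarrier V. hinner W (T f) w = hinner V f v)}"

text \<open>The space of all \<open>f\<close> with \<open>T\<^sup>* T f = t\<^sup>2 f\<close>.\<close>

definition singular_eigenspace ::
    "'x hspace \<Rightarrow> 'y hspace \<Rightarrow> (('x \<Rightarrow> complex) \<Rightarrow> 'y \<Rightarrow> complex) \<Rightarrow> real
      \<Rightarrow> ('x \<Rightarrow> complex) set"
  where "singular_eigenspace V W T t =
    {f \<in> hcarrier V. (T f, cfun_scale (of_real (t\<^sup>2)) f) \<in> adjoint_graph V W T}"

text \<open>
  For compact \<open>T\<close>, \<open>s\<close> is the decreasing enumeration of the square roots of the nonzero
  eigenvalues of \<open>T\<^sup>* T\<close>, repeated according to multiplicity, followed by zeros if there are only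
  finitely many. Compactness makes all the eigenspaces below finite-dimensional, and
  \<open>s \<longlonglongrightarrow> 0\<close> makes the sets counted by \<open>card\<close> finite.
\<close>

definition singular_numbers ::
    "'x hspace \<Rightarrow> 'y hspace \<Rightarrow> (('x \<Rightarrow> complex) \<Rightarrow> 'y \<Rightarrow> complex) \<Rightarrow> (nat \<Rightarrow> real) \<Rightarrow> bool"
  where "singular_numbers V W T s \<longleftrightarrow>
    (\<forall>n. 0 \<le> s n) \<and> decseq s \<and> s \<longlonglongrightarrow> 0 \<and>
    (\<forall>t>0. card {n. s n = t} = cfun.dim (singular_eigenspace V W T t))"

definition schatten_class ::
    "real \<Rightarrow> 'x hspace \<Rightarrow> 'y hspace \<Rightarrow> (('x \<Rightarrow> complex) \<Rightarrow> 'y \<Rightarrow> complex) set"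
  where "schatten_class p V W =
    {T. compact_operator V W T \<and>
        (\<exists>s. singular_numbers V W T s \<and> summable (\<lambda>n. s n powr p))}"


subsection \<open>Hardy space, inner functions and model spaces\<close>

definition taylor_coeff :: "(complex \<Rightarrow> complex) \<Rightarrow> nat \<Rightarrow> complex"
  where "taylor_coeff f n = (deriv ^^ n) f 0 / fact n"

text \<open>
  Functions on the disk are extended by zero to all of \<open>\<complex>\<close>, so that equality of members of the
  Hardy space is equality on the disk (otherwise dimensions would be wrong).
\<close>

definition hardy_space :: "complex hspace"
  where "hardy_space =
    \<lparr> hcarrier = {f. f holomorphic_on \<bbbD> \<and> (\<forall>z. z \<notin> \<bbbD> \<longrightarrow> f z = 0) \<and>
                     summable (\<lambda>n. (cmod (taylor_coeff f n))\<^sup>2)},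
      hinner = (\<lambda>f g. \<Sum>n. taylor_coeff f n * cnj (taylor_coeff g n)) \<rparr>"

definition stolz_region :: "real \<Rightarrow> complex \<Rightarrow> complex set"
  where "stolz_region \<alpha> \<xi> = {z \<in> \<bbbD>. cmod (z - \<xi>) < \<alpha> * (1 - cmod z)}"

definition nontangential_limit :: "(complex \<Rightarrow> complex) \<Rightarrow> complex \<Rightarrow> complex \<Rightarrow> bool"
  where "nontangential_limit f \<xi> l \<longleftrightarrow>
    (\<forall>\<alpha>>1. (f \<longlongrightarrow> l) (at \<xi> within stolz_region \<alpha> \<xi>))"

definition inner_function :: "(complex \<Rightarrow> complex) \<Rightarrow> bool"
  where "inner_function \<theta> \<longleftrightarrow>
    \<theta> holomorphic_on \<bbbD> \<and> bounded (\<theta> ` \<bbbD>) \<and>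
    (AE t in lebesgue_on {0..2 * pi}. \<exists>l. cmod l = 1 \<and> nontangential_limit \<theta> (cis t) l)"

definition model_space :: "(complex \<Rightarrow> complex) \<Rightarrow> complex hspace"
  where "model_space \<theta> =
    \<lparr> hcarrier = {f \<in> hcarrier hardy_space.
                    \<forall>g\<in>hcarrier hardy_space. hinner hardy_space f (\<lambda>z. \<theta> z * g z) = 0},
      hinner = hinner hardy_space \<rparr>"

definition model_kernel :: "(complex \<Rightarrow> complex) \<Rightarrow> complex \<Rightarrow> complex \<Rightarrow> complex"
  where "model_kernel \<theta> w z = (1 - cnj (\<theta> w) * \<theta> z) / (1 - cnj w * z)"

definition composition_operator ::
    "(complex \<Rightarrow> complex) \<Rightarrow> (complex \<Rightarrow> complex) \<Rightarrow> complex \<Rightarrow> complex"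
  where "composition_operator \<phi> f = (\<lambda>z. if z \<in> \<bbbD> then f (\<phi> z) else 0)"


subsection \<open>Area integrals, the Laplacian and the counting function\<close>

definition area_measure :: "complex measure"
  where "area_measure = scale_measure (ennreal (1 / pi)) (lebesgue_on \<bbbD>)"

definition differentiation_bounded :: "complex hspace \<Rightarrow> (complex \<Rightarrow> real) \<Rightarrow> bool"
  where "differentiation_bounded V \<Phi> \<longleftrightarrow>
    (\<exists>C::real. \<forall>f\<in>hcarrier V.
       (\<integral>\<^sup>+z. ennreal ((cmod (deriv f z))\<^sup>2 * \<Phi> z) \<partial>area_measure) \<le> ennreal (C * (hnorm V f)\<^sup>2))"

definition laplacian :: "(complex \<Rightarrow> real) \<Rightarrow> complex \<Rightarrow> real"
  where "laplacian u z =
    (deriv ^^ 2) (\<lambda>x. u (Complex x (Im z))) (Re z) +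
    (deriv ^^ 2) (\<lambda>y. u (Complex (Re z) y)) (Im z)"

text \<open>
  The multiplicity with which \<open>\<phi>\<close> takes the value \<open>\<phi> \<zeta>\<close> at \<open>\<zeta>\<close>. It is infinite for constant
  \<open>\<phi>\<close>, where \<^const>\<open>zorder\<close> is unspecified.
\<close>

definition value_multiplicity :: "(complex \<Rightarrow> complex) \<Rightarrow> complex \<Rightarrow> ennreal"
  where "value_multiplicity \<phi> \<zeta> =
    (if \<phi> constant_on \<bbbD> then \<infinity> else ennreal (of_int (zorder (\<lambda>w. \<phi> w - \<phi> \<zeta>) \<zeta>)))"

text \<open>The case distinction is needed because \<open>ln (1 / 0) = 0\<close> in HOL, while here it means \<open>\<infinity>\<close>.\<close>

definition nevanlinna_counting :: "(complex \<Rightarrow> complex) \<Rightarrow> complex \<Rightarrow> ennreal"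
  where "nevanlinna_counting \<phi> z =
    (\<Sum>\<^sub>\<infinity>\<zeta>\<in>{\<zeta> \<in> \<bbbD>. \<phi> \<zeta> = z}.
       value_multiplicity \<phi> \<zeta> * (if \<zeta> = 0 then \<infinity> else ennreal (ln (1 / cmod \<zeta>))))"

text \<open>Powers of extended nonnegative reals with a positive real exponent.\<close>

definition ennreal_powr :: "ennreal \<Rightarrow> real \<Rightarrow> ennreal"
  where "ennreal_powr x a = (if x = \<infinity> then \<infinity> else ennreal (enn2real x powr a))"

end

theory Submission
  imports Defs "HOL-Real_Asymp.Real_Asymp"
begin

text \<open>
  Put \<open>q = p / 2\<close>, let \<open>k\<close> be the kernel of the model space \<open>K\<close> and \<open>T\<close> the composition operator.
  The theorem follows from three inequalities for the eigenvectors \<open>e\<^sub>n\<close> of \<open>T\<^sup>* T\<close>, an orthonormal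
  system with \<open>T\<^sup>* T e\<^sub>n = s\<^sub>n\<^sup>2 e\<^sub>n\<close>.

  First, Littlewood-Paley and the area formula bound \<open>s\<^sub>n\<^sup>2 = \<parallel>T e\<^sub>n\<parallel>\<^sup>2\<close> by
  \<open>\<bar>e\<^sub>n(\<phi>(0))\<bar>\<^sup>2 + 2 \<integral> N \<bar>e\<^sub>n'\<bar>\<^sup>2 dA\<close> (\<open>littlewood_paley_composition\<close>). Here \<open>N\<close> is a Borel function below
  the counting function, obtained by ignoring the critical points of \<open>\<phi>\<close>; as it is a lower bound,
  replacing the counting function by it only decreases the integral of the hypothesis.

  Second, the measure \<open>\<bar>e\<^sub>n'\<bar>\<^sup>2 \<Phi> dA\<close> has total mass at most \<open>C\<close>, because differentiation is bounded, so
  Jensen's inequality for the power \<open>q \<ge> 1\<close> (\<open>nn_integral_power_mean\<close>) gives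
  \<open>(\<integral> N \<bar>e\<^sub>n'\<bar>\<^sup>2 dA)\<^sup>q \<le> C\<^sup>q\<^sup>-\<^sup>1 \<integral> (N / \<Phi>)\<^sup>q \<bar>e\<^sub>n'\<bar>\<^sup>2 \<Phi> dA\<close>.

  Third, evaluation of the derivative at \<open>z\<close> is a functional on \<open>K\<close> whose squared norm is at most a quarter
  of \<open>\<Delta>k(z,z)\<close> (\<open>derivative_kernel_properties\<close>, \<open>laplacian_model_kernel\<close>), so by Bessel's inequality
  \<open>\<Sum>\<^sub>n \<bar>e\<^sub>n'(z)\<bar>\<^sup>2 \<le> \<Delta>k(z,z) / 4\<close>. Summing the second inequality over \<open>n\<close> therefore reproduces the integral of
  the hypothesis; the point values \<open>e\<^sub>n(\<phi>(0))\<close> are summed by Bessel's inequality as well.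

  The same bounds give compactness: if \<open>d\<^sub>n\<close> tends weakly to zero in \<open>K\<close> then \<open>d\<^sub>n'\<close> tends to zero pointwise,
  \<open>\<bar>d\<^sub>n'(z)\<bar>\<^sup>2\<close> is dominated by a multiple of \<open>\<Delta>k(z,z)\<close>, and dominated convergence together with Jensen's
  inequality yields \<open>\<parallel>T d\<^sub>n\<parallel> \<rightarrow> 0\<close> (\<open>composition_null_sequence\<close>). Since bounded sequences in the Hardy space
  have weakly convergent subsequences (Montel), the eigenvectors can be constructed one at a time, \<open>e\<^sub>n\<close>
  maximizing \<open>\<parallel>T f\<parallel>\<close> over the unit vectors orthogonal to its predecessors
  (\<open>singular_numbers_singular_value\<close>).
\<close>


section \<open>Change of variables for holomorphic maps\<close>

text \<open>
  Such a map permutes the coordinates, so the preimage of a box is a box with the same side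
  lengths. It lets the plane be treated as a product of two lines (for Fubini) and as a space of column
  vectors (where the Jacobian determinant lives).
\<close>

lemma distr_lborel_basis_bijection:
  fixes J :: "'a::euclidean_space \<Rightarrow> 'b::euclidean_space"
  assumes lin: "linear J" and bij: "bij_betw J Basis Basis"
  shows "distr lborel borel J = lborel"
proof (rule lborel_eqI[symmetric])
  have meas: "J \<in> borel_measurable borel"
    using lin by (simp add: borel_measurable_continuous_onI linear_continuous_on linear_conv_bounded_linear)
  have coord: "J x \<bullet> J b = x \<bullet> b" if b: "b \<in> Basis" for x b
  proof -
    have "J x = J (\<Sum>i\<in>Basis. (x \<bullet> i) *\<^sub>R i)"
      by (simp add: euclidean_representation)
    also have "\<dots> = (\<Sum>i\<in>Basis. (x \<bullet> i) *\<^sub>R J i)"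
      using lin by (simp add: linear_sum linear_cmul)
    finally have "J x \<bullet> J b = (\<Sum>i\<in>Basis. (x \<bullet> i) * (J i \<bullet> J b))"
      by (simp add: inner_sum_left)
    also have "\<dots> = (\<Sum>i\<in>Basis. if i = b then x \<bullet> i else 0)"
    proof (intro sum.cong refl)
      fix i :: 'a assume i: "i \<in> Basis"
      have "J i \<in> Basis" "J b \<in> Basis" using i b bij by (auto simp: bij_betw_def)
      moreover have "J i = J b \<longleftrightarrow> i = b"
        using i b bij by (auto simp: bij_betw_def inj_on_def)
      ultimately show "(x \<bullet> i) * (J i \<bullet> J b) = (if i = b then x \<bullet> i else 0)"
        by (auto simp: inner_Basis)
    qed
    finally show ?thesis using b by simp
  qed
  fix l u :: 'b assume le: "\<And>b. b \<in> Basis \<Longrightarrow> l \<bullet> b \<le> u \<bullet> b"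
  \<comment> \<open>\<open>L\<close> is the inverse of \<open>J\<close>, given by its coordinates.\<close>
  define L where "L v = (\<Sum>b\<in>Basis. (v \<bullet> J b) *\<^sub>R b)" for v :: 'b
  have L: "L v \<bullet> b = v \<bullet> J b" if "b \<in> Basis" for v b
    using that by (simp add: L_def)
  have Jb: "J b \<in> Basis" if "b \<in> Basis" for b using that bij by (auto simp: bij_betw_def)
  have "J -` box l u = box (L l) (L u)"
  proof -
    have B: "Basis = J ` Basis" using bij by (simp add: bij_betw_def)
    have "(\<forall>b\<in>Basis. l \<bullet> b < J x \<bullet> b \<and> J x \<bullet> b < u \<bullet> b) \<longleftrightarrow>
      (\<forall>b\<in>Basis. l \<bullet> J b < J x \<bullet> J b \<and> J x \<bullet> J b < u \<bullet> J b)" for x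
      by (subst B) simp
    then show ?thesis by (auto simp: box_def L coord)
  qed
  then have "emeasure (distr lborel borel J) (box l u) = emeasure lborel (box (L l) (L u))"
    using meas by (simp add: emeasure_distr)
  also have "\<dots> = (\<Prod>b\<in>Basis. (L u - L l) \<bullet> b)"
    using le Jb L by (subst emeasure_lborel_box) auto
  also have "(\<Prod>b\<in>Basis. (L u - L l) \<bullet> b) = (\<Prod>b\<in>Basis. (u - l) \<bullet> J b)"
    by (intro prod.cong) (auto simp: inner_diff_left L)
  also have "\<dots> = (\<Prod>b\<in>Basis. (u - l) \<bullet> b)"
    using bij by (rule prod.reindex_bij_betw)
  finally show "emeasure (distr lborel borel J) (box l u) = ennreal (\<Prod>b\<in>Basis. (u - l) \<bullet> b)" .
qed auto

lemma distr_lborel_Complex: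
  "distr (lborel :: (real \<times> real) measure) borel (\<lambda>(x, y). Complex x y) = lborel"
proof (rule distr_lborel_basis_bijection)
  show "linear (\<lambda>(x, y). Complex x y)"
    by (rule linearI) (auto simp: complex_eq_iff)
  show "bij_betw (\<lambda>(x, y). Complex x y) Basis Basis"
    by (rule bij_betw_byWitness[where f' = "\<lambda>z. (Re z, Im z)"])
       (auto simp: Basis_prod_def Basis_complex_def complex_eq_iff)
qed

lemma distr_lborel_vec_Complex:
  "distr (lborel :: (real ^ 2) measure) borel (\<lambda>v. Complex (v $ 1) (v $ 2)) = lborel"
proof (rule distr_lborel_basis_bijection)
  show "linear (\<lambda>v::real^2. Complex (v $ 1) (v $ 2))"
    by (rule linearI) (auto simp: complex_eq_iff)
  show "bij_betw (\<lambda>v::real^2. Complex (v $ 1) (v $ 2)) Basis Basis"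
    by (rule bij_betw_byWitness[where f' = "\<lambda>z. vector [Re z, Im z]"])
       (auto simp: Basis_vec_def Basis_complex_def complex_eq_iff vec_eq_iff forall_2 axis_def UNIV_2)
qed

lemma borel_measurable_deriv_on_open:
  fixes \<phi> :: "complex \<Rightarrow> complex"
  assumes U: "open U" and hol: "\<phi> holomorphic_on U" and S: "S \<in> sets borel" "S \<subseteq> U"
  shows "(\<lambda>z. ennreal ((cmod (deriv \<phi> z))\<^sup>2) * indicator S z) \<in> borel_measurable borel"
    and "(\<lambda>z. indicat_real S z * (cmod (deriv \<phi> z))\<^sup>2) \<in> borel_measurable borel"
proof -
  have cont: "continuous_on U (deriv \<phi>)"
    using hol U by (intro holomorphic_on_imp_continuous_on holomorphic_deriv)
  have m: "(\<lambda>z. indicat_real U z * (cmod (deriv \<phi> z))\<^sup>2) \<in> borel_measurable borel"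
    using borel_measurable_continuous_on_indicator[of U "\<lambda>z. (cmod (deriv \<phi> z))\<^sup>2"] U
      continuous_on_power[OF continuous_on_norm[OF cont], of 2] by simp
  have "(\<lambda>z. ennreal (indicat_real U z * (cmod (deriv \<phi> z))\<^sup>2) * indicator S z) \<in> borel_measurable borel"
    using S(1) m by measurable
  also have "(\<lambda>z. ennreal (indicat_real U z * (cmod (deriv \<phi> z))\<^sup>2) * indicator S z)
      = (\<lambda>z. ennreal ((cmod (deriv \<phi> z))\<^sup>2) * indicator S z)"
    using S(2) by (auto simp: fun_eq_iff indicator_def)
  finally show "(\<lambda>z. ennreal ((cmod (deriv \<phi> z))\<^sup>2) * indicator S z) \<in> borel_measurable borel" .
  have "(\<lambda>z. indicat_real S z * (indicat_real U z * (cmod (deriv \<phi> z))\<^sup>2)) \<in> borel_measurable borel"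
    using S(1) m by measurable
  also have "(\<lambda>z. indicat_real S z * (indicat_real U z * (cmod (deriv \<phi> z))\<^sup>2))
      = (\<lambda>z. indicat_real S z * (cmod (deriv \<phi> z))\<^sup>2)"
    using S(2) by (auto simp: fun_eq_iff indicator_def)
  finally show "(\<lambda>z. indicat_real S z * (cmod (deriv \<phi> z))\<^sup>2) \<in> borel_measurable borel" .
qed

text \<open>
  By the Cauchy-Riemann equations the real Jacobian determinant of a holomorphic map is the
  squared modulus of its derivative. The real change of variables theorem concerns sets of finite measure,
  hence the case distinction on the measure of the image.
\<close>

lemma emeasure_holomorphic_image_lborel:
  assumes U: "open U" and hol: "\<phi> holomorphic_on U" and inj: "inj_on \<phi> U"
    and S: "S \<in> sets borel" "S \<subseteq> U" and im: "\<phi> ` S \<in> sets borel"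
  shows "emeasure lborel (\<phi> ` S) = (\<integral>\<^sup>+z. ennreal ((cmod (deriv \<phi> z))\<^sup>2) * indicator S z \<partial>lborel)"
proof -
  define J :: "real^2 \<Rightarrow> complex" where "J = (\<lambda>v. Complex (v $ 1) (v $ 2))"
  define K :: "complex \<Rightarrow> real^2" where "K = (\<lambda>z. vector [Re z, Im z])"
  have JK[simp]: "J (K z) = z" for z by (simp add: J_def K_def)
  have KJ[simp]: "K (J v) = v" for v by (simp add: J_def K_def vec_eq_iff forall_2)
  have linJ: "linear J" unfolding J_def by (rule linearI) (auto simp: complex_eq_iff)
  have linK: "linear K" unfolding K_def by (rule linearI) (auto simp: vec_eq_iff forall_2)
  have blJ: "bounded_linear J" and blK: "bounded_linear K"
    using linJ linK by (auto simp: linear_conv_bounded_linear)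
  have measJ[measurable]: "J \<in> borel_measurable borel"
    using linJ by (simp add: borel_measurable_continuous_onI linear_continuous_on linear_conv_bounded_linear)
  have distr: "distr lborel borel J = lborel" unfolding J_def by (rule distr_lborel_vec_Complex)
  define f where "f = (\<lambda>v. K (\<phi> (J v)))"
  define f' where "f' = (\<lambda>v w. K (deriv \<phi> (J v) * J w))"
  define T where "T = J -` S"
  have TB: "T \<in> sets borel" unfolding T_def using measurable_sets[OF measJ S(1)] by simp
  then have T: "T \<in> sets lebesgue" by (simp add: sets_completionI_sets)
  have der: "(f has_derivative f' v) (at v within T)" if "v \<in> T" for v
  proof -
    have "(\<phi> has_field_derivative deriv \<phi> (J v)) (at (J v))"
      using that S U hol by (intro holomorphic_derivI[of _ U]) (auto simp: T_def)
    then have "(\<phi> has_derivative (\<lambda>w. deriv \<phi> (J v) * w)) (at (J v))"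
      by (simp add: has_field_derivative_def)
    then have "((\<lambda>v. \<phi> (J v)) has_derivative (\<lambda>w. deriv \<phi> (J v) * J w)) (at v)"
      by (rule has_derivative_compose[OF bounded_linear.has_derivative[OF blJ has_derivative_ident]])
    from bounded_linear.has_derivative[OF blK this] show ?thesis
      unfolding f_def f'_def by (rule has_derivative_at_withinI)
  qed
  have det: "\<bar>det (matrix (f' v))\<bar> = (cmod (deriv \<phi> (J v)))\<^sup>2" for v
    by (simp add: det_2 matrix_def f'_def J_def K_def axis_def cmod_power2) (simp add: power2_eq_square)
  have injf: "inj_on f T"
  proof (rule inj_onI)
    fix x y assume "x \<in> T" "y \<in> T" "f x = f y"
    then have "\<phi> (J x) = \<phi> (J y)" unfolding f_def by (metis JK)
    then have "J x = J y" using \<open>x \<in> T\<close> \<open>y \<in> T\<close> S inj by (auto simp: T_def inj_on_def)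
    then show "x = y" by (metis KJ)
  qed
  have fT: "f ` T = J -` (\<phi> ` S)"
  proof (intro subset_antisym subsetI)
    fix x assume "x \<in> J -` (\<phi> ` S)"
    then obtain w where w: "w \<in> S" "J x = \<phi> w" by auto
    have "x = K (J x)" by (rule KJ[symmetric])
    also have "\<dots> = f (K w)" using w(2) unfolding f_def by (simp only: JK)
    finally have "x = f (K w)" .
    moreover have "K w \<in> T" unfolding T_def using w(1) by (simp only: vimage_eq JK)
    ultimately show "x \<in> f ` T" by blast
  next
    fix x assume "x \<in> f ` T"
    then obtain v where "v \<in> T" "x = f v" by blast
    then show "x \<in> J -` (\<phi> ` S)" by (simp add: f_def T_def)
  qed
  have fTB: "f ` T \<in> sets borel"
    unfolding fT using measurable_sets[OF measJ im] by simp
  have "emeasure lborel (\<phi> ` S) = emeasure (distr lborel borel J) (\<phi> ` S)" by (simp add: distr)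
  also have "\<dots> = emeasure lborel (f ` T)" using im by (simp add: emeasure_distr fT)
  also have "\<dots> = (\<integral>\<^sup>+v. ennreal \<bar>det (matrix (f' v))\<bar> * indicator T v \<partial>lborel)"
  proof -
    let ?d = "\<lambda>v. \<bar>det (matrix (f' v))\<bar>"
    have "(\<lambda>v. indicat_real S (J v) * (cmod (deriv \<phi> (J v)))\<^sup>2) \<in> borel_measurable borel"
      using measurable_compose[OF measJ borel_measurable_deriv_on_open(2)[OF U hol S]] .
    also have "(\<lambda>v. indicat_real S (J v) * (cmod (deriv \<phi> (J v)))\<^sup>2) = (\<lambda>v. indicat_real T v * ?d v)"
      by (auto simp: det T_def fun_eq_iff indicator_def)
    finally have dB[measurable]: "(\<lambda>v. indicat_real T v * ?d v) \<in> borel_measurable borel" .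
    have eqd: "(\<integral>\<^sup>+v. ennreal (?d v) * indicator T v \<partial>lborel) = (\<integral>\<^sup>+v. ennreal (indicat_real T v * ?d v) \<partial>lborel)"
      by (intro nn_integral_cong) (auto simp: indicator_def)
    have eql: "emeasure lborel (f ` T) = emeasure lebesgue (f ` T)"
      using fTB by simp
    show ?thesis
    proof (cases "f ` T \<in> lmeasurable")
      case True
      then have ai: "?d absolutely_integrable_on T"
        using measurable_differentiable_image_alt[OF T der injf] by simp
      then have "?d integrable_on T" unfolding absolutely_integrable_on_def by simp
      then have m: "measure lebesgue (f ` T) = integral T ?d"
        using measure_differentiable_image_eq[OF T der injf] by simp
      from ai have "integrable lebesgue (\<lambda>v. indicat_real T v * ?d v)"
        unfolding set_integrable_def by simp
      then have I: "integrable lborel (\<lambda>v. indicat_real T v * ?d v)"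
        by (subst (asm) integrable_completion) auto
      have "integral T ?d = (\<integral>v. indicat_real T v * ?d v \<partial>lebesgue)"
        using set_lebesgue_integral_eq_integral(2)[OF ai] by (simp add: set_lebesgue_integral_def)
      also have "\<dots> = (\<integral>v. indicat_real T v * ?d v \<partial>lborel)"
        by (rule integral_completion) simp
      finally have "ennreal (measure lebesgue (f ` T)) = (\<integral>\<^sup>+v. ennreal (indicat_real T v * ?d v) \<partial>lborel)"
        using I m by (subst nn_integral_eq_integral) auto
      then show ?thesis
        using True by (simp add: eqd eql emeasure_eq_measure2)
    next
      case False
      then have inf1: "emeasure lborel (f ` T) = \<infinity>"
        using fmeasurableI[of "f ` T" lebesgue] sets_completionI_sets[of "f ` T" lborel] fTB eql
        by (metis less_top infinity_ennreal_def sets_lborel)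
      have "(\<integral>\<^sup>+v. ennreal (indicat_real T v * ?d v) \<partial>lborel) = \<infinity>"
      proof (rule ccontr)
        assume "\<not> ?thesis"
        then have "integrable lborel (\<lambda>v. indicat_real T v * ?d v)"
          by (intro integrableI_bounded) (auto simp: less_top abs_mult)
        then have "integrable lebesgue (\<lambda>v. indicat_real T v * ?d v)"
          by (subst integrable_completion) auto
        then have "?d absolutely_integrable_on T" by (simp add: set_integrable_def)
        then show False using False measurable_differentiable_image_alt[OF T der injf] by simp
      qed
      then show ?thesis by (simp add: inf1 eqd)
    qed
  qed
  also have "\<dots> = (\<integral>\<^sup>+v. ennreal ((cmod (deriv \<phi> (J v)))\<^sup>2) * indicator S (J v) \<partial>lborel)"
    by (intro nn_integral_cong) (auto simp: det T_def indicator_def)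
  also have "\<dots> = (\<integral>\<^sup>+z. ennreal ((cmod (deriv \<phi> z))\<^sup>2) * indicator S z \<partial>distr lborel borel J)"
    using borel_measurable_deriv_on_open(1)[OF U hol S] by (subst nn_integral_distr) auto
  finally show ?thesis by (simp add: distr)
qed


text \<open>
  The inverse of an injective holomorphic map is continuous on the open image; extended by zero it
  is a Borel function whose preimages are the images under the original map.
\<close>

lemma borel_holomorphic_image:
  assumes U: "open U" and hol: "\<phi> holomorphic_on U" and inj: "inj_on \<phi> U"
    and S: "S \<in> sets borel" "S \<subseteq> U"
  obtains \<psi> where "\<And>z. z \<in> U \<Longrightarrow> \<psi> (\<phi> z) = z" "\<psi> \<in> borel_measurable borel"
    "\<phi> ` S \<in> sets borel"
proof -
  obtain g where g: "g holomorphic_on (\<phi> ` U)" "\<And>z. z \<in> U \<Longrightarrow> g (\<phi> z) = z"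
    using holomorphic_has_inverse[OF hol U inj] by metis
  have op: "open (\<phi> ` U)" by (rule open_mapping_thm3[OF hol U inj])
  define \<psi> where "\<psi> z = indicat_real (\<phi> ` U) z *\<^sub>R g z" for z
  have \<psi>: "\<psi> \<in> borel_measurable borel"
    unfolding \<psi>_def using op g(1)
    by (intro borel_measurable_continuous_on_indicator) (auto intro: holomorphic_on_imp_continuous_on)
  have inv: "\<psi> (\<phi> z) = z" if "z \<in> U" for z using that g(2) by (simp add: \<psi>_def)
  have "\<phi> ` S = \<psi> -` S \<inter> \<phi> ` U"
    using S(2) inv by (auto simp: image_iff)
  moreover have "\<psi> -` S \<in> sets borel" using measurable_sets[OF \<psi> S(1)] by simp
  ultimately have "\<phi> ` S \<in> sets borel" using op by auto
  with inv \<psi> that show ?thesis by blast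
qed

text \<open>
  Both sides are integrals of \<open>F\<close> against measures on the plane, which agree on Borel sets
  by the formula for the area of an image.
\<close>

lemma nn_integral_holomorphic_substitution:
  fixes F :: "complex \<Rightarrow> ennreal"
  assumes U: "open U" and hol: "\<phi> holomorphic_on U" and inj: "inj_on \<phi> U"
    and E: "E \<in> sets borel" "E \<subseteq> U" and F[measurable]: "F \<in> borel_measurable borel"
  shows "(\<integral>\<^sup>+z. F (\<phi> z) * (ennreal ((cmod (deriv \<phi> z))\<^sup>2) * indicator E z) \<partial>lborel)
    = (\<integral>\<^sup>+z. F z * indicator (\<phi> ` E) z \<partial>lborel)"
proof -
  \<comment> \<open>\<open>\<phi>\<close> is arbitrary outside \<open>U\<close>, so it is cut off there to become a Borel function.\<close>
  define \<phi>0 where "\<phi>0 z = indicat_real U z *\<^sub>R \<phi> z" for z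
  have \<phi>0[measurable]: "\<phi>0 \<in> borel_measurable borel"
    unfolding \<phi>0_def using U hol
    by (intro borel_measurable_continuous_on_indicator) (auto intro: holomorphic_on_imp_continuous_on)
  have \<phi>0_eq: "\<phi>0 z = \<phi> z" if "z \<in> U" for z using that by (simp add: \<phi>0_def)
  have imB: "\<phi> ` S \<in> sets borel" if "S \<in> sets borel" "S \<subseteq> U" for S
    using borel_holomorphic_image[OF U hol inj that] by blast
  note imE[measurable] = imB[OF E]
  note d[measurable] = borel_measurable_deriv_on_open(1)[OF U hol E]
  let ?d = "\<lambda>z. ennreal ((cmod (deriv \<phi> z))\<^sup>2) * indicator E z"
  have eq: "distr (density lborel ?d) borel \<phi>0 = density lborel (indicator (\<phi> ` E))"
  proof (rule measure_eqI)
    fix B assume "B \<in> sets (distr (density lborel ?d) borel \<phi>0)"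
    then have B[measurable]: "B \<in> sets borel" by simp
    define S where "S = E \<inter> \<phi>0 -` B"
    have "\<phi>0 -` B \<in> sets borel" using measurable_sets[OF \<phi>0 B] by simp
    then have S: "S \<in> sets borel" "S \<subseteq> U" using E by (auto simp: S_def)
    have im: "\<phi> ` S = B \<inter> \<phi> ` E" using E(2) \<phi>0_eq by (auto simp: S_def image_iff)
    have "emeasure (distr (density lborel ?d) borel \<phi>0) B = (\<integral>\<^sup>+z. ?d z * indicator (\<phi>0 -` B) z \<partial>lborel)"
      using \<open>\<phi>0 -` B \<in> sets borel\<close> by (simp add: emeasure_distr emeasure_density)
    also have "\<dots> = (\<integral>\<^sup>+z. ennreal ((cmod (deriv \<phi> z))\<^sup>2) * indicator S z \<partial>lborel)"
      by (intro nn_integral_cong) (auto simp: S_def indicator_def)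
    also have "\<dots> = emeasure lborel (B \<inter> \<phi> ` E)"
      using emeasure_holomorphic_image_lborel[OF U hol inj S imB[OF S]] im by simp
    also have "\<dots> = (\<integral>\<^sup>+z. indicator (B \<inter> \<phi> ` E) z \<partial>lborel)" by simp
    also have "\<dots> = (\<integral>\<^sup>+z. indicator (\<phi> ` E) z * indicator B z \<partial>lborel)"
      by (intro nn_integral_cong) (auto simp: indicator_def)
    also have "\<dots> = emeasure (density lborel (indicator (\<phi> ` E))) B"
      by (simp add: emeasure_density)
    finally show "emeasure (distr (density lborel ?d) borel \<phi>0) B = emeasure (density lborel (indicator (\<phi> ` E))) B" .
  qed simp
  have "(\<integral>\<^sup>+z. F (\<phi> z) * ?d z \<partial>lborel) = (\<integral>\<^sup>+z. ?d z * F (\<phi>0 z) \<partial>lborel)"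
    using E(2) by (intro nn_integral_cong) (auto simp: indicator_def \<phi>0_def mult.commute)
  also have "\<dots> = (\<integral>\<^sup>+z. F z \<partial>distr (density lborel ?d) borel \<phi>0)"
    by (simp add: nn_integral_distr nn_integral_density)
  also have "\<dots> = (\<integral>\<^sup>+z. F z * indicator (\<phi> ` E) z \<partial>lborel)"
    unfolding eq by (simp add: nn_integral_density mult.commute)
  finally show ?thesis .
qed

text \<open>
  A holomorphic map is injective near every point with nonzero derivative, and countably many such
  neighbourhoods suffice by Lindelof's theorem.
\<close>

lemma injective_borel_partition:
  fixes \<phi> :: "complex \<Rightarrow> complex"
  assumes D: "open D" and hol: "\<phi> holomorphic_on D"
  obtains E U :: "nat \<Rightarrow> complex set" where
    "\<And>n. E n \<in> sets borel" "\<And>n. E n \<subseteq> U n" "\<And>n. open (U n)" "\<And>n. U n \<subseteq> D"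
    "\<And>n. inj_on \<phi> (U n)" "disjoint_family E" "(\<Union>n. E n) = {z \<in> D. deriv \<phi> z \<noteq> 0}"
proof -
  define R where "R = {z \<in> D. deriv \<phi> z \<noteq> 0}"
  have "continuous_on D (deriv \<phi>)"
    using hol D by (intro holomorphic_on_imp_continuous_on holomorphic_deriv)
  then have oR: "open R" 
    using continuous_open_preimage[of D "deriv \<phi>" "-{0}"] D by (simp add: R_def vimage_def Int_def open_Compl)
  have holR: "\<phi> holomorphic_on R" using hol by (rule holomorphic_on_subset) (auto simp: R_def)
  have "\<exists>r>0. ball z r \<subseteq> R \<and> inj_on \<phi> (ball z r)" if zR: "z \<in> R" for z
  proof -
    have "deriv \<phi> z \<noteq> 0" using zR by (simp add: R_def)
    then obtain r where "r > 0" "ball z r \<subseteq> R" "inj_on \<phi> (ball z r)"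
      using has_complex_derivative_locally_injective[OF holR zR oR] by blast
    then show ?thesis by blast
  qed
  then obtain r where r: "\<And>z. z \<in> R \<Longrightarrow> r z > 0 \<and> ball z (r z) \<subseteq> R \<and> inj_on \<phi> (ball z (r z))"
    by metis
  obtain \<F> where \<F>: "\<F> \<subseteq> (\<lambda>z. ball z (r z)) ` R" "countable \<F>" "\<Union>\<F> = (\<Union>z\<in>R. ball z (r z))"
    using Lindelof[of "(\<lambda>z. ball z (r z)) ` R"] by auto
  have UR: "(\<Union>z\<in>R. ball z (r z)) = R" using r by (auto intro!: centre_in_ball[THEN iffD2])
  \<comment> \<open>Inserting the empty set makes the family nonempty, so that it can be enumerated.\<close>
  define U where "U = from_nat_into (insert {} \<F>)"
  have rangeU: "range U = insert {} \<F>"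
    unfolding U_def using \<F>(2) by (intro range_from_nat_into) auto
  have U: "open (U n) \<and> U n \<subseteq> R \<and> inj_on \<phi> (U n)" for n
  proof -
    have "U n \<in> insert {} \<F>" using rangeU by blast
    then show ?thesis using \<F>(1) r by auto
  qed
  show ?thesis
  proof (rule that[of "disjointed U" U])
    show "disjointed U n \<in> sets borel" for n
    proof -
      have "range U \<subseteq> sets borel" using U by auto
      then show ?thesis using sets.range_disjointed_sets[of U borel] by auto
    qed
    show "disjointed U n \<subseteq> U n" for n by (rule disjointed_subset)
    show "open (U n)" "U n \<subseteq> D" "inj_on \<phi> (U n)" for n using U[of n] by (auto simp: R_def)
    show "disjoint_family (disjointed U)" by (rule disjoint_family_disjointed)
    have "(\<Union>n. disjointed U n) = \<Union>(range U)" by (rule UN_disjointed_eq)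
    also have "\<dots> = R" using rangeU \<F>(3) UR by simp
    finally show "(\<Union>n. disjointed U n) = {z \<in> D. deriv \<phi> z \<noteq> 0}" by (simp add: R_def)
  qed
qed

text \<open>
  Summing the substitution rule over the pieces of a partition into sets of injectivity turns the
  left-hand integral into one against \<open>N z\<close>, the weight summed over the regular preimages of \<open>z\<close>. As a
  countable sum of Borel functions \<open>N\<close> is Borel, and each of its partial sums is a finite part of the unordered sum.
\<close>

lemma area_formula_weighted_counting:
  fixes \<phi> :: "complex \<Rightarrow> complex" and W :: "complex \<Rightarrow> ennreal"
  assumes D: "open D" and hol: "\<phi> holomorphic_on D" and W[measurable]: "W \<in> borel_measurable borel"
  obtains N where "N \<in> borel_measurable borel"
    "\<And>z. N z \<le> (\<Sum>\<^sub>\<infinity>\<zeta>\<in>{\<zeta> \<in> D. \<phi> \<zeta> = z \<and> deriv \<phi> \<zeta> \<noteq> 0}. W \<zeta>)"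
    "\<And>F. F \<in> borel_measurable borel \<Longrightarrow>
      (\<integral>\<^sup>+\<zeta>. F (\<phi> \<zeta>) * (W \<zeta> * (ennreal ((cmod (deriv \<phi> \<zeta>))\<^sup>2) * indicator D \<zeta>)) \<partial>lborel)
        = (\<integral>\<^sup>+z. F z * N z \<partial>lborel)"
proof -
  obtain E U :: "nat \<Rightarrow> complex set" where
    E: "\<And>n. E n \<in> sets borel" "\<And>n. E n \<subseteq> U n" and U: "\<And>n. open (U n)" "\<And>n. U n \<subseteq> D"
    and inj: "\<And>n. inj_on \<phi> (U n)" and dis: "disjoint_family E" and un: "(\<Union>n. E n) = {z \<in> D. deriv \<phi> z \<noteq> 0}"
    by (rule injective_borel_partition[OF D hol], rule that)
  have holU: "\<phi> holomorphic_on U n" for n using hol U(2) by (rule holomorphic_on_subset)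
  have "\<exists>\<psi>. (\<forall>z\<in>U n. \<psi> (\<phi> z) = z) \<and> \<psi> \<in> borel_measurable borel \<and> \<phi> ` E n \<in> sets borel" for n
    by (rule borel_holomorphic_image[OF U(1) holU inj E, of n]) blast
  then obtain \<psi> where \<psi>: "\<And>n z. z \<in> U n \<Longrightarrow> \<psi> n (\<phi> z) = z"
    and \<psi>m[measurable]: "\<And>n. \<psi> n \<in> borel_measurable borel" and im[measurable]: "\<And>n. \<phi> ` E n \<in> sets borel"
    by metis
  note d[measurable] = borel_measurable_deriv_on_open(1)[OF U(1) holU E]
  define N where "N z = (\<Sum>n. W (\<psi> n z) * indicator (\<phi> ` E n) z)" for z
  have N[measurable]: "N \<in> borel_measurable borel" unfolding N_def by measurable
  show ?thesis
  proof (rule that[OF N])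
    fix z
    let ?P = "{\<zeta> \<in> D. \<phi> \<zeta> = z \<and> deriv \<phi> \<zeta> \<noteq> 0}"
    have "(\<Sum>n<k. W (\<psi> n z) * indicator (\<phi> ` E n) z) \<le> (\<Sum>\<^sub>\<infinity>\<zeta>\<in>?P. W \<zeta>)" for k
    proof -
      define I where "I = {n. n < k \<and> z \<in> \<phi> ` E n}"
      have I: "\<psi> n z \<in> E n \<and> \<phi> (\<psi> n z) = z" if nI: "n \<in> I" for n
      proof -
        obtain x where x: "x \<in> E n" "z = \<phi> x" using nI by (auto simp: I_def)
        then have "\<psi> n z = x" using \<psi>[of x n] E(2)[of n] by blast
        then show ?thesis using x by simp
      qed
      have injI: "inj_on (\<lambda>n. \<psi> n z) I"
      proof (rule inj_onI)
        fix m n assume "m \<in> I" "n \<in> I" "\<psi> m z = \<psi> n z"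
        then have "\<psi> m z \<in> E m \<inter> E n" using I[of m] I[of n] by simp
        then show "m = n" using dis unfolding disjoint_family_on_def by blast
      qed
      have "(\<Sum>n<k. W (\<psi> n z) * indicator (\<phi> ` E n) z) = (\<Sum>n\<in>I. W (\<psi> n z))"
      proof (rule sum.mono_neutral_cong_right)
        show "\<forall>i\<in>{..<k} - I. W (\<psi> i z) * indicator (\<phi> ` E i) z = 0"
          unfolding I_def indicator_def by simp
        show "W (\<psi> n z) * indicator (\<phi> ` E n) z = W (\<psi> n z)" if "n \<in> I" for n
          using that unfolding I_def indicator_def by simp
      qed (simp_all add: I_def Collect_conj_eq lessThan_def)
      also have "\<dots> = sum W ((\<lambda>n. \<psi> n z) ` I)" using injI by (simp add: sum.reindex)
      also have "\<dots> \<le> (\<Sum>\<^sub>\<infinity>\<zeta>\<in>?P. W \<zeta>)"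
      proof -
        have "E n \<subseteq> {z \<in> D. deriv \<phi> z \<noteq> 0}" for n using un by blast
        then have "(\<lambda>n. \<psi> n z) ` I \<subseteq> ?P" using I by blast
        moreover have "finite ((\<lambda>n. \<psi> n z) ` I)" by (simp add: I_def)
        ultimately show ?thesis
          by (subst nonneg_infsum_complete) (auto intro!: SUP_upper simp del: sum.reindex)
      qed
      finally show ?thesis .
    qed
    then show "N z \<le> (\<Sum>\<^sub>\<infinity>\<zeta>\<in>?P. W \<zeta>)"
      unfolding N_def suminf_eq_SUP by (rule SUP_least)
  next
    fix F :: "complex \<Rightarrow> ennreal" assume F[measurable]: "F \<in> borel_measurable borel"
    have indE: "indicator {z \<in> D. deriv \<phi> z \<noteq> 0} \<zeta> = (\<Sum>n. indicator (E n) \<zeta> :: ennreal)" for \<zeta>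
      using suminf_indicator[OF dis] un by simp
    let ?G = "\<lambda>\<zeta>. F (\<phi> \<zeta>) * W \<zeta>"
    have "(\<integral>\<^sup>+\<zeta>. F (\<phi> \<zeta>) * (W \<zeta> * (ennreal ((cmod (deriv \<phi> \<zeta>))\<^sup>2) * indicator D \<zeta>)) \<partial>lborel)
      = (\<integral>\<^sup>+\<zeta>. (\<Sum>n. ?G \<zeta> * (ennreal ((cmod (deriv \<phi> \<zeta>))\<^sup>2) * indicator (E n) \<zeta>)) \<partial>lborel)"
    proof (rule nn_integral_cong)
      fix \<zeta>
      have "ennreal ((cmod (deriv \<phi> \<zeta>))\<^sup>2) * indicator D \<zeta> = ennreal ((cmod (deriv \<phi> \<zeta>))\<^sup>2) * indicator {z \<in> D. deriv \<phi> z \<noteq> 0} \<zeta>"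
        by (auto simp: indicator_def)
      then show "F (\<phi> \<zeta>) * (W \<zeta> * (ennreal ((cmod (deriv \<phi> \<zeta>))\<^sup>2) * indicator D \<zeta>))
        = (\<Sum>n. ?G \<zeta> * (ennreal ((cmod (deriv \<phi> \<zeta>))\<^sup>2) * indicator (E n) \<zeta>))"
        by (simp add: indE mult.assoc)
    qed
    also have "\<dots> = (\<integral>\<^sup>+\<zeta>. (\<Sum>n. (F (\<phi> \<zeta>) * indicator (E n) \<zeta>) * W \<zeta> * (ennreal ((cmod (deriv \<phi> \<zeta>))\<^sup>2) * indicator (E n) \<zeta>)) \<partial>lborel)"
    proof (intro nn_integral_cong suminf_cong)
      fix \<zeta> n
      show "?G \<zeta> * (ennreal ((cmod (deriv \<phi> \<zeta>))\<^sup>2) * indicator (E n) \<zeta>)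
        = (F (\<phi> \<zeta>) * indicator (E n) \<zeta>) * W \<zeta> * (ennreal ((cmod (deriv \<phi> \<zeta>))\<^sup>2) * indicator (E n) \<zeta>)"
        by (cases "\<zeta> \<in> E n") simp_all
    qed
    also have "\<dots> = (\<Sum>n. \<integral>\<^sup>+\<zeta>. (F (\<phi> \<zeta>) * indicator (E n) \<zeta>) * W \<zeta> * (ennreal ((cmod (deriv \<phi> \<zeta>))\<^sup>2) * indicator (E n) \<zeta>) \<partial>lborel)"
    proof (rule nn_integral_suminf)
      fix n
      have "(\<lambda>z. indicat_real (U n) z *\<^sub>R \<phi> z) \<in> borel_measurable borel"
        using U holU by (intro borel_measurable_continuous_on_indicator) (auto intro: holomorphic_on_imp_continuous_on)
      then have "(\<lambda>\<zeta>. F (indicat_real (U n) \<zeta> *\<^sub>R \<phi> \<zeta>) * indicator (E n) \<zeta>) \<in> borel_measurable borel"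
        using E(1)[of n] by measurable
      also have "(\<lambda>\<zeta>. F (indicat_real (U n) \<zeta> *\<^sub>R \<phi> \<zeta>) * indicator (E n) \<zeta>) = (\<lambda>\<zeta>. F (\<phi> \<zeta>) * indicator (E n) \<zeta>)"
        using E(2)[of n] by (auto simp: indicator_def fun_eq_iff)
      finally have [measurable]: "(\<lambda>\<zeta>. F (\<phi> \<zeta>) * indicator (E n) \<zeta>) \<in> borel_measurable borel" .
      show "(\<lambda>\<zeta>. (F (\<phi> \<zeta>) * indicator (E n) \<zeta>) * W \<zeta> * (ennreal ((cmod (deriv \<phi> \<zeta>))\<^sup>2) * indicator (E n) \<zeta>)) \<in> borel_measurable lborel"
        by measurable
    qed
    also have "\<dots> = (\<Sum>n. \<integral>\<^sup>+\<zeta>. (F (\<phi> \<zeta>) * W (\<psi> n (\<phi> \<zeta>))) * (ennreal ((cmod (deriv \<phi> \<zeta>))\<^sup>2) * indicator (E n) \<zeta>) \<partial>lborel)"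
    proof (intro suminf_cong nn_integral_cong)
      fix n \<zeta>
      show "(F (\<phi> \<zeta>) * indicator (E n) \<zeta>) * W \<zeta> * (ennreal ((cmod (deriv \<phi> \<zeta>))\<^sup>2) * indicator (E n) \<zeta>)
        = (F (\<phi> \<zeta>) * W (\<psi> n (\<phi> \<zeta>))) * (ennreal ((cmod (deriv \<phi> \<zeta>))\<^sup>2) * indicator (E n) \<zeta>)"
        using \<psi>[of \<zeta> n] E(2)[of n] by (auto simp: indicator_def)
    qed
    also have "\<dots> = (\<Sum>n. \<integral>\<^sup>+z. (F z * W (\<psi> n z)) * indicator (\<phi> ` E n) z \<partial>lborel)"
    proof (rule suminf_cong)
      fix n
      show "(\<integral>\<^sup>+\<zeta>. (F (\<phi> \<zeta>) * W (\<psi> n (\<phi> \<zeta>))) * (ennreal ((cmod (deriv \<phi> \<zeta>))\<^sup>2) * indicator (E n) \<zeta>) \<partial>lborel)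
        = (\<integral>\<^sup>+z. (F z * W (\<psi> n z)) * indicator (\<phi> ` E n) z \<partial>lborel)"
        by (rule nn_integral_holomorphic_substitution[OF U(1) holU inj E, where F = "\<lambda>z. F z * W (\<psi> n z)"]) measurable
    qed
    also have "\<dots> = (\<integral>\<^sup>+z. (\<Sum>n. (F z * W (\<psi> n z)) * indicator (\<phi> ` E n) z) \<partial>lborel)"
      by (rule nn_integral_suminf[symmetric]) measurable
    also have "\<dots> = (\<integral>\<^sup>+z. F z * N z \<partial>lborel)"
      unfolding N_def by (simp only: mult.assoc ennreal_suminf_cmult)
    finally show "(\<integral>\<^sup>+\<zeta>. F (\<phi> \<zeta>) * (W \<zeta> * (ennreal ((cmod (deriv \<phi> \<zeta>))\<^sup>2) * indicator D \<zeta>)) \<partial>lborel)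
        = (\<integral>\<^sup>+z. F z * N z \<partial>lborel)" .
  qed
qed

text \<open>
  Polar coordinates in logarithmic form: the exponential maps the half-strip
  \<open>x < 0\<close>, \<open>0 < y < 2 \<pi>\<close> injectively into the disk, with Jacobian \<open>exp (2 * x)\<close>.
\<close>

lemma nn_integral_disk_ge_polar:
  fixes F :: "complex \<Rightarrow> ennreal"
  assumes F[measurable]: "F \<in> borel_measurable borel"
  shows "(\<integral>\<^sup>+x. (\<integral>\<^sup>+y. F (exp (Complex x y)) * indicator {0<..<2 * pi} y \<partial>lborel)
            * (ennreal (exp (2 * x)) * indicator {..<0} x) \<partial>lborel)
    \<le> (\<integral>\<^sup>+z. F z * indicator \<bbbD> z \<partial>lborel)"
proof -
  define U where "U = {z. Re z < 0 \<and> 0 < Im z \<and> Im z < 2 * pi}"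
  have oU: "open U" unfolding U_def
    by (intro open_Collect_conj open_halfspace_Re_lt open_Collect_less continuous_intros)
  have inj: "inj_on exp U"
  proof (rule inj_onI)
    fix z w :: complex assume "z \<in> U" "w \<in> U" "exp z = exp w"
    then show "z = w" using exp_complex_eqI[of z w] by (auto simp: U_def)
  qed
  have [measurable]: "(\<lambda>(x, y). Complex x y) \<in> borel_measurable (borel :: (real \<times> real) measure)"
    by (intro borel_measurable_continuous_onI) (auto simp: case_prod_unfold Complex_eq intro!: continuous_intros)
  have [measurable]: "U \<in> sets borel" using oU by auto
  define H where "H z = F (exp z) * (ennreal ((cmod (deriv exp z))\<^sup>2) * indicator U z)" for z
  have Heq: "H z = F (exp z) * (ennreal (exp (2 * Re z)) * indicator U z)" for z
    by (simp add: H_def DERIV_imp_deriv[OF DERIV_exp] exp_double)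
  have [measurable]: "exp \<in> borel_measurable (borel :: complex measure)" 
    by (intro borel_measurable_continuous_onI continuous_intros)
  have Hm[measurable]: "H \<in> borel_measurable borel" unfolding Heq by measurable
  have "(\<integral>\<^sup>+x. (\<integral>\<^sup>+y. F (exp (Complex x y)) * indicator {0<..<2 * pi} y \<partial>lborel)
            * (ennreal (exp (2 * x)) * indicator {..<0} x) \<partial>lborel)
     = (\<integral>\<^sup>+x. (\<integral>\<^sup>+y. H (Complex x y) \<partial>lborel) \<partial>lborel)"
  proof (rule nn_integral_cong)
    fix x :: real
    have [measurable]: "(\<lambda>y. Complex x y) \<in> borel_measurable borel"
      by (intro borel_measurable_continuous_onI) (auto simp: Complex_eq intro!: continuous_intros)
    have "(\<integral>\<^sup>+y. F (exp (Complex x y)) * indicator {0<..<2 * pi} y \<partial>lborel) * (ennreal (exp (2 * x)) * indicator {..<0} x)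
      = (\<integral>\<^sup>+y. F (exp (Complex x y)) * indicator {0<..<2 * pi} y * (ennreal (exp (2 * x)) * indicator {..<0} x) \<partial>lborel)"
      by (rule nn_integral_multc[symmetric]) measurable
    also have "\<dots> = (\<integral>\<^sup>+y. H (Complex x y) \<partial>lborel)"
      by (intro nn_integral_cong) (auto simp: Heq U_def indicator_def)
    finally show "(\<integral>\<^sup>+y. F (exp (Complex x y)) * indicator {0<..<2 * pi} y \<partial>lborel) * (ennreal (exp (2 * x)) * indicator {..<0} x)
      = (\<integral>\<^sup>+y. H (Complex x y) \<partial>lborel)" .
  qed
  also have "\<dots> = (\<integral>\<^sup>+p. H ((\<lambda>(x, y). Complex x y) p) \<partial>(lborel \<Otimes>\<^sub>M lborel))"
    by (subst lborel.nn_integral_fst[symmetric]) (auto simp: lborel_prod)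
  also have "\<dots> = (\<integral>\<^sup>+z. H z \<partial>distr (lborel :: (real \<times> real) measure) borel (\<lambda>(x, y). Complex x y))"
    by (subst nn_integral_distr) (auto simp: lborel_prod)
  also have "\<dots> = (\<integral>\<^sup>+z. H z \<partial>lborel)" by (simp add: distr_lborel_Complex)
  also have "\<dots> = (\<integral>\<^sup>+z. F z * indicator (exp ` U) z \<partial>lborel)"
    unfolding H_def by (rule nn_integral_holomorphic_substitution[OF oU _ inj]) (auto intro: holomorphic_intros)
  also have "\<dots> \<le> (\<integral>\<^sup>+z. F z * indicator \<bbbD> z \<partial>lborel)"
    by (intro nn_integral_mono mult_left_mono) (auto simp: U_def indicator_def)
  finally show ?thesis .
qed


section \<open>Power series and means over circles\<close>

lemma taylor_coeff_sums:
  assumes "f holomorphic_on \<bbbD>" "z \<in> \<bbbD>"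
  shows "(\<lambda>n. taylor_coeff f n * z ^ n) sums f z"
  using holomorphic_power_series[OF assms] by (simp add: taylor_coeff_def)

text \<open>
  Uniqueness of power series, in the form that reads off Taylor coefficients from an explicit expansion.
\<close>

lemma taylor_coeff_eqI:
  assumes "\<And>z. z \<in> \<bbbD> \<Longrightarrow> (\<lambda>n. a n * z ^ n) sums f z"
  shows "taylor_coeff f n = a n"
proof -
  have "f has_fps_expansion Abs_fps a"
    unfolding has_fps_expansion_def
  proof
    have "summable (\<lambda>n. a n * (of_real (1/2)) ^ n)" using assms[of "of_real (1/2)"] by (auto simp: sums_iff)
    then have "conv_radius a \<ge> norm (of_real (1/2) :: complex)" by (rule conv_radius_geI)
    then show "0 < fps_conv_radius (Abs_fps a)"
      by (simp add: fps_conv_radius_def) (metis ereal_less(2) half_gt_zero less_le_trans zero_less_one ereal_divide_one one_ereal_def)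
    show "\<forall>\<^sub>F z in nhds 0. eval_fps (Abs_fps a) z = f z"
      unfolding eventually_nhds
      by (rule exI[of _ \<bbbD>]) (auto simp: eval_fps_def sums_unique[OF assms, symmetric])
  qed
  from fps_nth_fps_expansion[OF this, of n] show ?thesis by (simp add: taylor_coeff_def)
qed

lemma taylor_coeff_cong:
  assumes "f holomorphic_on \<bbbD>" "\<And>z. z \<in> \<bbbD> \<Longrightarrow> g z = f z"
  shows "taylor_coeff g n = taylor_coeff f n"
  using taylor_coeff_sums[OF assms(1)] assms(2) by (intro taylor_coeff_eqI) simp

lemma taylor_coeff_add:
  assumes "f holomorphic_on \<bbbD>" "g holomorphic_on \<bbbD>"
  shows "taylor_coeff (f + g) n = taylor_coeff f n + taylor_coeff g n"
proof (rule taylor_coeff_eqI)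
  fix z assume z: "z \<in> \<bbbD>"
  show "(\<lambda>n. (taylor_coeff f n + taylor_coeff g n) * z ^ n) sums (f + g) z"
    using sums_add[OF taylor_coeff_sums[OF assms(1) z] taylor_coeff_sums[OF assms(2) z]]
    by (simp add: algebra_simps)
qed

lemma taylor_coeff_scale:
  assumes "f holomorphic_on \<bbbD>"
  shows "taylor_coeff (cfun_scale c f) n = c * taylor_coeff f n"
proof (rule taylor_coeff_eqI)
  fix z assume z: "z \<in> \<bbbD>"
  show "(\<lambda>n. (c * taylor_coeff f n) * z ^ n) sums cfun_scale c f z"
    using sums_mult[OF taylor_coeff_sums[OF assms(1) z], of c]
    by (simp add: algebra_simps cfun_scale_def)
qed

lemma taylor_coeff_deriv:
  "taylor_coeff (deriv f) n = of_nat (Suc n) * taylor_coeff f (Suc n)"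
proof -
  have "(deriv ^^ n) (deriv f) 0 = (deriv ^^ Suc n) f 0" by (simp add: funpow_swap1)
  then show ?thesis by (simp add: taylor_coeff_def del: funpow.simps of_nat_Suc)
qed

lemma deriv_sums:
  assumes "f holomorphic_on \<bbbD>" "z \<in> \<bbbD>"
  shows "(\<lambda>n. of_nat (Suc n) * taylor_coeff f (Suc n) * z ^ n) sums deriv f z"
  using taylor_coeff_sums[of "deriv f" z] holomorphic_deriv[OF assms(1)] assms(2)
  by (simp add: taylor_coeff_deriv)

lemma summable_norm_taylor:
  assumes f: "f holomorphic_on \<bbbD>" and r: "0 \<le> r" "r < 1"
  shows "summable (\<lambda>n. cmod (taylor_coeff f n) * r ^ n)"
proof -
  \<comment> \<open>The series converges at a point between the circle of radius \<open>r\<close> and the unit circle.\<close>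
  define s where "s = (r + 1) / 2"
  have s: "r < s" "s < 1" "0 < s" using r by (auto simp: s_def)
  have "summable (\<lambda>n. taylor_coeff f n * (of_real s) ^ n)"
    using taylor_coeff_sums[OF f, of "of_real s"] s by (auto simp: sums_iff)
  from powser_insidea[OF this, of "of_real r"] show ?thesis using r s
    by (simp add: norm_mult norm_power)
qed

lemma has_integral_cis_product:
  fixes m n :: nat
  shows "((\<lambda>y. cis (real m * y) * cnj (cis (real n * y))) has_integral (if m = n then 2 * of_real pi else 0)) {0..2 * pi}"
proof (cases "m = n")
  case True
  have "((\<lambda>y::real. 1::complex) has_integral (measure lborel {0..2 * pi} *\<^sub>R 1)) {0..2 * pi}"
    by (rule has_integral_const_real)
  then show ?thesis using True by (simp add: cis_cnj cis_mult scaleR_conv_of_real mult.commute)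
next
  case False
  define k where "k = real m - real n"
  have k: "k \<noteq> 0" using False by (simp add: k_def)
  have "((\<lambda>y. exp (\<i> * k * y)) has_integral (exp (\<i> * k * of_real (2 * pi)) / (\<i> * k) - exp (\<i> * k * of_real 0) / (\<i> * k))) {0..2 * pi}"
  proof (rule fundamental_theorem_of_calculus)
    fix x :: real
    have "((\<lambda>z. exp (\<i> * k * z) / (\<i> * k)) has_field_derivative exp (\<i> * k * x)) (at (of_real x))"
      using k by (auto intro!: derivative_eq_intros)
    then have "((\<lambda>x. exp (\<i> * k * of_real x) / (\<i> * k)) has_vector_derivative exp (\<i> * k * x)) (at x)"
      by (rule has_vector_derivative_real_field)
    then show "((\<lambda>x. exp (\<i> * k * of_real x) / (\<i> * k)) has_vector_derivative exp (\<i> * k * x)) (at x within {0..2 * pi})"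
      by (rule has_vector_derivative_at_within)
  qed simp
  moreover have "exp (\<i> * k * of_real (2 * pi)) = 1"
    unfolding exp_eq_1 by (intro conjI exI[of _ "int m - int n"]) (simp_all add: k_def)
  ultimately have "((\<lambda>y. exp (\<i> * k * y)) has_integral 0) {0..2 * pi}" by simp
  moreover have "cis (real m * y) * cnj (cis (real n * y)) = exp (\<i> * k * y)" for y
  proof -
    have "cis (real m * y) * cnj (cis (real n * y)) = cis (k * y)"
      by (simp add: complex_eq_iff k_def left_diff_distrib cos_diff sin_diff)
    then show ?thesis by (simp add: cis_conv_exp mult_ac)
  qed
  ultimately show ?thesis using False by simp
qed

lemma has_integral_trig_polynomial_square:
  fixes c :: "nat \<Rightarrow> complex"
  shows "((\<lambda>y. (cmod (\<Sum>n<N. c n * cis (real n * y)))\<^sup>2) has_integral (2 * pi * (\<Sum>n<N. (cmod (c n))\<^sup>2))) {0..2 * pi}"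
proof -
  have "((\<lambda>y. \<Sum>m<N. \<Sum>n<N. (c m * cnj (c n)) * (cis (real m * y) * cnj (cis (real n * y)))) has_integral
     (\<Sum>m<N. \<Sum>n<N. (c m * cnj (c n)) * (if m = n then 2 * of_real pi else 0))) {0..2 * pi}"
    by (intro has_integral_sum finite_lessThan has_integral_mult_right has_integral_cis_product)
  moreover have "(\<Sum>m<N. \<Sum>n<N. (c m * cnj (c n)) * (if m = n then 2 * of_real pi else 0))
      = of_real (2 * pi * (\<Sum>n<N. (cmod (c n))\<^sup>2))"
  proof -
    have "(\<Sum>m<N. \<Sum>n<N. (c m * cnj (c n)) * (if m = n then 2 * of_real pi else 0))
        = (\<Sum>m<N. (c m * cnj (c m)) * (2 * of_real pi))"
      by (intro sum.cong refl) (simp add: if_distrib[of "\<lambda>x. _ * x"] cong: if_cong)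
    then show ?thesis
      by (simp only: complex_norm_square[symmetric] of_real_mult of_real_sum sum_distrib_left of_real_numeral mult_ac)
  qed
  moreover have "(\<Sum>m<N. \<Sum>n<N. (c m * cnj (c n)) * (cis (real m * y) * cnj (cis (real n * y))))
      = of_real ((cmod (\<Sum>n<N. c n * cis (real n * y)))\<^sup>2)" for y
    by (simp only: complex_norm_square cnj_sum sum_product complex_cnj_mult mult_ac)
  ultimately have "((\<lambda>y. of_real ((cmod (\<Sum>n<N. c n * cis (real n * y)))\<^sup>2)) has_integral
      (of_real (2 * pi * (\<Sum>n<N. (cmod (c n))\<^sup>2)) :: complex)) {0..2 * pi}"
    by simp
  from has_integral_Re[OF this] show ?thesis by simp
qed

lemma summable_taylor_square_circle:
  assumes f: "f holomorphic_on \<bbbD>" and r: "0 \<le> r" "r < 1"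
  shows "summable (\<lambda>n. (cmod (taylor_coeff f n))\<^sup>2 * r ^ (2 * n))"
proof -
  have "summable (\<lambda>n. (cmod (taylor_coeff f n) * r ^ n) * (cmod (taylor_coeff f n) * r ^ n))"
  proof (rule summable_comparison_test_ev)
    have "(\<lambda>n. cmod (taylor_coeff f n) * r ^ n) \<longlonglongrightarrow> 0"
      by (rule summable_LIMSEQ_zero[OF summable_norm_taylor[OF f r]])
    then have "\<forall>\<^sub>F n in sequentially. cmod (taylor_coeff f n) * r ^ n < 1"
      by (rule order_tendstoD) simp
    then show "\<forall>\<^sub>F n in sequentially. norm ((cmod (taylor_coeff f n) * r ^ n) * (cmod (taylor_coeff f n) * r ^ n))
       \<le> cmod (taylor_coeff f n) * r ^ n"
    proof eventually_elim
      case (elim n)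
      then show ?case using r by (simp add: mult_left_le)
    qed
    show "summable (\<lambda>n. cmod (taylor_coeff f n) * r ^ n)" by (rule summable_norm_taylor[OF f r])
  qed
  then show ?thesis by (simp add: power2_eq_square power_mult power_mult_distrib mult_ac)
qed

text \<open>
  Parseval's identity on the circle of radius \<open>exp x\<close>: the partial sums of the power series are
  trigonometric polynomials that converge boundedly.
\<close>

lemma nn_integral_circle_square:
  assumes f: "f holomorphic_on \<bbbD>" and x: "x < 0"
  shows "(\<integral>\<^sup>+y. ennreal ((cmod (f (exp (Complex x y))))\<^sup>2) * indicator {0<..<2 * pi} y \<partial>lborel)
    = ennreal (2 * pi * (\<Sum>n. (cmod (taylor_coeff f n))\<^sup>2 * exp x ^ (2 * n)))"
proof -
  define c where "c n = taylor_coeff f n * of_real (exp x ^ n)" for n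
  have r: "0 \<le> exp x" "exp x < 1" using x by auto
  have nc: "cmod (c n) = cmod (taylor_coeff f n) * exp x ^ n" for n by (simp add: c_def norm_mult norm_power)
  have sc: "summable (\<lambda>n. cmod (c n))" unfolding nc by (rule summable_norm_taylor[OF f r])
  have sc2: "summable (\<lambda>n. (cmod (c n))\<^sup>2)"
    using summable_taylor_square_circle[OF f r] by (simp add: nc power_mult_distrib power_mult mult.commute)
  define g where "g y = f (exp (Complex x y))" for y
  define P where "P N y = (\<Sum>n<N. c n * cis (real n * y))" for N y
  define M where "M = (\<Sum>n. cmod (c n))"
  have z: "exp (Complex x y) \<in> \<bbbD>" for y using x by (simp add: norm_exp_eq_Re)
  have pw: "taylor_coeff f n * exp (Complex x y) ^ n = c n * cis (real n * y)" for n y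
    by (simp add: c_def exp_eq_polar power_mult_distrib Complex.DeMoivre norm_exp_eq_Re)
  have lim: "(\<lambda>N. P N y) \<longlonglongrightarrow> g y" for y
    using taylor_coeff_sums[OF f z[of y]] unfolding sums_def pw P_def g_def .
  have PM: "cmod (P N y) \<le> M" for N y
  proof -
    have "cmod (P N y) \<le> (\<Sum>n<N. cmod (c n * cis (real n * y)))" unfolding P_def by (rule norm_sum)
    also have "\<dots> = (\<Sum>n<N. cmod (c n))" by (simp add: norm_mult)
    also have "\<dots> \<le> M" unfolding M_def by (rule sum_le_suminf[OF sc]) auto
    finally show ?thesis .
  qed
  have intP: "((\<lambda>y. (cmod (P N y))\<^sup>2) has_integral (2 * pi * (\<Sum>n<N. (cmod (c n))\<^sup>2))) {0..2 * pi}" for N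
    unfolding P_def by (rule has_integral_trig_polynomial_square)
  have d1: "(\<lambda>y. (cmod (P N y))\<^sup>2) integrable_on {0..2 * pi}" for N using intP by blast
  have d2: "(\<lambda>y::real. M\<^sup>2) integrable_on {0..2 * pi}" by (rule integrable_const_ivl)
  have d3: "norm ((cmod (P N y))\<^sup>2) \<le> M\<^sup>2" for N y using power_mono[OF PM norm_ge_zero, of N y 2] by simp
  have d4: "(\<lambda>N. (cmod (P N y))\<^sup>2) \<longlonglongrightarrow> (cmod (g y))\<^sup>2" for y
    using lim[of y] by (auto intro!: tendsto_intros)
  note conv = dominated_convergence[OF d1 d2 d3 d4]
  have "(\<lambda>N. 2 * pi * (\<Sum>n<N. (cmod (c n))\<^sup>2)) \<longlonglongrightarrow> 2 * pi * (\<Sum>n. (cmod (c n))\<^sup>2)"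
    using summable_LIMSEQ[OF sc2] by (intro tendsto_intros)
  then have "integral {0..2 * pi} (\<lambda>y. (cmod (g y))\<^sup>2) = 2 * pi * (\<Sum>n. (cmod (c n))\<^sup>2)"
    using conv(2) intP[THEN integral_unique] by (simp add: LIMSEQ_unique)
  with conv(1) have "((\<lambda>y. (cmod (g y))\<^sup>2) has_integral (2 * pi * (\<Sum>n. (cmod (c n))\<^sup>2))) {0..2 * pi}"
    by (metis integrable_integral)
  then have "((\<lambda>y. (cmod (g y))\<^sup>2) has_integral (2 * pi * (\<Sum>n. (cmod (c n))\<^sup>2))) {0<..<2 * pi}"
    using has_integral_open_interval[of "\<lambda>y. (cmod (g y))\<^sup>2" _ 0 "2 * pi"] by simp
  from nn_integral_has_integral_lebesgue'[OF _ this] show ?thesis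
    by (simp add: g_def nc power_mult_distrib power_mult mult.commute)
qed

lemma taylor_square_sum_circle_mono:
  assumes f: "f holomorphic_on \<bbbD>" and g: "g holomorphic_on \<bbbD>"
    and le: "\<And>z. z \<in> \<bbbD> \<Longrightarrow> cmod (f z) \<le> cmod (g z)" and r: "0 < r" "r < 1"
  shows "(\<Sum>n. (cmod (taylor_coeff f n))\<^sup>2 * r ^ (2 * n)) \<le> (\<Sum>n. (cmod (taylor_coeff g n))\<^sup>2 * r ^ (2 * n))"
proof -
  define x where "x = ln r"
  have x: "x < 0" "exp x = r" using r by (auto simp: x_def)
  have z: "exp (Complex x y) \<in> \<bbbD>" for y using x r by (simp add: norm_exp_eq_Re)
  have "ennreal (2 * pi * (\<Sum>n. (cmod (taylor_coeff f n))\<^sup>2 * exp x ^ (2 * n)))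
      \<le> ennreal (2 * pi * (\<Sum>n. (cmod (taylor_coeff g n))\<^sup>2 * exp x ^ (2 * n)))"
    unfolding nn_integral_circle_square[OF f x(1), symmetric] nn_integral_circle_square[OF g x(1), symmetric]
    by (intro nn_integral_mono mult_right_mono ennreal_leI power_mono le z) auto
  moreover have "0 \<le> (\<Sum>n. (cmod (taylor_coeff g n))\<^sup>2 * exp x ^ (2 * n))"
    using summable_taylor_square_circle[OF g, of r] r x by (intro suminf_nonneg) auto
  ultimately show ?thesis by (simp add: x)
qed

text \<open>
  Pointwise domination passes to the means over circles, which by Parseval's identity are the
  weighted coefficient sums; then the radius tends to one.
\<close>

lemma taylor_square_sum_mono:
  assumes f: "f holomorphic_on \<bbbD>" and g: "g holomorphic_on \<bbbD>"
    and le: "\<And>z. z \<in> \<bbbD> \<Longrightarrow> cmod (f z) \<le> cmod (g z)"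
    and sg: "summable (\<lambda>n. (cmod (taylor_coeff g n))\<^sup>2)"
  shows "summable (\<lambda>n. (cmod (taylor_coeff f n))\<^sup>2)"
    and "(\<Sum>n. (cmod (taylor_coeff f n))\<^sup>2) \<le> (\<Sum>n. (cmod (taylor_coeff g n))\<^sup>2)"
proof -
  let ?B = "\<Sum>n. (cmod (taylor_coeff g n))\<^sup>2"
  have part: "(\<Sum>n<N. (cmod (taylor_coeff f n))\<^sup>2) \<le> ?B" for N
  proof (rule tendsto_upperbound)
    show "((\<lambda>r. \<Sum>n<N. (cmod (taylor_coeff f n))\<^sup>2 * r ^ (2 * n)) \<longlongrightarrow> (\<Sum>n<N. (cmod (taylor_coeff f n))\<^sup>2)) (at_left 1)"
    proof -
      have "((\<lambda>r::real. \<Sum>n<N. (cmod (taylor_coeff f n))\<^sup>2 * r ^ (2 * n)) \<longlongrightarrow> (\<Sum>n<N. (cmod (taylor_coeff f n))\<^sup>2 * 1 ^ (2 * n))) (at_left 1)"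
        by (intro tendsto_intros)
      then show ?thesis by simp
    qed
    have "\<forall>\<^sub>F r::real in at_left 1. 0 < r \<and> r < 1"
      using eventually_at_left_real[of 0 1] by (auto elim: eventually_mono)
    then show "\<forall>\<^sub>F r in at_left 1. (\<Sum>n<N. (cmod (taylor_coeff f n))\<^sup>2 * r ^ (2 * n)) \<le> ?B"
    proof eventually_elim
      case (elim r)
      have "(\<Sum>n<N. (cmod (taylor_coeff f n))\<^sup>2 * r ^ (2 * n)) \<le> (\<Sum>n. (cmod (taylor_coeff f n))\<^sup>2 * r ^ (2 * n))"
        using summable_taylor_square_circle[OF f, of r] elim by (intro sum_le_suminf) auto
      also have "\<dots> \<le> (\<Sum>n. (cmod (taylor_coeff g n))\<^sup>2 * r ^ (2 * n))"
        by (rule taylor_square_sum_circle_mono[OF f g le]) (use elim in auto)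
      also have "\<dots> \<le> ?B"
        using summable_taylor_square_circle[OF g, of r] elim sg
        by (intro suminf_le) (auto intro!: mult_left_le power_le_one)
      finally show ?case .
    qed
  qed simp
  show s: "summable (\<lambda>n. (cmod (taylor_coeff f n))\<^sup>2)"
    using part[of "Suc _"] by (intro bounded_imp_summable[where B = ?B]) (auto simp only: lessThan_Suc_atMost zero_le_power2)
  show "(\<Sum>n. (cmod (taylor_coeff f n))\<^sup>2) \<le> ?B"
    using part by (intro suminf_le_const s)
qed

text \<open>
  The integral of \<open>log (1 / r)\<close> against \<open>r\<^sup>2\<^sup>k\<^sup>-\<^sup>1 dr\<close> in the variable \<open>x = log r\<close>.
\<close>

lemma nn_integral_log_weight:
  assumes k: "k > (0::real)"
  shows "(\<integral>\<^sup>+x. ennreal (- x * exp (2 * k * x)) * indicator {..<0} x \<partial>lborel) = ennreal (1 / (4 * k\<^sup>2))"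
proof -
  have "(\<integral>\<^sup>+x. ennreal (- x * exp (2 * k * x)) * indicator {..<0} x \<partial>lborel)
      = (\<integral>\<^sup>+x. ennreal (x * exp (- (2 * k * x))) * indicator {0<..} x \<partial>lborel)"
    by (subst nn_integral_real_affine[where c = "-1" and t = 0]) (auto intro!: nn_integral_cong simp: indicator_def)
  also have "\<dots> = (\<integral>\<^sup>+x. ennreal (x * exp (- (2 * k * x))) * indicator {0..} x \<partial>lborel)"
    by (intro nn_integral_cong) (auto simp: indicator_def)
  also have "\<dots> = ennreal (0 - (- (0 / (2 * k) + 1 / (4 * k\<^sup>2)) * exp (- (2 * k * 0))))"
  proof (rule nn_integral_FTC_atLeast)
    show "((\<lambda>x. - (x / (2 * k) + 1 / (4 * k\<^sup>2)) * exp (- (2 * k * x))) has_real_derivative x * exp (- (2 * k * x))) (at x)" for x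
      using k by (auto intro!: derivative_eq_intros simp: field_simps power2_eq_square)
    show "((\<lambda>x. - (x / (2 * k) + 1 / (4 * k\<^sup>2)) * exp (- (2 * k * x))) \<longlongrightarrow> 0) at_top"
      using k by real_asymp
  qed auto
  finally show ?thesis by simp
qed


text \<open>
  In logarithmic polar coordinates the integral over the angle is a coefficient sum by Parseval's
  identity, and the logarithmic weight turns the factor \<open>(n + 1)\<^sup>2\<close> produced by differentiation into the
  constant \<open>\<pi> / 2\<close>.
\<close>

lemma littlewood_paley_inequality:
  assumes F: "F holomorphic_on \<bbbD>"
  shows "(\<Sum>n. ennreal ((cmod (taylor_coeff F (Suc n)))\<^sup>2))
    \<le> ennreal (2 / pi) * (\<integral>\<^sup>+z. ennreal ((cmod (deriv F z))\<^sup>2) * (ennreal (ln (1 / cmod z)) * indicator \<bbbD> z) \<partial>lborel)"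
proof -
  define a where "a n = (cmod (taylor_coeff F n))\<^sup>2" for n
  define G where "G z = ennreal ((cmod (deriv F z))\<^sup>2) * indicator \<bbbD> z * ennreal (ln (1 / cmod z))" for z
  have G[measurable]: "G \<in> borel_measurable borel"
  proof -
    have [measurable]: "(\<lambda>z. ennreal ((cmod (deriv F z))\<^sup>2) * indicator \<bbbD> z) \<in> borel_measurable borel"
      by (rule borel_measurable_deriv_on_open(1)[OF _ F]) auto
    show ?thesis unfolding G_def by measurable
  qed
  have F': "deriv F holomorphic_on \<bbbD>" using F by (intro holomorphic_deriv) auto
  have inner: "(\<integral>\<^sup>+y. G (exp (Complex x y)) * indicator {0<..<2 * pi} y \<partial>lborel)
      = ennreal (- x) * ennreal (2 * pi * (\<Sum>n. (real (Suc n))\<^sup>2 * a (Suc n) * exp x ^ (2 * n)))" if x: "x < 0" for x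
  proof -
    have z: "exp (Complex x y) \<in> \<bbbD>" for y using x by (simp add: norm_exp_eq_Re)
    have "(\<integral>\<^sup>+y. G (exp (Complex x y)) * indicator {0<..<2 * pi} y \<partial>lborel)
      = (\<integral>\<^sup>+y. ennreal (- x) * (ennreal ((cmod (deriv F (exp (Complex x y))))\<^sup>2) * indicator {0<..<2 * pi} y) \<partial>lborel)"
      using z x by (intro nn_integral_cong) (simp add: G_def norm_exp_eq_Re ln_div mult_ac)
    also have "\<dots> = ennreal (- x) * (\<integral>\<^sup>+y. (ennreal ((cmod (deriv F (exp (Complex x y))))\<^sup>2) * indicator {0<..<2 * pi} y) \<partial>lborel)"
    proof (rule nn_integral_cmult)
      have c: "continuous_on UNIV (\<lambda>y. deriv F (exp (Complex x y)))"
        using z by (intro continuous_on_compose2[OF holomorphic_on_imp_continuous_on[OF F']])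
          (auto simp: Complex_eq intro!: continuous_intros)
      then have "(\<lambda>y. (cmod (deriv F (exp (Complex x y))))\<^sup>2) \<in> borel_measurable borel"
        by (intro borel_measurable_continuous_onI continuous_intros)
      then show "(\<lambda>y. ennreal ((cmod (deriv F (exp (Complex x y))))\<^sup>2) * indicator {0<..<2 * pi} y) \<in> borel_measurable lborel"
        by measurable
    qed
    finally show ?thesis
      by (simp add: nn_integral_circle_square[OF F' x] taylor_coeff_deriv norm_mult power_mult_distrib a_def del: of_nat_Suc)
  qed
  have "(\<Sum>n. ennreal (pi / 2 * a (Suc n)))
     = (\<Sum>n. ennreal (2 * pi * (real (Suc n))\<^sup>2 * a (Suc n)) * ennreal (1 / (4 * (real (Suc n))\<^sup>2)))"
    by (intro suminf_cong) (simp add: ennreal_mult[symmetric] a_def field_simps del: of_nat_Suc)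
  also have "\<dots> = (\<Sum>n. ennreal (2 * pi * (real (Suc n))\<^sup>2 * a (Suc n)) *
        (\<integral>\<^sup>+x. ennreal (- x * exp (2 * real (Suc n) * x)) * indicator {..<0} x \<partial>lborel))"
    by (subst nn_integral_log_weight) (auto simp del: of_nat_Suc)
  also have "\<dots> = (\<Sum>n. \<integral>\<^sup>+x. ennreal (2 * pi * (real (Suc n))\<^sup>2 * a (Suc n)) *
        (ennreal (- x * exp (2 * real (Suc n) * x)) * indicator {..<0} x) \<partial>lborel)"
    by (subst nn_integral_cmult) auto
  also have "\<dots> = (\<integral>\<^sup>+x. (\<Sum>n. ennreal (2 * pi * (real (Suc n))\<^sup>2 * a (Suc n)) *
        (ennreal (- x * exp (2 * real (Suc n) * x)) * indicator {..<0} x)) \<partial>lborel)"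
    by (rule nn_integral_suminf[symmetric]) measurable
  also have "\<dots> = (\<integral>\<^sup>+x. (\<integral>\<^sup>+y. G (exp (Complex x y)) * indicator {0<..<2 * pi} y \<partial>lborel)
            * (ennreal (exp (2 * x)) * indicator {..<0} x) \<partial>lborel)"
  proof (rule nn_integral_cong)
    fix x :: real
    show "(\<Sum>n. ennreal (2 * pi * (real (Suc n))\<^sup>2 * a (Suc n)) *
        (ennreal (- x * exp (2 * real (Suc n) * x)) * indicator {..<0} x))
      = (\<integral>\<^sup>+y. G (exp (Complex x y)) * indicator {0<..<2 * pi} y \<partial>lborel)
            * (ennreal (exp (2 * x)) * indicator {..<0} x)"
    proof (cases "x < 0")
      case True
      let ?b = "\<lambda>n. (real (Suc n))\<^sup>2 * a (Suc n) * exp x ^ (2 * n)"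
      have sb: "summable ?b"
        using summable_taylor_square_circle[OF F', of "exp x"] True
        by (simp add: taylor_coeff_deriv norm_mult power_mult_distrib a_def del: of_nat_Suc)
      have b0: "0 \<le> ?b n" for n by (simp add: a_def)
      have "(\<Sum>n. ennreal (2 * pi * (real (Suc n))\<^sup>2 * a (Suc n)) *
        (ennreal (- x * exp (2 * real (Suc n) * x)) * indicator {..<0} x))
        = (\<Sum>n. ennreal (- x * (2 * pi) * exp (2 * x)) * ennreal (?b n))"
      proof (rule suminf_cong)
        fix n
        have e: "exp (2 * real (Suc n) * x) = exp (2 * x) * exp x ^ (2 * n)"
          by (simp add: exp_of_nat_mult[symmetric] exp_add[symmetric] algebra_simps)
        have "ennreal (2 * pi * (real (Suc n))\<^sup>2 * a (Suc n)) * ennreal (- x * exp (2 * real (Suc n) * x))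
          = ennreal ((2 * pi * (real (Suc n))\<^sup>2 * a (Suc n)) * (- x * exp (2 * real (Suc n) * x)))"
          using True by (intro ennreal_mult[symmetric]) (auto simp: a_def mult_nonpos_nonneg)
        also have "(2 * pi * (real (Suc n))\<^sup>2 * a (Suc n)) * (- x * exp (2 * real (Suc n) * x)) = (- x * (2 * pi) * exp (2 * x)) * ?b n"
          unfolding e by (simp only: mult_ac)
        also have "ennreal ((- x * (2 * pi) * exp (2 * x)) * ?b n) = ennreal (- x * (2 * pi) * exp (2 * x)) * ennreal (?b n)"
          using True b0 by (intro ennreal_mult) (auto simp: mult_nonpos_nonneg)
        finally show "ennreal (2 * pi * (real (Suc n))\<^sup>2 * a (Suc n)) *
            (ennreal (- x * exp (2 * real (Suc n) * x)) * indicator {..<0} x)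
          = ennreal (- x * (2 * pi) * exp (2 * x)) * ennreal (?b n)" using True by simp
      qed
      also have "\<dots> = ennreal (- x * (2 * pi) * exp (2 * x)) * ennreal (suminf ?b)"
        using suminf_ennreal2[OF b0 sb] by simp
      also have "\<dots> = ennreal ((- x * (2 * pi) * exp (2 * x)) * suminf ?b)"
        using True suminf_nonneg[OF sb b0] by (intro ennreal_mult[symmetric]) (auto simp: mult_nonpos_nonneg)
      also have "(- x * (2 * pi) * exp (2 * x)) * suminf ?b = (- x) * (2 * pi * suminf ?b) * exp (2 * x)"
        by (simp only: mult_ac)
      also have "ennreal \<dots> = ennreal (- x) * ennreal (2 * pi * suminf ?b) * ennreal (exp (2 * x))"
        using True suminf_nonneg[OF sb b0] by (simp add: ennreal_mult[symmetric] mult_nonpos_nonneg del: of_nat_Suc)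
      finally show ?thesis using True by (simp add: inner[OF True] del: of_nat_Suc)
    qed simp
  qed
  also have "\<dots> \<le> (\<integral>\<^sup>+z. G z * indicator \<bbbD> z \<partial>lborel)"
    by (rule nn_integral_disk_ge_polar[OF G])
  also have "\<dots> = (\<integral>\<^sup>+z. ennreal ((cmod (deriv F z))\<^sup>2) * (ennreal (ln (1 / cmod z)) * indicator \<bbbD> z) \<partial>lborel)"
    by (intro nn_integral_cong) (auto simp: G_def indicator_def)
  finally have main: "(\<Sum>n. ennreal (pi / 2 * a (Suc n)))
    \<le> (\<integral>\<^sup>+z. ennreal ((cmod (deriv F z))\<^sup>2) * (ennreal (ln (1 / cmod z)) * indicator \<bbbD> z) \<partial>lborel)" .
  have "(\<Sum>n. ennreal (a (Suc n))) = (\<Sum>n. ennreal (2 / pi) * ennreal (pi / 2 * a (Suc n)))"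
    by (intro suminf_cong) (simp add: ennreal_mult[symmetric] a_def)
  also have "\<dots> = ennreal (2 / pi) * (\<Sum>n. ennreal (pi / 2 * a (Suc n)))" by simp
  also have "\<dots> \<le> ennreal (2 / pi) * (\<integral>\<^sup>+z. ennreal ((cmod (deriv F z))\<^sup>2) * (ennreal (ln (1 / cmod z)) * indicator \<bbbD> z) \<partial>lborel)"
    by (rule mult_left_mono[OF main]) simp
  finally show ?thesis by (simp add: a_def)
qed


section \<open>Singular vectors of compact operators\<close>

text \<open>
  The Hardy space and the model spaces are treated uniformly as inner product spaces of functions;
  completeness enters only through weak compactness of bounded sequences.
\<close>

locale inner_product_hspace =
  fixes V :: "'x hspace"
  assumes zero_mem: "0 \<in> hcarrier V"
    and add_mem: "f \<in> hcarrier V \<Longrightarrow> g \<in> hcarrier V \<Longrightarrow> f + g \<in> hcarrier V"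
    and scale_mem: "f \<in> hcarrier V \<Longrightarrow> cfun_scale c f \<in> hcarrier V"
    and inner_add_left: "f \<in> hcarrier V \<Longrightarrow> g \<in> hcarrier V \<Longrightarrow> h \<in> hcarrier V \<Longrightarrow>
          hinner V (f + g) h = hinner V f h + hinner V g h"
    and inner_scale_left: "f \<in> hcarrier V \<Longrightarrow> h \<in> hcarrier V \<Longrightarrow>
          hinner V (cfun_scale c f) h = c * hinner V f h"
    and inner_commute: "f \<in> hcarrier V \<Longrightarrow> g \<in> hcarrier V \<Longrightarrow> hinner V g f = cnj (hinner V f g)"
    and inner_nonneg: "f \<in> hcarrier V \<Longrightarrow> 0 \<le> Re (hinner V f f)"
    and inner_definite: "f \<in> hcarrier V \<Longrightarrow> Re (hinner V f f) = 0 \<Longrightarrow> f = 0"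
begin

lemma inner_add_right:
  assumes "f \<in> hcarrier V" "g \<in> hcarrier V" "h \<in> hcarrier V"
  shows "hinner V h (f + g) = hinner V h f + hinner V h g"
  using assms by (simp add: inner_commute[of "f + g" h] inner_commute[of f h] inner_commute[of g h] inner_add_left add_mem)

lemma inner_scale_right:
  assumes "f \<in> hcarrier V" "h \<in> hcarrier V"
  shows "hinner V h (cfun_scale c f) = cnj c * hinner V h f"
  using assms by (simp add: inner_commute[of "cfun_scale c f" h] inner_commute[of f h] inner_scale_left scale_mem)

lemma diff_conv: "f - g = f + cfun_scale (-1) g"
  by (simp add: cfun_scale_def fun_eq_iff)

lemma diff_mem: "f \<in> hcarrier V \<Longrightarrow> g \<in> hcarrier V \<Longrightarrow> f - g \<in> hcarrier V"
  unfolding diff_conv by (intro add_mem scale_mem)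

lemma inner_diff_left:
  "f \<in> hcarrier V \<Longrightarrow> g \<in> hcarrier V \<Longrightarrow> h \<in> hcarrier V \<Longrightarrow> hinner V (f - g) h = hinner V f h - hinner V g h"
  using inner_add_left[of f "cfun_scale (-1) g" h] inner_scale_left[of g h "-1"] scale_mem[of g "-1"]
  unfolding diff_conv by (simp del: cfun.scale_minus_left)

lemma inner_diff_right:
  "f \<in> hcarrier V \<Longrightarrow> g \<in> hcarrier V \<Longrightarrow> h \<in> hcarrier V \<Longrightarrow> hinner V h (f - g) = hinner V h f - hinner V h g"
  using inner_add_right[of f "cfun_scale (-1) g" h] inner_scale_right[of g h "-1"] scale_mem[of g "-1"]
  unfolding diff_conv by (simp del: cfun.scale_minus_left)

lemma inner_zero_left: "f \<in> hcarrier V \<Longrightarrow> hinner V 0 f = 0"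
  using inner_add_left[of 0 0 f] zero_mem by simp

lemma inner_zero_right: "f \<in> hcarrier V \<Longrightarrow> hinner V f 0 = 0"
  using inner_add_right[of 0 0 f] zero_mem by simp

lemma inner_self: "f \<in> hcarrier V \<Longrightarrow> hinner V f f = of_real ((hnorm V f)\<^sup>2)"
  using inner_commute[of f f] inner_nonneg[of f] by (simp add: hnorm_def complex_eq_iff)

lemma hnorm_nonneg: "0 \<le> hnorm V f" if "f \<in> hcarrier V"
  using inner_nonneg[OF that] by (simp add: hnorm_def)

lemma hnorm_eq_0: "f \<in> hcarrier V \<Longrightarrow> hnorm V f = 0 \<Longrightarrow> f = 0"
  by (rule inner_definite) (auto simp: hnorm_def)

lemma hnorm_zero: "hnorm V 0 = 0"
  using inner_zero_left[OF zero_mem] by (simp add: hnorm_def)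

lemma hnorm_scale: "f \<in> hcarrier V \<Longrightarrow> hnorm V (cfun_scale c f) = cmod c * hnorm V f"
proof -
  assume f: "f \<in> hcarrier V"
  have "hinner V (cfun_scale c f) (cfun_scale c f) = of_real ((cmod c)\<^sup>2 * (hnorm V f)\<^sup>2)"
  proof -
    have "hinner V (cfun_scale c f) (cfun_scale c f) = c * (cnj c * hinner V f f)"
      using f by (simp add: inner_scale_left inner_scale_right scale_mem)
    then show ?thesis by (simp only: inner_self[OF f] of_real_mult complex_norm_square mult_ac)
  qed
  then show ?thesis using hnorm_nonneg[OF f] by (simp add: hnorm_def[of V "cfun_scale c f"] real_sqrt_mult)
qed

lemma hnorm_add_square:
  assumes "f \<in> hcarrier V" "g \<in> hcarrier V"
  shows "(hnorm V (f + g))\<^sup>2 = (hnorm V f)\<^sup>2 + 2 * Re (hinner V f g) + (hnorm V g)\<^sup>2"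
proof -
  have "complex_of_real ((hnorm V (f + g))\<^sup>2) = hinner V (f + g) (f + g)"
    using assms by (simp add: inner_self add_mem)
  also have "\<dots> = hinner V f f + (hinner V f g + cnj (hinner V f g)) + hinner V g g"
    using assms by (simp add: inner_add_left inner_add_right add_mem inner_commute[of f g] algebra_simps)
  also have "\<dots> = of_real ((hnorm V f)\<^sup>2 + 2 * Re (hinner V f g) + (hnorm V g)\<^sup>2)"
    using assms by (simp add: inner_self complex_add_cnj)
  finally show ?thesis by (simp only: of_real_eq_iff)
qed

lemma hnorm_diff_square:
  assumes "f \<in> hcarrier V" "g \<in> hcarrier V"
  shows "(hnorm V (f - g))\<^sup>2 = (hnorm V f)\<^sup>2 - 2 * Re (hinner V f g) + (hnorm V g)\<^sup>2"
  using hnorm_add_square[OF assms(1) scale_mem[OF assms(2)], of "-1"] assms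
  unfolding diff_conv by (simp add: hnorm_scale inner_scale_right del: cfun.scale_minus_left)

text \<open>
  Vectors of norm at most one, rather than exactly one, are allowed so that orthogonal systems may
  contain zero vectors.
\<close>

lemma remove_component:
  assumes f: "f \<in> hcarrier V" and e: "e \<in> hcarrier V" "hnorm V e \<le> 1"
  shows "(hnorm V (f - cfun_scale (hinner V f e) e))\<^sup>2 \<le> (hnorm V f)\<^sup>2 - (cmod (hinner V f e))\<^sup>2"
proof -
  let ?c = "hinner V f e"
  have "(hnorm V (f - cfun_scale ?c e))\<^sup>2 = (hnorm V f)\<^sup>2 - 2 * (cmod ?c)\<^sup>2 + (cmod ?c)\<^sup>2 * (hnorm V e)\<^sup>2"
  proof -
    have "hinner V f (cfun_scale ?c e) = cnj ?c * ?c" by (rule inner_scale_right[OF e(1) f])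
    also have "\<dots> = of_real ((cmod ?c)\<^sup>2)" by (simp only: complex_norm_square mult.commute)
    finally have "Re (hinner V f (cfun_scale ?c e)) = (cmod ?c)\<^sup>2" by (simp only: Re_complex_of_real)
    then show ?thesis
      by (simp only: hnorm_diff_square[OF f scale_mem[OF e(1)]] hnorm_scale[OF e(1)] power_mult_distrib)
  qed
  moreover have "(cmod ?c)\<^sup>2 * (hnorm V e)\<^sup>2 \<le> (cmod ?c)\<^sup>2"
    using e hnorm_nonneg[OF e(1)] by (intro mult_left_le) (auto simp: power_le_one)
  ultimately show ?thesis by simp
qed

text \<open>
  Removing one component after the other leaves the remaining inner products unchanged, so no
  orthogonal sum has to be expanded.
\<close>

lemma bessel_inequality:
  assumes "finite I" and f: "f \<in> hcarrier V"
    and e: "\<And>i. i \<in> I \<Longrightarrow> e i \<in> hcarrier V" "\<And>i. i \<in> I \<Longrightarrow> hnorm V (e i) \<le> 1"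
    and orth: "\<And>i j. i \<in> I \<Longrightarrow> j \<in> I \<Longrightarrow> i \<noteq> j \<Longrightarrow> hinner V (e i) (e j) = 0"
  shows "(\<Sum>i\<in>I. (cmod (hinner V f (e i)))\<^sup>2) \<le> (hnorm V f)\<^sup>2"
  using assms
proof (induction I arbitrary: f rule: finite_induct)
  case empty
  then show ?case by simp
next
  case (insert k I)
  define g where "g = f - cfun_scale (hinner V f (e k)) (e k)"
  have ek: "e k \<in> hcarrier V" "hnorm V (e k) \<le> 1" using insert by auto
  have g: "g \<in> hcarrier V" unfolding g_def using insert ek by (intro diff_mem scale_mem)
  have same: "hinner V g (e i) = hinner V f (e i)" if "i \<in> I" for i
  proof -
    have "i \<noteq> k" "e i \<in> hcarrier V" using that insert by auto
    then show ?thesis using insert.prems(4)[of k i] that insert.prems ek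
      unfolding g_def by (simp add: inner_diff_left inner_scale_left scale_mem)
  qed
  have "(\<Sum>i\<in>I. (cmod (hinner V g (e i)))\<^sup>2) \<le> (hnorm V g)\<^sup>2"
    by (rule insert.IH[OF g]) (use insert.prems in auto)
  also have "\<dots> \<le> (hnorm V f)\<^sup>2 - (cmod (hinner V f (e k)))\<^sup>2"
    unfolding g_def by (rule remove_component[OF insert.prems(1) ek])
  finally show ?case using insert.hyps same by simp
qed

lemma cauchy_schwarz:
  assumes f: "f \<in> hcarrier V" and g: "g \<in> hcarrier V"
  shows "cmod (hinner V f g) \<le> hnorm V f * hnorm V g"
proof (cases "hnorm V g = 0")
  case True
  then have "g = 0" using hnorm_eq_0 g by simp
  then show ?thesis using f by (simp add: inner_zero_right hnorm_zero)
next
  case False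
  then have pos: "hnorm V g > 0" using hnorm_nonneg[OF g] by simp
  define e where "e = cfun_scale (of_real (1 / hnorm V g)) g"
  have e: "e \<in> hcarrier V" unfolding e_def by (rule scale_mem[OF g])
  have "hnorm V e = 1" using pos g by (simp add: e_def hnorm_scale norm_divide)
  then have "hnorm V e \<le> 1" by simp
  from remove_component[OF f e this] have "(cmod (hinner V f e))\<^sup>2 \<le> (hnorm V f)\<^sup>2"
    using zero_le_power2[of "hnorm V (f - cfun_scale (hinner V f e) e)"] by linarith
  then have "cmod (hinner V f e) \<le> hnorm V f" using hnorm_nonneg[OF f] by (simp add: power2_le_iff_abs_le)
  moreover have "cmod (hinner V f e) = cmod (hinner V f g) / hnorm V g"
    using f g pos by (simp add: e_def inner_scale_right norm_divide)
  ultimately show ?thesis using pos by (simp add: divide_le_eq)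
qed

lemma hnorm_triangle:
  assumes f: "f \<in> hcarrier V" and g: "g \<in> hcarrier V"
  shows "hnorm V (f + g) \<le> hnorm V f + hnorm V g"
proof (rule power2_le_imp_le)
  have "Re (hinner V f g) \<le> hnorm V f * hnorm V g"
    using cauchy_schwarz[OF f g] complex_Re_le_cmod order_trans by blast
  then show "(hnorm V (f + g))\<^sup>2 \<le> (hnorm V f + hnorm V g)\<^sup>2"
    by (simp add: hnorm_add_square[OF f g] power2_sum)
  show "0 \<le> hnorm V f + hnorm V g" using f g by (simp add: hnorm_nonneg)
qed

lemma hnorm_reverse_triangle:
  assumes f: "f \<in> hcarrier V" and g: "g \<in> hcarrier V"
  shows "\<bar>hnorm V f - hnorm V g\<bar> \<le> hnorm V (f - g)"
proof -
  have "f - g + g = f" "g - f + f = g" by (auto simp: fun_eq_iff)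
  moreover have "hnorm V (g - f) = hnorm V (f - g)"
    using hnorm_scale[OF diff_mem[OF f g], of "-1"] by (simp add: cfun_scale_def fun_diff_def)
  ultimately show ?thesis
    using hnorm_triangle[OF diff_mem[OF f g] g] hnorm_triangle[OF diff_mem[OF g f] f] by simp
qed

end

text \<open>
  The second assumption combines weak sequential compactness of the unit ball of the domain with
  continuity of \<open>T\<close> from the weak to the norm topology. In this form it yields compactness of \<open>T\<close> and
  the existence of maximizers of \<open>\<parallel>T f\<parallel>\<close>.
\<close>

locale weakly_compact_operator =
  V: inner_product_hspace V + W: inner_product_hspace W
  for V :: "'x hspace" and W :: "'y hspace" +
  fixes T :: "('x \<Rightarrow> complex) \<Rightarrow> 'y \<Rightarrow> complex"
  assumes lin: "linear_operator V W T"
    and weakly_compact: "\<And>f. (\<And>n. f n \<in> hcarrier V \<and> hnorm V (f n) \<le> 1) \<Longrightarrow>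
      \<exists>r g. strict_mono (r :: nat \<Rightarrow> nat) \<and> g \<in> hcarrier V \<and>
        (\<forall>h\<in>hcarrier V. (\<lambda>n. hinner V (f (r n)) h) \<longlonglongrightarrow> hinner V g h) \<and>
        (\<lambda>n. hnorm W (T (f (r n)) - T g)) \<longlonglongrightarrow> 0"
begin

lemma T_mem: "f \<in> hcarrier V \<Longrightarrow> T f \<in> hcarrier W"
  using lin by (auto simp: linear_operator_def)

lemma T_add: "f \<in> hcarrier V \<Longrightarrow> g \<in> hcarrier V \<Longrightarrow> T (f + g) = T f + T g"
  using lin by (auto simp: linear_operator_def)

lemma T_scale: "f \<in> hcarrier V \<Longrightarrow> T (cfun_scale c f) = cfun_scale c (T f)"
  using lin by (auto simp: linear_operator_def)

lemma T_diff: "f \<in> hcarrier V \<Longrightarrow> g \<in> hcarrier V \<Longrightarrow> T (f - g) = T f - T g"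
  unfolding V.diff_conv by (simp add: T_add T_scale V.scale_mem del: cfun.scale_minus_left)

lemma T_zero: "T 0 = 0"
  using T_diff[of 0 0] V.zero_mem by simp

lemma compact: "compact_operator V W T"
  unfolding compact_operator_def
proof (intro conjI allI impI lin)
  fix f :: "nat \<Rightarrow> 'x \<Rightarrow> complex" assume f: "\<forall>n. f n \<in> hcarrier V \<and> hnorm V (f n) \<le> 1"
  obtain r g where "strict_mono (r :: nat \<Rightarrow> nat)" "g \<in> hcarrier V"
    "(\<lambda>n. hnorm W (T (f (r n)) - T g)) \<longlonglongrightarrow> 0"
    using weakly_compact[of f] f by blast
  then show "\<exists>r g. strict_mono (r :: nat \<Rightarrow> nat) \<and> g \<in> hcarrier W \<and> (\<lambda>n. hnorm W (T (f (r n)) - g)) \<longlonglongrightarrow> 0"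
    using T_mem by blast
qed

definition orth_compl :: "('x \<Rightarrow> complex) set \<Rightarrow> ('x \<Rightarrow> complex) set"
  where "orth_compl S = {f \<in> hcarrier V. \<forall>g\<in>S. hinner V f g = 0}"

text \<open>
  The maximum is stated for all vectors by homogeneity. The last conjunct selects the zero vector once
  \<open>T\<close> vanishes on the complement, so that the construction can go on forever even if it runs out of dimensions.
\<close>

definition maximizer :: "('x \<Rightarrow> complex) set \<Rightarrow> ('x \<Rightarrow> complex) \<Rightarrow> bool"
  where "maximizer S f \<longleftrightarrow> f \<in> orth_compl S \<and> hnorm V f \<le> 1 \<and>
    (\<forall>g\<in>orth_compl S. hnorm W (T g) \<le> hnorm W (T f) * hnorm V g) \<and> (hnorm W (T f) = 0 \<longrightarrow> f = 0)"

lemma orth_compl_scale: "S \<subseteq> hcarrier V \<Longrightarrow> f \<in> orth_compl S \<Longrightarrow> cfun_scale c f \<in> orth_compl S"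
  by (auto simp: orth_compl_def V.scale_mem V.inner_scale_left subset_iff)

lemma orth_compl_add: "S \<subseteq> hcarrier V \<Longrightarrow> f \<in> orth_compl S \<Longrightarrow> g \<in> orth_compl S \<Longrightarrow> f + g \<in> orth_compl S"
  by (auto simp: orth_compl_def V.add_mem V.inner_add_left subset_iff)

text \<open>
  Both the orthogonality relations and the bound on the norm survive weak limits, whereas
  \<open>\<parallel>T f\<parallel>\<close> converges because \<open>T\<close> turns weak convergence into norm convergence.
\<close>

lemma weak_limit:
  assumes S: "S \<subseteq> hcarrier V" and f: "\<And>n. f n \<in> orth_compl S" "\<And>n. hnorm V (f n) \<le> 1"
  obtains r g where "strict_mono (r :: nat \<Rightarrow> nat)" "g \<in> orth_compl S" "hnorm V g \<le> 1"
    "(\<lambda>n. hnorm W (T (f (r n)))) \<longlonglongrightarrow> hnorm W (T g)"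
proof -
  have fV: "f n \<in> hcarrier V" for n using f(1) by (simp add: orth_compl_def)
  obtain r g where r: "strict_mono (r :: nat \<Rightarrow> nat)" and g: "g \<in> hcarrier V"
    and weak: "\<And>h. h \<in> hcarrier V \<Longrightarrow> (\<lambda>n. hinner V (f (r n)) h) \<longlonglongrightarrow> hinner V g h"
    and lim: "(\<lambda>n. hnorm W (T (f (r n)) - T g)) \<longlonglongrightarrow> 0"
    using weakly_compact[of f] fV f(2) by blast
  have "hinner V g h = 0" if "h \<in> S" for h
  proof -
    have "(\<lambda>n. hinner V (f (r n)) h) = (\<lambda>n. 0)" using f(1) that by (auto simp: orth_compl_def)
    then show ?thesis using weak[of h] that S by (auto simp: LIMSEQ_const_iff)
  qed
  then have gS: "g \<in> orth_compl S" using g by (simp add: orth_compl_def)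
  have "(hnorm V g)\<^sup>2 \<le> hnorm V g"
  proof -
    have "(\<lambda>n. cmod (hinner V (f (r n)) g)) \<longlonglongrightarrow> cmod (hinner V g g)"
      using weak[OF g] by (rule tendsto_norm)
    moreover have "cmod (hinner V (f (r n)) g) \<le> hnorm V g" for n
      using V.cauchy_schwarz[OF fV[of "r n"] g] f(2)[of "r n"] V.hnorm_nonneg[OF g]
      by (meson mult_left_le_one_le order_trans V.hnorm_nonneg fV)
    ultimately have "cmod (hinner V g g) \<le> hnorm V g" by (intro LIMSEQ_le_const2) auto
    then show ?thesis by (simp add: V.inner_self[OF g] norm_power)
  qed
  then have g1: "hnorm V g \<le> 1"
    using V.hnorm_nonneg[OF g] by (cases "hnorm V g = 0") (auto simp: power2_eq_square)
  have "(\<lambda>n. hnorm W (T (f (r n))) - hnorm W (T g)) \<longlonglongrightarrow> 0"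
    by (rule Lim_null_comparison[OF _ lim]) (simp add: W.hnorm_reverse_triangle T_mem fV g)
  then have "(\<lambda>n. hnorm W (T (f (r n)))) \<longlonglongrightarrow> hnorm W (T g)" by (simp add: LIM_zero_iff)
  with r gS g1 that show ?thesis by blast
qed

text \<open>
  A maximizing sequence on the unit ball has a weak limit at which the supremum is attained. If the
  supremum is zero, the zero vector is taken.
\<close>

lemma ex_maximizer:
  assumes S: "S \<subseteq> hcarrier V"
  shows "\<exists>f. maximizer S f"
proof -
  define A where "A = {f \<in> orth_compl S. hnorm V f \<le> 1}"
  define B where "B f = hnorm W (T f)" for f
  have zeroA: "0 \<in> A" using V.zero_mem V.inner_zero_left S by (auto simp: A_def orth_compl_def V.hnorm_zero)
  have bdd: "bdd_above (B ` A)"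
  proof (rule ccontr)
    assume "\<not> bdd_above (B ` A)"
    then have "\<exists>f\<in>A. real n < B f" for n by (auto simp: bdd_above_def not_le)
    then obtain f where f: "\<And>n. f n \<in> A" "\<And>n. real n < B (f n)" by metis
    obtain r g where r: "strict_mono (r :: nat \<Rightarrow> nat)" and lim: "(\<lambda>n. B (f (r n))) \<longlonglongrightarrow> B g"
      using weak_limit[OF S, of f] f(1) unfolding A_def B_def by blast
    obtain K where K: "\<And>n. norm (B (f (r n))) \<le> K" using convergent_imp_Bseq[of "\<lambda>n. B (f (r n))"] lim
      by (auto simp: convergent_def Bseq_def)
    obtain n :: nat where "K < real n" using reals_Archimedean2 by blast
    also have "real n \<le> real (r n)" using seq_suble[OF r] by simp
    also have "\<dots> < B (f (r n))" by (rule f)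
    finally show False using K[of n] by simp
  qed
  define m where "m = Sup (B ` A)"
  have le_m: "B f \<le> m" if "f \<in> A" for f unfolding m_def using that bdd by (intro cSup_upper) auto
  have "\<exists>f\<in>A. m - 1 / real (Suc n) < B f" for n
    using less_cSup_iff[of "B ` A" "m - 1 / real (Suc n)"] bdd zeroA unfolding m_def by auto
  then obtain f where f: "\<And>n. f n \<in> A" "\<And>n. m - 1 / real (Suc n) < B (f n)" by metis
  obtain r g where r: "strict_mono (r :: nat \<Rightarrow> nat)" and g: "g \<in> orth_compl S" "hnorm V g \<le> 1"
    and lim: "(\<lambda>n. B (f (r n))) \<longlonglongrightarrow> B g"
    using weak_limit[OF S, of f] f(1) unfolding A_def B_def by blast
  have "(\<lambda>n. m - 1 / real (Suc n)) \<longlonglongrightarrow> m - 0"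
    using LIMSEQ_inverse_real_of_nat by (intro tendsto_diff tendsto_const) (simp add: inverse_eq_divide)
  from LIMSEQ_subseq_LIMSEQ[OF this r] have "m - 0 \<le> B g"
    by (rule LIMSEQ_le[OF _ lim]) (auto simp: o_def simp del: of_nat_Suc intro!: exI[of _ 0] less_imp_le f(2))
  then have Bg: "B g = m" using le_m[of g] g by (auto simp: A_def)
  have max: "B h \<le> m * hnorm V h" if h: "h \<in> orth_compl S" for h
  proof (cases "hnorm V h = 0")
    case True
    then have "h = 0" using h V.hnorm_eq_0 by (auto simp: orth_compl_def)
    then show ?thesis by (simp add: B_def T_zero W.hnorm_zero V.hnorm_zero)
  next
    case False
    have hV: "h \<in> hcarrier V" using h by (simp add: orth_compl_def)
    have pos: "hnorm V h > 0" using False V.hnorm_nonneg[OF hV] by simp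
    let ?k = "cfun_scale (of_real (1 / hnorm V h)) h"
    have "?k \<in> A" unfolding A_def using orth_compl_scale[OF S h] pos by (simp add: V.hnorm_scale[OF hV] norm_divide)
    from le_m[OF this] have "B h / hnorm V h \<le> m"
      using pos by (simp add: B_def T_scale[OF hV] W.hnorm_scale[OF T_mem[OF hV]] norm_divide)
    then show ?thesis using pos by (simp add: divide_le_eq)
  qed
  show ?thesis
  proof (cases "m = 0")
    case True
    have "maximizer S 0" unfolding maximizer_def
      using zeroA max True by (auto simp: A_def B_def T_zero W.hnorm_zero V.hnorm_zero)
    then show ?thesis by blast
  next
    case False
    have "maximizer S g" unfolding maximizer_def
      using g max False Bg by (auto simp: B_def)
    then show ?thesis by blast
  qed
qed

text \<open>
  At a maximizer \<open>f\<close> the positive semidefinite form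
  \<open>Q h = \<parallel>T f\<parallel>\<^sup>2 \<parallel>h\<parallel>\<^sup>2 - \<parallel>T h\<parallel>\<^sup>2\<close> vanishes, and a zero of a semidefinite form is orthogonal to every
  vector with respect to it.
\<close>

lemma maximizer_eigenvector:
  assumes S: "S \<subseteq> hcarrier V" and f: "maximizer S f" and h: "h \<in> orth_compl S"
  shows "hinner W (T h) (T f) = of_real ((hnorm W (T f))\<^sup>2) * hinner V h f"
proof -
  define l where "l = hnorm W (T f)"
  have fS: "f \<in> orth_compl S" using f by (simp add: maximizer_def)
  have V: "f \<in> hcarrier V" "h \<in> hcarrier V" using fS h by (auto simp: orth_compl_def)
  have l0: "0 \<le> l" unfolding l_def using W.hnorm_nonneg[OF T_mem[OF V(1)]] .
  define Q where "Q g = l\<^sup>2 * (hnorm V g)\<^sup>2 - (hnorm W (T g))\<^sup>2" for g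
  have Q0: "0 \<le> Q g" if g: "g \<in> orth_compl S" for g
  proof -
    have gV: "g \<in> hcarrier V" using g by (simp add: orth_compl_def)
    have "hnorm W (T g) \<le> l * hnorm V g" using f g by (simp add: maximizer_def l_def)
    then have "(hnorm W (T g))\<^sup>2 \<le> (l * hnorm V g)\<^sup>2" using W.hnorm_nonneg[OF T_mem[OF gV]] by (intro power_mono)
    then show ?thesis by (simp add: Q_def power_mult_distrib)
  qed
  have Qf: "Q f \<le> 0"
    using f V.hnorm_nonneg[OF V(1)] by (simp add: Q_def l_def maximizer_def mult_left_le power_le_one)
  define q where "q = of_real (l\<^sup>2) * hinner V h f - hinner W (T h) (T f)"
  have expand: "Q (f + cfun_scale c h) = Q f + 2 * Re (c * q) + (cmod c)\<^sup>2 * Q h" for c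
  proof -
    have X: "Re (hinner V f (cfun_scale c h)) = Re (c * hinner V h f)"
      using V by (subst V.inner_commute[of "cfun_scale c h"]) (auto simp: V.scale_mem V.inner_scale_left)
    have Y: "Re (hinner W (T f) (cfun_scale c (T h))) = Re (c * hinner W (T h) (T f))"
      using V by (subst W.inner_commute[of "cfun_scale c (T h)"]) (auto simp: W.scale_mem W.inner_scale_left T_mem)
    have 1: "(hnorm V (f + cfun_scale c h))\<^sup>2 = (hnorm V f)\<^sup>2 + 2 * Re (c * hinner V h f) + (cmod c)\<^sup>2 * (hnorm V h)\<^sup>2"
      unfolding X[symmetric] V.hnorm_add_square[OF V(1) V.scale_mem[OF V(2)]] V.hnorm_scale[OF V(2)] power_mult_distrib ..
    have 2: "(hnorm W (T (f + cfun_scale c h)))\<^sup>2 =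
        (hnorm W (T f))\<^sup>2 + 2 * Re (c * hinner W (T h) (T f)) + (cmod c)\<^sup>2 * (hnorm W (T h))\<^sup>2"
      unfolding Y[symmetric] T_add[OF V(1) V.scale_mem[OF V(2)]] T_scale[OF V(2)]
        W.hnorm_add_square[OF T_mem[OF V(1)] W.scale_mem[OF T_mem[OF V(2)]]] W.hnorm_scale[OF T_mem[OF V(2)]] power_mult_distrib ..
    have "c * q = of_real (l\<^sup>2) * (c * hinner V h f) - c * hinner W (T h) (T f)"
      by (simp only: q_def right_diff_distrib mult_ac)
    then have 3: "Re (c * q) = l\<^sup>2 * Re (c * hinner V h f) - Re (c * hinner W (T h) (T f))"
      by (simp only: Re_complex_of_real minus_complex.sel times_complex.sel Im_complex_of_real mult_zero_left diff_zero)
    show ?thesis unfolding Q_def 1 2 3 by (simp only: algebra_simps)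
  qed
  have "q = 0"
  proof (rule ccontr)
    assume "q \<noteq> 0"
    then have q: "(cmod q)\<^sup>2 > 0" by simp
    \<comment> \<open>For small \<open>t\<close> the linear term of \<open>Q (f - t cnj q h)\<close> outweighs the quadratic one; this \<open>t\<close> is small enough.\<close>
    define t where "t = 1 / (Q h + 1)"
    have t: "t > 0" "t * Q h < 1" using Q0[OF h] by (auto simp: t_def field_simps)
    have "0 \<le> Q (f + cfun_scale (- of_real t * cnj q) h)"
      by (intro Q0 orth_compl_add orth_compl_scale S fS h)
    also have "\<dots> = Q f + 2 * Re ((- of_real t * cnj q) * q) + (cmod (- of_real t * cnj q))\<^sup>2 * Q h"
      by (rule expand)
    also have "(- of_real t * cnj q) * q = of_real (- t * (cmod q)\<^sup>2)"
      by (simp add: complex_eq_iff cmod_power2) (simp add: power2_eq_square algebra_simps)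
    also have "(cmod (- of_real t * cnj q))\<^sup>2 = t\<^sup>2 * (cmod q)\<^sup>2"
      by (simp add: norm_mult power_mult_distrib)
    finally have "0 \<le> t * (cmod q)\<^sup>2 * (t * Q h - 2)" using Qf by (simp add: power2_eq_square algebra_simps)
    moreover have "t * (cmod q)\<^sup>2 * (t * Q h - 2) < 0" using t q by (intro mult_pos_neg) auto
    ultimately show False by simp
  qed
  then show ?thesis by (simp add: q_def l_def)
qed


text \<open>
  The recursion runs over the set of vectors chosen so far, because the choice of a maximizer depends
  on all of them.
\<close>

definition previous_vectors :: "nat \<Rightarrow> ('x \<Rightarrow> complex) set"
  where "previous_vectors = rec_nat {} (\<lambda>n S. insert (SOME f. maximizer S f) S)"

definition singular_vector :: "nat \<Rightarrow> 'x \<Rightarrow> complex"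
  where "singular_vector n = (SOME f. maximizer (previous_vectors n) f)"

definition singular_value :: "nat \<Rightarrow> real"
  where "singular_value n = hnorm W (T (singular_vector n))"

lemma previous_vectors_eq: "previous_vectors n = singular_vector ` {..<n}"
  by (induction n) (auto simp: previous_vectors_def singular_vector_def lessThan_Suc)

lemma previous_vectors_carrier: "previous_vectors n \<subseteq> hcarrier V"
proof (induction n)
  case (Suc n)
  have "maximizer (previous_vectors n) (singular_vector n)"
    unfolding singular_vector_def using ex_maximizer[OF Suc] by (rule someI_ex)
  then show ?case using Suc by (auto simp: previous_vectors_eq lessThan_Suc maximizer_def orth_compl_def)
qed (simp add: previous_vectors_eq)

lemma singular_vector_maximizer: "maximizer (previous_vectors n) (singular_vector n)"
  unfolding singular_vector_def using ex_maximizer[OF previous_vectors_carrier] by (rule someI_ex)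

lemma singular_vector_mem: "singular_vector n \<in> hcarrier V"
  using singular_vector_maximizer[of n] by (simp add: maximizer_def orth_compl_def)

lemma singular_vector_norm_le: "hnorm V (singular_vector n) \<le> 1"
  using singular_vector_maximizer[of n] by (simp add: maximizer_def)

lemma singular_vector_orthogonal: "m \<noteq> n \<Longrightarrow> hinner V (singular_vector m) (singular_vector n) = 0"
proof (induction m n rule: linorder_wlog)
  case (le m n)
  then have "hinner V (singular_vector n) (singular_vector m) = 0"
    using singular_vector_maximizer[of n] by (auto simp: maximizer_def orth_compl_def previous_vectors_eq)
  then show ?case by (subst V.inner_commute) (auto simp: singular_vector_mem)
next
  case (sym m n)
  then have "hinner V (singular_vector n) (singular_vector m) = 0" by simp
  then show ?case by (subst V.inner_commute) (auto simp: singular_vector_mem)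
qed

lemma singular_value_nonneg: "0 \<le> singular_value n"
  unfolding singular_value_def by (intro W.hnorm_nonneg T_mem singular_vector_mem)

lemma singular_value_bound:
  assumes "f \<in> hcarrier V" "\<And>i. i < n \<Longrightarrow> hinner V f (singular_vector i) = 0"
  shows "hnorm W (T f) \<le> singular_value n * hnorm V f"
  using singular_vector_maximizer[of n] assms
  by (auto simp: maximizer_def orth_compl_def previous_vectors_eq singular_value_def)

lemma decseq_singular_value: "decseq singular_value"
proof (rule decseq_SucI)
  fix n
  have "hnorm W (T (singular_vector (Suc n))) \<le> singular_value n * hnorm V (singular_vector (Suc n))"
    by (intro singular_value_bound singular_vector_mem singular_vector_orthogonal) simp
  also have "\<dots> \<le> singular_value n"
    by (rule mult_left_le[OF singular_vector_norm_le singular_value_nonneg])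
  finally show "singular_value (Suc n) \<le> singular_value n" unfolding singular_value_def[of "Suc n"] .
qed

text \<open>
  Were the norm smaller than one, rescaling would increase the maximum.
\<close>

lemma singular_vector_norm_1:
  assumes "singular_vector n \<noteq> 0"
  shows "hnorm V (singular_vector n) = 1"
proof -
  let ?e = "singular_vector n"
  have "singular_value n \<noteq> 0"
    using assms singular_vector_maximizer[of n] by (auto simp: maximizer_def singular_value_def)
  then have pos: "singular_value n > 0" using singular_value_nonneg[of n] by simp
  have "singular_value n \<le> singular_value n * hnorm V ?e"
    using singular_value_bound[OF singular_vector_mem[of n], of n] singular_vector_orthogonal[of n]
    by (simp add: singular_value_def)
  then have "1 \<le> hnorm V ?e" using pos by simp
  with singular_vector_norm_le[of n] show ?thesis by simp
qed

lemma remove_singular_component: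
  fixes n :: nat
  assumes f: "f \<in> hcarrier V"
  defines "g \<equiv> f - cfun_scale (hinner V f (singular_vector n)) (singular_vector n)"
  shows "g \<in> hcarrier V" "hinner V g (singular_vector n) = 0"
    "m \<noteq> n \<Longrightarrow> hinner V g (singular_vector m) = hinner V f (singular_vector m)"
proof -
  note mem = singular_vector_mem
  show "g \<in> hcarrier V" unfolding g_def by (intro V.diff_mem V.scale_mem f mem)
  have gi: "hinner V g (singular_vector m) = hinner V f (singular_vector m)
      - hinner V f (singular_vector n) * hinner V (singular_vector n) (singular_vector m)" for m
    unfolding g_def using f mem by (simp add: V.inner_diff_left V.inner_scale_left V.scale_mem)
  show "m \<noteq> n \<Longrightarrow> hinner V g (singular_vector m) = hinner V f (singular_vector m)"
    using gi[of m] singular_vector_orthogonal[of n m] by simp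
  show "hinner V g (singular_vector n) = 0"
  proof (cases "singular_vector n = 0")
    case True
    then show ?thesis using \<open>g \<in> hcarrier V\<close> by (simp add: V.inner_zero_right)
  next
    case False
    then show ?thesis using gi[of n] singular_vector_norm_1[of n] by (simp add: V.inner_self[OF mem])
  qed
qed

text \<open>
  On the orthogonal complement of the previous vectors this is the variational property; on these
  vectors both sides vanish. An arbitrary \<open>h\<close> is reduced to the complement by removing its components along
  them, the last one first.
\<close>

lemma singular_vector_eigen:
  assumes h: "h \<in> hcarrier V"
  shows "hinner W (T h) (T (singular_vector n)) = of_real ((singular_value n)\<^sup>2) * hinner V h (singular_vector n)"
proof -
  let ?P = "\<lambda>n h. hinner W (T h) (T (singular_vector n)) = of_real ((singular_value n)\<^sup>2) * hinner V h (singular_vector n)"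
  have top: "?P n h" if "h \<in> hcarrier V" "\<And>i. i < n \<Longrightarrow> hinner V h (singular_vector i) = 0" for n h
    unfolding singular_value_def
    by (rule maximizer_eigenvector[OF previous_vectors_carrier singular_vector_maximizer])
      (use that in \<open>auto simp: orth_compl_def previous_vectors_eq\<close>)
  \<comment> \<open>Symmetry: the roles of the two vectors are exchanged, and the property of the earlier one is used.\<close>
  have lower: "?P n (singular_vector i)" if "i < n" for i
  proof -
    have "?P i (singular_vector n)"
      by (rule top) (use that in \<open>auto simp: singular_vector_mem singular_vector_orthogonal\<close>)
    then have "hinner W (T (singular_vector n)) (T (singular_vector i)) = 0"
      using that by (simp add: singular_vector_orthogonal)
    then have "hinner W (T (singular_vector i)) (T (singular_vector n)) = 0"
      by (subst W.inner_commute) (auto simp: T_mem singular_vector_mem)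
    then show ?thesis using that by (simp add: singular_vector_orthogonal)
  qed
  have "\<forall>h\<in>hcarrier V. (\<forall>i<k. hinner V h (singular_vector i) = 0) \<longrightarrow> ?P n h" if "k \<le> n" for k
    using that
  proof (induction k rule: inc_induct)
    case base
    then show ?case using top by blast
  next
    case (step k)
    show ?case
    proof (intro ballI impI)
      fix h assume h: "h \<in> hcarrier V" and orth: "\<forall>i<k. hinner V h (singular_vector i) = 0"
      define c where "c = hinner V h (singular_vector k)"
      define g where "g = h - cfun_scale c (singular_vector k)"
      have gV: "g \<in> hcarrier V" using remove_singular_component(1)[OF h] unfolding g_def c_def .
      have "hinner V g (singular_vector i) = 0" if "i < Suc k" for i
        using that remove_singular_component(2)[OF h, of k] remove_singular_component(3)[OF h, of i k] orth
        unfolding g_def c_def by (cases "i = k") auto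
      then have "?P n g" using step.IH gV by blast
      moreover have "?P n (singular_vector k)" using lower[of k] step.hyps by simp
      moreover have "h = g + cfun_scale c (singular_vector k)" by (simp add: g_def)
      ultimately show "?P n h"
        using gV by (simp add: T_add T_scale V.scale_mem W.scale_mem T_mem singular_vector_mem
          V.inner_add_left W.inner_add_left V.inner_scale_left W.inner_scale_left algebra_simps)
    qed
  qed
  from this[of 0] h show ?thesis by simp
qed

text \<open>
  An eigenvector for \<open>t\<^sup>2\<close> is orthogonal to all \<open>e\<^sub>n\<close> with \<open>s\<^sub>n \<noteq> t\<close>. After removing its components
  along the remaining ones it is orthogonal to all \<open>e\<^sub>n\<close>, so \<open>t \<parallel>f\<parallel> = \<parallel>T f\<parallel> \<le> s\<^sub>n \<parallel>f\<parallel>\<close> for every \<open>n\<close>, which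
  forces \<open>f = 0\<close>. Hence the \<open>e\<^sub>n\<close> with \<open>s\<^sub>n = t\<close> form a basis of the eigenspace.
\<close>

lemma singular_numbers_singular_value:
  assumes lim: "singular_value \<longlonglongrightarrow> 0"
  shows "singular_numbers V W T singular_value"
  unfolding singular_numbers_def
proof (intro conjI allI impI singular_value_nonneg decseq_singular_value lim)
  fix t :: real assume t: "t > 0"
  let ?s = singular_value and ?e = singular_vector
  define I where "I = {n. ?s n = t}"
  define E where "E = singular_eigenspace V W T t"
  have E_iff: "f \<in> E \<longleftrightarrow> f \<in> hcarrier V \<and> (\<forall>h\<in>hcarrier V. hinner W (T h) (T f) = of_real (t\<^sup>2) * hinner V h f)" for f
    by (auto simp: E_def singular_eigenspace_def adjoint_graph_def T_mem V.scale_mem V.inner_scale_right)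
  have "\<forall>\<^sub>F n in sequentially. ?s n < t" using lim t by (rule order_tendstoD)
  then obtain N where "\<And>n. n \<ge> N \<Longrightarrow> ?s n < t" by (auto simp: eventually_sequentially)
  then have "I \<subseteq> {..<N}" unfolding I_def by (force simp: not_less[symmetric])
  then have finI: "finite I" by (rule finite_subset) simp
  have norm1: "hnorm V (?e i) = 1" if "i \<in> I" for i
    by (rule singular_vector_norm_1) (use that t in \<open>auto simp: I_def singular_value_def T_zero W.hnorm_zero\<close>)
  have inj: "inj_on ?e I"
  proof (rule inj_onI, rule ccontr)
    fix i j assume ij: "i \<in> I" "j \<in> I" "?e i = ?e j" "i \<noteq> j"
    then have "hinner V (?e i) (?e i) = 0" using singular_vector_orthogonal[of i j] by simp
    then show False using norm1[OF ij(1)] V.inner_self[OF singular_vector_mem, of i] by simp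
  qed
  have eE: "?e ` I \<subseteq> E"
    by (auto simp: E_iff I_def singular_vector_mem singular_vector_eigen)
  have indep: "\<not> cfun.dependent (?e ` J)" if "finite J" "J \<subseteq> I" for J
    using that
  proof (induction J rule: finite_induct)
    case (insert k J)
    have "cfun.span (?e ` J) \<subseteq> {f \<in> hcarrier V. hinner V f (?e k) = 0}"
    proof (rule cfun.span_minimal)
      show "?e ` J \<subseteq> {f \<in> hcarrier V. hinner V f (?e k) = 0}"
        using insert.hyps by (auto simp: singular_vector_mem intro!: singular_vector_orthogonal)
      show "cfun.subspace {f \<in> hcarrier V. hinner V f (?e k) = 0}"
        by (rule cfun.subspaceI)
          (auto simp: V.zero_mem V.add_mem V.scale_mem V.inner_zero_left V.inner_add_left V.inner_scale_left singular_vector_mem)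
    qed
    moreover have "hinner V (?e k) (?e k) \<noteq> 0"
      using norm1[of k] insert.prems V.inner_self[OF singular_vector_mem, of k] by simp
    ultimately have "?e k \<notin> cfun.span (?e ` J)" by auto
    then show ?case using insert by (simp add: cfun.independent_insertI)
  qed (simp add: cfun.independent_empty)
  have project: "\<exists>g\<in>E. f - g \<in> cfun.span (?e ` J) \<and> (\<forall>i\<in>J. hinner V g (?e i) = 0)"
    if "finite J" "J \<subseteq> I" and f: "f \<in> E" for J f
    using that(1,2)
  proof (induction J rule: finite_induct)
    case empty
    then show ?case using f by (intro bexI[of _ f]) (auto simp: cfun.span_zero)
  next
    case (insert k J)
    then have "J \<subseteq> I" by simp
    from insert.IH[OF this] obtain g where g: "g \<in> E" "f - g \<in> cfun.span (?e ` J)" "\<forall>i\<in>J. hinner V g (?e i) = 0"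
      by blast
    have gV: "g \<in> hcarrier V" using g E_iff by auto
    define c where "c = hinner V g (?e k)"
    define g' where "g' = g - cfun_scale c (?e k)"
    note rem = remove_singular_component[OF gV, where n = k, folded c_def, folded g'_def]
    have "?e k \<in> E" using eE insert.prems by auto
    then have g'E: "g' \<in> E" using g(1) rem(1) unfolding g'_def E_iff
      by (simp add: T_diff T_scale V.scale_mem W.scale_mem T_mem V.inner_diff_right W.inner_diff_right
          V.inner_scale_right W.inner_scale_right right_diff_distrib mult_ac)
    have "f - g' = (f - g) + cfun_scale c (?e k)" by (simp add: g'_def)
    moreover have "f - g \<in> cfun.span (?e ` insert k J)" using g(2) cfun.span_mono[of "?e ` J" "?e ` insert k J"] by auto
    moreover have "cfun_scale c (?e k) \<in> cfun.span (?e ` insert k J)" by (intro cfun.span_scale cfun.span_base) auto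
    ultimately have "f - g' \<in> cfun.span (?e ` insert k J)" by (simp only: cfun.span_add)
    moreover have "\<forall>i\<in>insert k J. hinner V g' (?e i) = 0"
      using rem(2) rem(3) g(3) by (metis insert_iff)
    ultimately show ?case using g'E by blast
  qed
  have zero: "f = 0" if f: "f \<in> E" and orth: "\<forall>i\<in>I. hinner V f (?e i) = 0" for f
  proof -
    have fV: "f \<in> hcarrier V" and feig: "\<And>h. h \<in> hcarrier V \<Longrightarrow> hinner W (T h) (T f) = of_real (t\<^sup>2) * hinner V h f"
      using f E_iff by auto
    have all: "hinner V f (?e n) = 0" for n
    proof (cases "n \<in> I")
      case False
      then have ne: "(?s n)\<^sup>2 \<noteq> t\<^sup>2" using t singular_value_nonneg[of n] by (simp add: I_def)
      have "of_real ((?s n)\<^sup>2) * hinner V f (?e n) = hinner W (T f) (T (?e n))"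
        using singular_vector_eigen[OF fV] by simp
      also have "\<dots> = cnj (hinner W (T (?e n)) (T f))" by (intro W.inner_commute T_mem fV singular_vector_mem)
      also have "\<dots> = of_real (t\<^sup>2) * cnj (hinner V (?e n) f)" by (simp add: feig singular_vector_mem)
      also have "cnj (hinner V (?e n) f) = hinner V f (?e n)" by (intro V.inner_commute[symmetric] fV singular_vector_mem)
      finally have "of_real ((?s n)\<^sup>2 - t\<^sup>2) * hinner V f (?e n) = 0" by (simp add: algebra_simps)
      then show ?thesis using ne by (simp flip: of_real_power of_real_diff)
    qed (use orth in auto)
    have le: "t * hnorm V f \<le> ?s n * hnorm V f" for n
    proof -
      have "complex_of_real ((hnorm W (T f))\<^sup>2) = of_real ((t * hnorm V f)\<^sup>2)"
        using feig[OF fV] by (simp add: V.inner_self[OF fV] W.inner_self[OF T_mem[OF fV]] power_mult_distrib)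
      then have "(hnorm W (T f))\<^sup>2 = (t * hnorm V f)\<^sup>2" by (simp only: of_real_eq_iff)
      then have "hnorm W (T f) = t * hnorm V f"
        using t V.hnorm_nonneg[OF fV] W.hnorm_nonneg[OF T_mem[OF fV]] by simp
      then show ?thesis using singular_value_bound[OF fV, of n] all by simp
    qed
    have "(\<lambda>n. ?s n * hnorm V f) \<longlonglongrightarrow> 0 * hnorm V f" by (intro tendsto_intros lim)
    then have "t * hnorm V f \<le> 0" using le by (intro LIMSEQ_le_const) auto
    then have "hnorm V f = 0" using t V.hnorm_nonneg[OF fV] by (simp add: mult_le_0_iff)
    then show ?thesis using V.hnorm_eq_0 fV by blast
  qed
  have "E \<subseteq> cfun.span (?e ` I)"
  proof
    fix f assume "f \<in> E"
    then obtain g where g: "g \<in> E" "f - g \<in> cfun.span (?e ` I)" "\<forall>i\<in>I. hinner V g (?e i) = 0"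
      using project[OF finI subset_refl] by blast
    then show "f \<in> cfun.span (?e ` I)" using zero[OF g(1,3)] by simp
  qed
  then have "cfun.dim E = card (?e ` I)"
    using eE indep[OF finI subset_refl] by (intro cfun.dim_unique[of "?e ` I"]) auto
  then show "card {n. ?s n = t} = cfun.dim (singular_eigenspace V W T t)"
    using card_image[OF inj] by (simp add: I_def E_def)
qed

end


section \<open>The Hardy space and its kernels\<close>

lemma hardy_iff:
  "f \<in> hcarrier hardy_space \<longleftrightarrow> f holomorphic_on \<bbbD> \<and> (\<forall>z. z \<notin> \<bbbD> \<longrightarrow> f z = 0) \<and>
    summable (\<lambda>n. (cmod (taylor_coeff f n))\<^sup>2)"
  by (simp add: hardy_space_def)

lemma hinner_hardy: "hinner hardy_space f g = (\<Sum>n. taylor_coeff f n * cnj (taylor_coeff g n))"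
  by (simp add: hardy_space_def)

lemma summable_cmod_product:
  fixes a b :: "nat \<Rightarrow> complex"
  assumes "summable (\<lambda>n. (cmod (a n))\<^sup>2)" "summable (\<lambda>n. (cmod (b n))\<^sup>2)"
  shows "summable (\<lambda>n. cmod (a n) * cmod (b n))"
proof (rule summable_comparison_test)
  show "summable (\<lambda>n. (cmod (a n))\<^sup>2 + (cmod (b n))\<^sup>2)" using assms by (rule summable_add)
  show "\<exists>N. \<forall>n\<ge>N. norm (cmod (a n) * cmod (b n)) \<le> (cmod (a n))\<^sup>2 + (cmod (b n))\<^sup>2"
  proof (intro exI[of _ 0] allI impI)
    fix n
    have "2 * (cmod (a n) * cmod (b n)) \<le> (cmod (a n))\<^sup>2 + (cmod (b n))\<^sup>2"
      using sum_squares_bound[of "cmod (a n)" "cmod (b n)"] by (simp add: mult.assoc)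
    moreover have "0 \<le> cmod (a n) * cmod (b n)" by simp
    ultimately show "norm (cmod (a n) * cmod (b n)) \<le> (cmod (a n))\<^sup>2 + (cmod (b n))\<^sup>2"
      unfolding real_norm_def by linarith
  qed
qed

lemma summable_hardy_inner:
  assumes "f \<in> hcarrier hardy_space" "g \<in> hcarrier hardy_space"
  shows "summable (\<lambda>n. taylor_coeff f n * cnj (taylor_coeff g n))"
proof (rule summable_norm_cancel)
  show "summable (\<lambda>n. cmod (taylor_coeff f n * cnj (taylor_coeff g n)))"
    using summable_cmod_product assms by (simp add: norm_mult hardy_iff)
qed

lemma summable_square_add:
  fixes a b :: "nat \<Rightarrow> complex"
  assumes "summable (\<lambda>n. (cmod (a n))\<^sup>2)" "summable (\<lambda>n. (cmod (b n))\<^sup>2)"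
  shows "summable (\<lambda>n. (cmod (a n + b n))\<^sup>2)"
proof (rule summable_comparison_test)
  show "summable (\<lambda>n. (cmod (a n))\<^sup>2 + (cmod (b n))\<^sup>2 + 2 * (cmod (a n) * cmod (b n)))"
    using assms by (intro summable_add summable_mult summable_cmod_product)
  show "\<exists>N. \<forall>n\<ge>N. norm ((cmod (a n + b n))\<^sup>2) \<le> (cmod (a n))\<^sup>2 + (cmod (b n))\<^sup>2 + 2 * (cmod (a n) * cmod (b n))"
  proof (intro exI[of _ 0] allI impI)
    fix n
    have "(cmod (a n + b n))\<^sup>2 \<le> (cmod (a n) + cmod (b n))\<^sup>2"
      by (intro power_mono norm_triangle_ineq norm_ge_zero)
    then show "norm ((cmod (a n + b n))\<^sup>2) \<le> (cmod (a n))\<^sup>2 + (cmod (b n))\<^sup>2 + 2 * (cmod (a n) * cmod (b n))"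
      by (simp add: power2_sum)
  qed
qed

lemma hardy_add: "f \<in> hcarrier hardy_space \<Longrightarrow> g \<in> hcarrier hardy_space \<Longrightarrow> f + g \<in> hcarrier hardy_space"
proof -
  assume f: "f \<in> hcarrier hardy_space" and g: "g \<in> hcarrier hardy_space"
  then have "summable (\<lambda>n. (cmod (taylor_coeff f n + taylor_coeff g n))\<^sup>2)"
    by (intro summable_square_add) (simp_all add: hardy_iff)
  moreover have "f + g holomorphic_on \<bbbD>"
    using f g unfolding plus_fun_def hardy_iff by (intro holomorphic_on_add) auto
  ultimately show ?thesis using f g by (simp add: hardy_iff taylor_coeff_add)
qed

lemma hardy_scale: "f \<in> hcarrier hardy_space \<Longrightarrow> cfun_scale c f \<in> hcarrier hardy_space"
proof -
  assume f: "f \<in> hcarrier hardy_space"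
  then have "summable (\<lambda>n. (cmod c)\<^sup>2 * (cmod (taylor_coeff f n))\<^sup>2)" by (intro summable_mult) (simp add: hardy_iff)
  moreover have "cfun_scale c f holomorphic_on \<bbbD>"
    using f unfolding cfun_scale_def hardy_iff by (intro holomorphic_on_mult holomorphic_on_const) auto
  moreover have "cfun_scale c f z = 0" if "z \<notin> \<bbbD>" for z
    using f that unfolding cfun_scale_def hardy_iff by simp
  ultimately show ?thesis using f by (simp add: hardy_iff taylor_coeff_scale norm_mult power_mult_distrib)
qed

global_interpretation hardy: inner_product_hspace hardy_space
proof
  have "taylor_coeff (0 :: complex \<Rightarrow> complex) n = 0" for n by (rule taylor_coeff_eqI) simp
  then show "0 \<in> hcarrier hardy_space" by (simp add: hardy_iff zero_fun_def holomorphic_on_const)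
next
  fix f g h :: "complex \<Rightarrow> complex"
  assume f: "f \<in> hcarrier hardy_space" and g: "g \<in> hcarrier hardy_space" and h: "h \<in> hcarrier hardy_space"
  show "hinner hardy_space (f + g) h = hinner hardy_space f h + hinner hardy_space g h"
    using summable_hardy_inner[OF f h] summable_hardy_inner[OF g h] f g
    by (simp add: hinner_hardy hardy_iff taylor_coeff_add distrib_right suminf_add)
next
  fix f h :: "complex \<Rightarrow> complex" and c
  assume f: "f \<in> hcarrier hardy_space" and h: "h \<in> hcarrier hardy_space"
  show "hinner hardy_space (cfun_scale c f) h = c * hinner hardy_space f h"
    using suminf_mult[OF summable_hardy_inner[OF f h], of c] f
    by (simp add: hinner_hardy hardy_iff taylor_coeff_scale mult.assoc)
next
  fix f g :: "complex \<Rightarrow> complex"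
  assume f: "f \<in> hcarrier hardy_space" and g: "g \<in> hcarrier hardy_space"
  have "(\<lambda>n. cnj (taylor_coeff f n * cnj (taylor_coeff g n))) sums cnj (hinner hardy_space f g)"
    unfolding sums_cnj hinner_hardy by (rule summable_sums[OF summable_hardy_inner[OF f g]])
  then show "hinner hardy_space g f = cnj (hinner hardy_space f g)"
    unfolding hinner_hardy[of g f] by (simp add: sums_iff mult.commute)
next
  fix f :: "complex \<Rightarrow> complex" assume f: "f \<in> hcarrier hardy_space"
  then have hol: "f holomorphic_on \<bbbD>" and out: "\<forall>z. z \<notin> \<bbbD> \<longrightarrow> f z = 0"
    and sf: "summable (\<lambda>n. (cmod (taylor_coeff f n))\<^sup>2)"
    unfolding hardy_iff by blast+
  have eq: "hinner hardy_space f f = of_real (\<Sum>n. (cmod (taylor_coeff f n))\<^sup>2)"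
    unfolding hinner_hardy complex_norm_square[symmetric] by (rule suminf_of_real[OF sf, symmetric])
  show "0 \<le> Re (hinner hardy_space f f)"
    unfolding eq Re_complex_of_real by (rule suminf_nonneg[OF sf]) simp
  assume "Re (hinner hardy_space f f) = 0"
  then have "(\<Sum>n. (cmod (taylor_coeff f n))\<^sup>2) = 0" unfolding eq Re_complex_of_real .
  then have "(cmod (taylor_coeff f n))\<^sup>2 = 0" for n
    using suminf_eq_zero_iff[OF sf] by simp
  then have "f z = 0" if "z \<in> \<bbbD>" for z
    using taylor_coeff_sums[OF hol that] by (simp add: sums_iff)
  with out show "f = 0" unfolding fun_eq_iff zero_fun_def by blast
qed (rule hardy_add hardy_scale; assumption)+

lemma hnorm_hardy_square:
  assumes "f \<in> hcarrier hardy_space"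
  shows "(hnorm hardy_space f)\<^sup>2 = (\<Sum>n. (cmod (taylor_coeff f n))\<^sup>2)"
proof -
  have "complex_of_real ((hnorm hardy_space f)\<^sup>2) = (\<Sum>n. of_real ((cmod (taylor_coeff f n))\<^sup>2))"
    unfolding hardy.inner_self[OF assms, symmetric] hinner_hardy complex_norm_square[symmetric] ..
  also have "\<dots> = of_real (\<Sum>n. (cmod (taylor_coeff f n))\<^sup>2)"
    using assms by (intro suminf_of_real[symmetric]) (simp add: hardy_iff)
  finally show ?thesis by (simp only: of_real_eq_iff)
qed

lemma bounded_holomorphic_hardy:
  assumes hol: "f holomorphic_on \<bbbD>" and out: "\<And>z. z \<notin> \<bbbD> \<Longrightarrow> f z = 0"
    and B: "\<And>z. z \<in> \<bbbD> \<Longrightarrow> cmod (f z) \<le> B"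
  shows "f \<in> hcarrier hardy_space"
proof -
  have B0: "0 \<le> B" using B[of 0] order_trans[OF norm_ge_zero] by auto
  \<comment> \<open>A bounded function is compared with the constant \<open>B\<close>.\<close>
  have tc: "taylor_coeff (\<lambda>z. complex_of_real B) n = (if n = 0 then of_real B else 0)" for n
  proof (rule taylor_coeff_eqI)
    fix z
    have "(\<lambda>n. (if n = 0 then complex_of_real B else 0) * z ^ n) = (\<lambda>n. if n = 0 then of_real B else 0)" by auto
    then show "(\<lambda>n. (if n = 0 then complex_of_real B else 0) * z ^ n) sums of_real B"
      using sums_single[of 0 "\<lambda>n. complex_of_real B"] by simp
  qed
  have "summable (\<lambda>n. (cmod (taylor_coeff (\<lambda>z. complex_of_real B) n))\<^sup>2)"
    unfolding tc by (rule summable_finite[of "{0}"]) auto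
  then have "summable (\<lambda>n. (cmod (taylor_coeff f n))\<^sup>2)"
    using B B0 by (intro taylor_square_sum_mono(1)[OF hol holomorphic_on_const[of "complex_of_real B"]]) auto
  with hol out show ?thesis by (simp add: hardy_iff)
qed

lemma hardy_multiplier:
  assumes hol: "\<theta> holomorphic_on \<bbbD>" and le: "\<And>z. z \<in> \<bbbD> \<Longrightarrow> cmod (\<theta> z) \<le> 1"
    and g: "g \<in> hcarrier hardy_space"
  shows "(\<lambda>z. \<theta> z * g z) \<in> hcarrier hardy_space"
    and "hnorm hardy_space (\<lambda>z. \<theta> z * g z) \<le> hnorm hardy_space g"
proof -
  have ghol: "g holomorphic_on \<bbbD>" and gs: "summable (\<lambda>n. (cmod (taylor_coeff g n))\<^sup>2)"
    using g by (auto simp: hardy_iff)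
  have h: "(\<lambda>z. \<theta> z * g z) holomorphic_on \<bbbD>" using hol ghol by (rule holomorphic_on_mult)
  have b: "cmod (\<theta> z * g z) \<le> cmod (g z)" if "z \<in> \<bbbD>" for z
    using le[OF that] by (simp add: norm_mult mult_left_le_one_le)
  have sf: "summable (\<lambda>n. (cmod (taylor_coeff (\<lambda>z. \<theta> z * g z) n))\<^sup>2)"
    by (rule taylor_square_sum_mono(1)[OF h ghol b gs])
  have mono: "(\<Sum>n. (cmod (taylor_coeff (\<lambda>z. \<theta> z * g z) n))\<^sup>2) \<le> (\<Sum>n. (cmod (taylor_coeff g n))\<^sup>2)"
    by (rule taylor_square_sum_mono(2)[OF h ghol b gs])
  show mem: "(\<lambda>z. \<theta> z * g z) \<in> hcarrier hardy_space" using g h sf by (auto simp: hardy_iff)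
  show "hnorm hardy_space (\<lambda>z. \<theta> z * g z) \<le> hnorm hardy_space g"
    using mono unfolding hnorm_hardy_square[OF mem, symmetric] hnorm_hardy_square[OF g, symmetric]
    by (rule power2_le_imp_le) (rule hardy.hnorm_nonneg[OF g])
qed

definition szego :: "complex \<Rightarrow> complex \<Rightarrow> complex"
  where "szego w z = (if z \<in> \<bbbD> then 1 / (1 - cnj w * z) else 0)"

text \<open>
  The derivative of the Szego kernel with respect to the conjugate of \<open>w\<close>; it represents
  evaluation of the derivative at \<open>w\<close>.
\<close>

definition szego_deriv :: "complex \<Rightarrow> complex \<Rightarrow> complex"
  where "szego_deriv w z = (if z \<in> \<bbbD> then z / (1 - cnj w * z)\<^sup>2 else 0)"

context
  fixes w :: complex assumes w: "w \<in> \<bbbD>"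
begin

lemma disk_product: "z \<in> \<bbbD> \<Longrightarrow> cmod (cnj w * z) \<le> cmod w" "z \<in> \<bbbD> \<Longrightarrow> cmod (cnj w * z) < 1"
  "z \<in> \<bbbD> \<Longrightarrow> 1 - cnj w * z \<noteq> 0"
proof -
  show *: "cmod (cnj w * z) \<le> cmod w" if "z \<in> \<bbbD>" for z
    using that by (simp add: norm_mult mult_left_le)
  show **: "cmod (cnj w * z) < 1" if "z \<in> \<bbbD>" for z
    using *[OF that] w by simp
  show "1 - cnj w * z \<noteq> 0" if "z \<in> \<bbbD>" for z
    using **[OF that] by auto
qed

lemma szego_taylor: "taylor_coeff (szego w) n = cnj w ^ n"
proof (rule taylor_coeff_eqI)
  fix z assume z: "z \<in> \<bbbD>"
  show "(\<lambda>n. cnj w ^ n * z ^ n) sums szego w z"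
    using geometric_sums[OF disk_product(2)[OF z]] z by (simp add: szego_def power_mult_distrib)
qed

lemma szego_deriv_taylor: "taylor_coeff (szego_deriv w) n = of_nat n * cnj w ^ (n - 1)"
proof (rule taylor_coeff_eqI)
  fix z assume z: "z \<in> \<bbbD>"
  have "(\<lambda>n. z * (of_nat (Suc n) * (cnj w * z) ^ n)) sums (z * (1 / (1 - cnj w * z)\<^sup>2))"
    by (rule sums_mult[OF geometric_deriv_sums[OF disk_product(2)[OF z]]])
  then have "(\<lambda>n. (of_nat (Suc n) * cnj w ^ (Suc n - 1)) * z ^ Suc n) sums szego_deriv w z"
    using z by (simp add: szego_deriv_def power_mult_distrib mult_ac)
  then show "(\<lambda>n. (of_nat n * cnj w ^ (n - 1)) * z ^ n) sums szego_deriv w z"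
    by (subst (asm) sums_Suc_iff) simp
qed

lemma szego_has_derivative:
  assumes z: "z \<in> \<bbbD>"
  shows "(szego w has_field_derivative cnj w / (1 - cnj w * z)\<^sup>2) (at z)"
    and "(szego_deriv w has_field_derivative (1 / (1 - cnj w * z)\<^sup>2 + 2 * cnj w * z / (1 - cnj w * z) ^ 3)) (at z)"
proof -
  have nz: "1 - cnj w * z \<noteq> 0" by (rule disk_product(3)[OF z])
  have "((\<lambda>z. 1 / (1 - cnj w * z)) has_field_derivative cnj w / (1 - cnj w * z)\<^sup>2) (at z)"
    using nz by (auto intro!: derivative_eq_intros simp: power2_eq_square)
  then show "(szego w has_field_derivative cnj w / (1 - cnj w * z)\<^sup>2) (at z)"
    by (rule has_field_derivative_transform_within_open[of _ _ _ \<bbbD>]) (use z in \<open>auto simp: szego_def\<close>)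
  have "((\<lambda>z. z / (1 - cnj w * z)\<^sup>2) has_field_derivative
     (1 / (1 - cnj w * z)\<^sup>2 + 2 * cnj w * z / (1 - cnj w * z) ^ 3)) (at z)"
  proof -
    \<comment> \<open>Abbreviating the denominator keeps the algebra linear in the numerators.\<close>
    define q where "q = 1 - cnj w * z"
    have "((\<lambda>z. z / (1 - cnj w * z)\<^sup>2) has_field_derivative
      ((1 * (1 - cnj w * z)\<^sup>2 - z * (2 * (1 - cnj w * z) * (- cnj w))) / ((1 - cnj w * z)\<^sup>2 * (1 - cnj w * z)\<^sup>2))) (at z)"
      using nz by (auto intro!: derivative_eq_intros)
    moreover have "(1 * q\<^sup>2 - z * (2 * q * (- cnj w))) / (q\<^sup>2 * q\<^sup>2) = 1 / q\<^sup>2 + 2 * cnj w * z / q ^ 3"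
      using nz unfolding q_def[symmetric] by (simp add: field_simps power2_eq_square power3_eq_cube)
    ultimately show ?thesis unfolding q_def by simp
  qed
  then show "(szego_deriv w has_field_derivative (1 / (1 - cnj w * z)\<^sup>2 + 2 * cnj w * z / (1 - cnj w * z) ^ 3)) (at z)"
    by (rule has_field_derivative_transform_within_open[of _ _ _ \<bbbD>]) (use z in \<open>auto simp: szego_deriv_def\<close>)
qed

lemma szego_lower: "z \<in> \<bbbD> \<Longrightarrow> 1 - cmod w \<le> cmod (1 - cnj w * z)"
  using norm_triangle_ineq2[of 1 "cnj w * z"] disk_product(1)[of z] by simp

lemma szego_mem: "szego w \<in> hcarrier hardy_space"
proof (rule bounded_holomorphic_hardy)
  show "szego w holomorphic_on \<bbbD>"
    unfolding holomorphic_on_open[OF open_ball] using szego_has_derivative(1) by blast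
  show "cmod (szego w z) \<le> 1 / (1 - cmod w)" if "z \<in> \<bbbD>" for z
    using szego_lower[OF that] that w by (auto simp: szego_def norm_divide intro!: divide_left_mono mult_pos_pos)
qed (simp add: szego_def)

lemma szego_deriv_mem: "szego_deriv w \<in> hcarrier hardy_space"
proof (rule bounded_holomorphic_hardy)
  show "szego_deriv w holomorphic_on \<bbbD>"
    unfolding holomorphic_on_open[OF open_ball] using szego_has_derivative(2) by blast
  show "cmod (szego_deriv w z) \<le> 1 / (1 - cmod w)\<^sup>2" if "z \<in> \<bbbD>" for z
    using szego_lower[OF that] that w
    by (auto simp: szego_deriv_def norm_divide norm_power intro!: frac_le power_mono)
qed (simp add: szego_deriv_def)

lemma szego_reproducing:
  assumes f: "f \<in> hcarrier hardy_space"
  shows "hinner hardy_space f (szego w) = f w"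
  using taylor_coeff_sums[of f w] f w
  by (simp add: hinner_hardy szego_taylor hardy_iff sums_iff)

lemma szego_deriv_reproducing:
  assumes f: "f \<in> hcarrier hardy_space"
  shows "hinner hardy_space f (szego_deriv w) = deriv f w"
proof -
  have "(\<lambda>n. taylor_coeff f (Suc n) * (of_nat (Suc n) * w ^ (Suc n - 1))) sums deriv f w"
    using deriv_sums[of f w] f w by (simp add: hardy_iff mult_ac)
  then have "(\<lambda>n. taylor_coeff f n * (of_nat n * w ^ (n - 1))) sums deriv f w"
    by (subst (asm) sums_Suc_iff) simp
  then show ?thesis by (simp add: hinner_hardy szego_deriv_taylor sums_iff)
qed

end

text \<open>
  Taylor polynomials, cut off to the disk, are dense.
\<close>

lemma hardy_truncation:
  assumes h: "h \<in> hcarrier hardy_space" and e: "0 < e"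
  obtains p K where "p \<in> hcarrier hardy_space" "\<And>k. k \<ge> K \<Longrightarrow> taylor_coeff p k = 0"
    "hnorm hardy_space (h - p) < e"
proof -
  have hs: "summable (\<lambda>n. (cmod (taylor_coeff h n))\<^sup>2)" and hh: "h holomorphic_on \<bbbD>" using h by (auto simp: hardy_iff)
  have "(\<lambda>K. \<Sum>n. (cmod (taylor_coeff h (n + K)))\<^sup>2) \<longlonglongrightarrow> 0" by (rule suminf_exist_split2[OF hs])
  then have "\<forall>\<^sub>F K in sequentially. (\<Sum>n. (cmod (taylor_coeff h (n + K)))\<^sup>2) < e\<^sup>2"
    by (rule order_tendstoD) (use e in simp)
  then obtain K where K: "(\<Sum>n. (cmod (taylor_coeff h (n + K)))\<^sup>2) < e\<^sup>2"
    by (auto simp: eventually_sequentially)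
  define p where "p z = (if z \<in> \<bbbD> then \<Sum>k<K. taylor_coeff h k * z ^ k else 0)" for z
  have ph: "p holomorphic_on \<bbbD>"
  proof (rule holomorphic_transform)
    show "(\<lambda>z. \<Sum>k<K. taylor_coeff h k * z ^ k) holomorphic_on \<bbbD>" by (intro holomorphic_intros)
  qed (simp add: p_def)
  have pc: "taylor_coeff p n = (if n < K then taylor_coeff h n else 0)" for n
  proof (rule taylor_coeff_eqI)
    fix z assume z: "z \<in> \<bbbD>"
    have "(\<lambda>n. (if n < K then taylor_coeff h n else 0) * z ^ n) sums (\<Sum>n<K. (if n < K then taylor_coeff h n else 0) * z ^ n)"
      by (rule sums_finite) auto
    then show "(\<lambda>n. (if n < K then taylor_coeff h n else 0) * z ^ n) sums p z"
      using z by (simp add: p_def)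
  qed
  have "summable (\<lambda>n. (cmod (taylor_coeff p n))\<^sup>2)"
    by (rule summable_finite[of "{..<K}"]) (auto simp: pc)
  then have p: "p \<in> hcarrier hardy_space" using ph by (simp add: hardy_iff p_def)
  have d: "taylor_coeff (h - p) n = (if n < K then 0 else taylor_coeff h n)" for n
  proof -
    have "taylor_coeff (h - p) n = taylor_coeff h n + (-1) * taylor_coeff p n"
      unfolding hardy.diff_conv
      using taylor_coeff_add[OF hh, of "cfun_scale (-1) p" n] taylor_coeff_scale[OF ph, of "-1" n]
        hardy.scale_mem[OF p, of "-1"]
      by (simp add: hardy_iff del: cfun.scale_minus_left)
    then show ?thesis by (simp add: pc)
  qed
  have "(hnorm hardy_space (h - p))\<^sup>2 = (\<Sum>n. (cmod (taylor_coeff (h - p) n))\<^sup>2)"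
    by (rule hnorm_hardy_square[OF hardy.diff_mem[OF h p]])
  also have "\<dots> = (\<Sum>n. (cmod (taylor_coeff (h - p) (n + K)))\<^sup>2) + (\<Sum>n<K. (cmod (taylor_coeff (h - p) n))\<^sup>2)"
    using hardy.diff_mem[OF h p] by (intro suminf_split_initial_segment) (simp add: hardy_iff)
  also have "\<dots> = (\<Sum>n. (cmod (taylor_coeff h (n + K)))\<^sup>2)" by (simp add: d)
  also have "\<dots> < e\<^sup>2" by (rule K)
  finally have "hnorm hardy_space (h - p) < e" using e by (simp add: power_less_imp_less_base)
  with p pc show ?thesis by (intro that[of p K]) auto
qed

text \<open>
  Against a polynomial the inner product is a finite sum of coefficients; the error of approximating
  \<open>h\<close> by a polynomial is controlled uniformly in \<open>n\<close> by the bound on the norms.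
\<close>

lemma hardy_weak_convergence:
  assumes d: "\<And>n. d n \<in> hcarrier hardy_space" "\<And>n. hnorm hardy_space (d n) \<le> B"
    and coeff: "\<And>k. (\<lambda>n. taylor_coeff (d n) k) \<longlonglongrightarrow> 0" and h: "h \<in> hcarrier hardy_space"
  shows "(\<lambda>n. hinner hardy_space (d n) h) \<longlonglongrightarrow> 0"
proof (rule tendstoI)
  fix e :: real assume e: "0 < e"
  have B: "0 \<le> B" using d(2)[of 0] hardy.hnorm_nonneg[OF d(1)[of 0]] by simp
  obtain p K where p: "p \<in> hcarrier hardy_space" "\<And>k. k \<ge> K \<Longrightarrow> taylor_coeff p k = 0"
    and close: "hnorm hardy_space (h - p) < e / (2 * (B + 1))"
    using hardy_truncation[OF h, of "e / (2 * (B + 1))"] e B by auto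
  have "(\<lambda>n. \<Sum>k<K. taylor_coeff (d n) k * cnj (taylor_coeff p k)) \<longlonglongrightarrow> (\<Sum>k<K. 0 * cnj (taylor_coeff p k))"
    by (intro tendsto_intros coeff)
  moreover have "hinner hardy_space (d n) p = (\<Sum>k<K. taylor_coeff (d n) k * cnj (taylor_coeff p k))" for n
    unfolding hinner_hardy by (rule suminf_finite) (auto simp: p)
  ultimately have "(\<lambda>n. hinner hardy_space (d n) p) \<longlonglongrightarrow> 0" by simp
  from tendstoD[OF this, of "e / 2"] e have "\<forall>\<^sub>F n in sequentially. cmod (hinner hardy_space (d n) p) < e / 2" by simp
  then show "\<forall>\<^sub>F n in sequentially. dist (hinner hardy_space (d n) h) 0 < e"
  proof eventually_elim
    case (elim n)
    have hp: "h - p \<in> hcarrier hardy_space" by (rule hardy.diff_mem[OF h p(1)])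
    have "cmod (hinner hardy_space (d n) (h - p)) \<le> hnorm hardy_space (d n) * hnorm hardy_space (h - p)"
      by (rule hardy.cauchy_schwarz[OF d(1) hp])
    also have "\<dots> \<le> B * (e / (2 * (B + 1)))"
      using d(2) close B hardy.hnorm_nonneg[OF hp] by (intro mult_mono) auto
    also have "\<dots> \<le> e / 2" using B e by (simp add: field_simps)
    finally have "cmod (hinner hardy_space (d n) (h - p)) \<le> e / 2" .
    moreover have "hinner hardy_space (d n) h = hinner hardy_space (d n) p + hinner hardy_space (d n) (h - p)"
      using hardy.inner_diff_right[OF h p(1) d(1)] by simp
    ultimately have "cmod (hinner hardy_space (d n) h) < e"
      using norm_triangle_ineq[of "hinner hardy_space (d n) p" "hinner hardy_space (d n) (h - p)"] elim by simp
    then show ?case by simp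
  qed
qed

lemma hardy_pointwise_bound:
  assumes f: "f \<in> hcarrier hardy_space" and z: "z \<in> \<bbbD>"
  shows "(cmod (f z))\<^sup>2 \<le> (hnorm hardy_space f)\<^sup>2 / (1 - (cmod z)\<^sup>2)"
proof -
  have "complex_of_real ((hnorm hardy_space (szego z))\<^sup>2) = szego z z"
    using hardy.inner_self[OF szego_mem[OF z]] szego_reproducing[OF z szego_mem[OF z]] by simp
  also have "\<dots> = of_real (1 / (1 - (cmod z)\<^sup>2))"
  proof -
    have "cnj z * z = of_real ((cmod z)\<^sup>2)" by (simp only: complex_norm_square mult.commute)
    then show ?thesis using z by (simp add: szego_def)
  qed
  finally have s: "(hnorm hardy_space (szego z))\<^sup>2 = 1 / (1 - (cmod z)\<^sup>2)" by (simp only: of_real_eq_iff)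
  have "cmod (f z) \<le> hnorm hardy_space f * hnorm hardy_space (szego z)"
    using hardy.cauchy_schwarz[OF f szego_mem[OF z]] szego_reproducing[OF z f] by simp
  then have "(cmod (f z))\<^sup>2 \<le> (hnorm hardy_space f * hnorm hardy_space (szego z))\<^sup>2" by (rule power_mono) simp
  then show ?thesis by (simp add: power_mult_distrib s)
qed

text \<open>
  Point evaluations are bounded locally uniformly on the unit ball, so Montel's theorem gives a locally
  uniform limit along a subsequence. Its Taylor coefficients are the limits of the coefficients, so
  it lies in the unit ball and is the weak limit.
\<close>

lemma hardy_ball_weakly_compact:
  assumes f: "\<And>n. f n \<in> hcarrier hardy_space" "\<And>n. hnorm hardy_space (f n) \<le> 1"
  obtains r g where "strict_mono (r :: nat \<Rightarrow> nat)" "g \<in> hcarrier hardy_space" "hnorm hardy_space g \<le> 1"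
    "\<And>h. h \<in> hcarrier hardy_space \<Longrightarrow> (\<lambda>n. hinner hardy_space (f (r n) - g) h) \<longlonglongrightarrow> 0"
proof -
  \<comment> \<open>A normal family that contains the unit ball.\<close>
  define H where "H = {h. h holomorphic_on \<bbbD> \<and> (\<forall>z\<in>\<bbbD>. (cmod (h z))\<^sup>2 \<le> 1 / (1 - (cmod z)\<^sup>2))}"
  have rangeH: "range f \<subseteq> H"
  proof -
    have "(cmod (f n z))\<^sup>2 \<le> 1 / (1 - (cmod z)\<^sup>2)" if z: "z \<in> \<bbbD>" for n z
    proof -
      have "(hnorm hardy_space (f n))\<^sup>2 \<le> 1" using f(2)[of n] hardy.hnorm_nonneg[OF f(1)] by (simp add: power_le_one)
      moreover have "0 < 1 - (cmod z)\<^sup>2" using z by (simp add: abs_square_less_1)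
      ultimately have "(hnorm hardy_space (f n))\<^sup>2 / (1 - (cmod z)\<^sup>2) \<le> 1 / (1 - (cmod z)\<^sup>2)"
        by (intro divide_right_mono) auto
      then show ?thesis using hardy_pointwise_bound[OF f(1) z] by (rule order_trans[rotated])
    qed
    then show ?thesis using f(1) by (auto simp: H_def hardy_iff)
  qed
  have bounded: "\<exists>B. \<forall>h\<in>H. \<forall>z\<in>K. cmod (h z) \<le> B" if K: "compact K" "K \<subseteq> \<bbbD>" for K
  proof -
    have nz: "1 - (cmod z)\<^sup>2 \<noteq> 0" if "z \<in> K" for z
      using that K(2) by (auto simp: abs_square_eq_1)
    have "compact ((\<lambda>z. sqrt (1 / (1 - (cmod z)\<^sup>2))) ` K)"
      using nz by (intro compact_continuous_image[OF _ K(1)] continuous_intros) auto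
    from bounded_imp_bdd_above[OF compact_imp_bounded[OF this]]
    obtain B where B: "\<And>z. z \<in> K \<Longrightarrow> sqrt (1 / (1 - (cmod z)\<^sup>2)) \<le> B"
      unfolding bdd_above_def by blast
    have "cmod (h z) \<le> B" if "h \<in> H" "z \<in> K" for h z
    proof -
      have "(cmod (h z))\<^sup>2 \<le> 1 / (1 - (cmod z)\<^sup>2)" using that K(2) by (auto simp: H_def)
      then have "cmod (h z) \<le> sqrt (1 / (1 - (cmod z)\<^sup>2))" by (rule real_le_rsqrt)
      then show ?thesis using B[OF that(2)] by simp
    qed
    then show ?thesis by blast
  qed
  have holH: "\<And>h. h \<in> H \<Longrightarrow> h holomorphic_on \<bbbD>" by (simp add: H_def)
  obtain g0 r where g0: "g0 holomorphic_on \<bbbD>" and r: "strict_mono (r :: nat \<Rightarrow> nat)"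
    and unif: "\<And>K. compact K \<Longrightarrow> K \<subseteq> \<bbbD> \<Longrightarrow> uniform_limit K (f \<circ> r) g0 sequentially"
    using Montel[OF open_ball holH bounded rangeH] by metis
  define g where "g z = (if z \<in> \<bbbD> then g0 z else 0)" for z
  have gh: "g holomorphic_on \<bbbD>" by (rule holomorphic_transform[OF g0]) (simp add: g_def)
  have gc: "taylor_coeff g k = taylor_coeff g0 k" for k by (rule taylor_coeff_cong[OF g0]) (simp add: g_def)
  have coeff: "(\<lambda>n. taylor_coeff (f (r n)) k) \<longlonglongrightarrow> taylor_coeff g k" for k
  proof -
    have "cball 0 (1 / 2) \<subseteq> \<bbbD>" by (auto simp: subset_iff)
    from unif[OF compact_cball this] have u: "uniform_limit (ball 0 (1 / 2)) (f \<circ> r) g0 sequentially"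
      by (rule uniform_limit_on_subset) auto
    have "(\<lambda>n. (deriv ^^ k) ((f \<circ> r) n) 0) \<longlonglongrightarrow> (deriv ^^ k) g0 0"
    proof (rule higher_deriv_complex_uniform_limit[OF u])
      have "f (r n) holomorphic_on ball 0 (1 / 2)" for n
        by (rule holomorphic_on_subset[of _ \<bbbD>]) (use f(1) in \<open>auto simp: hardy_iff\<close>)
      then show "\<forall>\<^sub>F n in sequentially. (f \<circ> r) n holomorphic_on ball 0 (1 / 2)" by simp
    qed auto
    then show ?thesis unfolding gc unfolding taylor_coeff_def by (intro tendsto_divide tendsto_const) (simp_all add: o_def)
  qed
  have part: "(\<Sum>k<N. (cmod (taylor_coeff g k))\<^sup>2) \<le> 1" for N
  proof (rule LIMSEQ_le_const2)
    show "(\<lambda>n. \<Sum>k<N. (cmod (taylor_coeff (f (r n)) k))\<^sup>2) \<longlonglongrightarrow> (\<Sum>k<N. (cmod (taylor_coeff g k))\<^sup>2)"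
      by (intro tendsto_intros coeff)
    have "(\<Sum>k<N. (cmod (taylor_coeff (f n) k))\<^sup>2) \<le> 1" for n
    proof -
      have "(\<Sum>k<N. (cmod (taylor_coeff (f n) k))\<^sup>2) \<le> (hnorm hardy_space (f n))\<^sup>2"
        unfolding hnorm_hardy_square[OF f(1)] using f(1)[of n] by (intro sum_le_suminf) (auto simp: hardy_iff)
      also have "\<dots> \<le> 1" using f(2)[of n] hardy.hnorm_nonneg[OF f(1)] by (simp add: power_le_one)
      finally show ?thesis .
    qed
    then show "\<exists>N'. \<forall>n\<ge>N'. (\<Sum>k<N. (cmod (taylor_coeff (f (r n)) k))\<^sup>2) \<le> 1" by blast
  qed
  have gs: "summable (\<lambda>k. (cmod (taylor_coeff g k))\<^sup>2)" by (rule summableI_nonneg_bounded[OF _ part]) simp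
  have gH: "g \<in> hcarrier hardy_space" using gh gs by (simp add: hardy_iff g_def)
  have "(hnorm hardy_space g)\<^sup>2 \<le> 1" unfolding hnorm_hardy_square[OF gH] by (rule suminf_le_const[OF gs part])
  then have g1: "hnorm hardy_space g \<le> 1" using hardy.hnorm_nonneg[OF gH] by (simp add: power_le_one_iff)
  show ?thesis
  proof (rule that[OF r gH g1])
    fix h assume h: "h \<in> hcarrier hardy_space"
    show "(\<lambda>n. hinner hardy_space (f (r n) - g) h) \<longlonglongrightarrow> 0"
    proof (rule hardy_weak_convergence[OF _ _ _ h])
      show "f (r n) - g \<in> hcarrier hardy_space" for n by (rule hardy.diff_mem[OF f(1) gH])
      show "hnorm hardy_space (f (r n) - g) \<le> 2" for n
      proof -
        have neg: "cfun_scale (-1) g \<in> hcarrier hardy_space" by (rule hardy.scale_mem[OF gH])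
        have "hnorm hardy_space (f (r n) - g) \<le> hnorm hardy_space (f (r n)) + hnorm hardy_space (cfun_scale (-1) g)"
          unfolding hardy.diff_conv by (rule hardy.hnorm_triangle[OF f(1) neg])
        also have "\<dots> \<le> 1 + 1"
          using f(2) g1 hardy.hnorm_scale[OF gH, of "-1"] by (intro add_mono) auto
        finally show ?thesis by simp
      qed
      fix k
      have "taylor_coeff (f (r n) - g) k = taylor_coeff (f (r n)) k - taylor_coeff g k" for n
      proof -
        have fn: "f (r n) holomorphic_on \<bbbD>" using f(1) by (simp add: hardy_iff)
        have "cfun_scale (-1) g holomorphic_on \<bbbD>" using hardy.scale_mem[OF gH, of "-1"] by (simp add: hardy_iff)
        from taylor_coeff_add[OF fn this, of k] taylor_coeff_scale[OF gh, of "-1" k]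
        show ?thesis unfolding hardy.diff_conv by (simp del: cfun.scale_minus_left)
      qed
      then show "(\<lambda>n. taylor_coeff (f (r n) - g) k) \<longlonglongrightarrow> 0"
        using tendsto_diff[OF coeff tendsto_const, of k "taylor_coeff g k"] by simp
    qed
  qed
qed


section \<open>The derivative kernel of a model space\<close>

text \<open>
  This is \<open>\<partial>\<^sub>z \<partial>\<^sub>w\<^sub>* k(w, z)\<close> on the diagonal, where \<open>w\<^sub>*\<close> stands for the conjugate of \<open>w\<close>: a
  quarter of the Laplacian of \<open>k(z, z)\<close>.
\<close>

definition derivative_kernel_bound :: "(complex \<Rightarrow> complex) \<Rightarrow> complex \<Rightarrow> real"
  where "derivative_kernel_bound \<theta> w =
    (1 - (cmod (\<theta> w))\<^sup>2) * (1 / (1 - (cmod w)\<^sup>2)\<^sup>2 + 2 * (cmod w)\<^sup>2 / (1 - (cmod w)\<^sup>2) ^ 3)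
    - (cmod (deriv \<theta> w))\<^sup>2 / (1 - (cmod w)\<^sup>2)
    - 2 * Re (cnj (\<theta> w) * deriv \<theta> w * w) / (1 - (cmod w)\<^sup>2)\<^sup>2"

text \<open>
  Inner functions enter the argument through this property.
\<close>

locale contractive_symbol =
  fixes \<theta> :: "complex \<Rightarrow> complex"
  assumes hol: "\<theta> holomorphic_on \<bbbD>" and le_1: "\<And>z. z \<in> \<bbbD> \<Longrightarrow> cmod (\<theta> z) \<le> 1"
begin

lemma model_iff: "f \<in> hcarrier (model_space \<theta>) \<longleftrightarrow> f \<in> hcarrier hardy_space \<and>
    (\<forall>g\<in>hcarrier hardy_space. hinner hardy_space f (\<lambda>z. \<theta> z * g z) = 0)"
  by (simp add: model_space_def)

lemma multiplier_mem: "g \<in> hcarrier hardy_space \<Longrightarrow> (\<lambda>z. \<theta> z * g z) \<in> hcarrier hardy_space"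
  by (rule hardy_multiplier(1)[OF hol le_1])

lemma hinner_model: "hinner (model_space \<theta>) = hinner hardy_space"
  by (simp add: model_space_def)

lemma hnorm_model: "hnorm (model_space \<theta>) = hnorm hardy_space"
  by (simp add: hnorm_def hinner_model fun_eq_iff)

sublocale model: inner_product_hspace "model_space \<theta>"
proof
  show "0 \<in> hcarrier (model_space \<theta>)"
    unfolding model_iff by (intro conjI ballI hardy.zero_mem hardy.inner_zero_left multiplier_mem)
  show "f + g \<in> hcarrier (model_space \<theta>)" if "f \<in> hcarrier (model_space \<theta>)" "g \<in> hcarrier (model_space \<theta>)" for f g
    unfolding model_iff
  proof (intro conjI ballI)
    have mem: "f \<in> hcarrier hardy_space" "g \<in> hcarrier hardy_space" using that unfolding model_iff by blast+
    then show "f + g \<in> hcarrier hardy_space" by (rule hardy.add_mem)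
    show "hinner hardy_space (f + g) (\<lambda>z. \<theta> z * h z) = 0" if h: "h \<in> hcarrier hardy_space" for h
      using hardy.inner_add_left[OF mem multiplier_mem[OF h]] h \<open>f \<in> hcarrier (model_space \<theta>)\<close> \<open>g \<in> hcarrier (model_space \<theta>)\<close>
      unfolding model_iff by simp
  qed
  show "cfun_scale c f \<in> hcarrier (model_space \<theta>)" if "f \<in> hcarrier (model_space \<theta>)" for c f
    unfolding model_iff
  proof (intro conjI ballI)
    have mem: "f \<in> hcarrier hardy_space" using that unfolding model_iff by blast
    then show "cfun_scale c f \<in> hcarrier hardy_space" by (rule hardy.scale_mem)
    show "hinner hardy_space (cfun_scale c f) (\<lambda>z. \<theta> z * h z) = 0" if h: "h \<in> hcarrier hardy_space" for h
      using hardy.inner_scale_left[OF mem multiplier_mem[OF h], of c] h \<open>f \<in> hcarrier (model_space \<theta>)\<close>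
      unfolding model_iff by simp
  qed
next
  fix f g h c assume "f \<in> hcarrier (model_space \<theta>)" "g \<in> hcarrier (model_space \<theta>)" "h \<in> hcarrier (model_space \<theta>)"
  then have mem: "f \<in> hcarrier hardy_space" "g \<in> hcarrier hardy_space" "h \<in> hcarrier hardy_space"
    by (simp_all add: model_iff)
  show "hinner (model_space \<theta>) (f + g) h = hinner (model_space \<theta>) f h + hinner (model_space \<theta>) g h"
    unfolding hinner_model by (rule hardy.inner_add_left[OF mem])
  show "hinner (model_space \<theta>) (cfun_scale c f) h = c * hinner (model_space \<theta>) f h"
    unfolding hinner_model by (rule hardy.inner_scale_left[OF mem(1,3)])
  show "hinner (model_space \<theta>) g f = cnj (hinner (model_space \<theta>) f g)"
    unfolding hinner_model by (rule hardy.inner_commute[OF mem(1,2)])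
  show "0 \<le> Re (hinner (model_space \<theta>) f f)"
    unfolding hinner_model by (rule hardy.inner_nonneg[OF mem(1)])
  show "f = 0" if "Re (hinner (model_space \<theta>) f f) = 0"
    using that unfolding hinner_model by (rule hardy.inner_definite[OF mem(1)])
qed

definition derivative_kernel :: "complex \<Rightarrow> complex \<Rightarrow> complex"
  where "derivative_kernel w = szego_deriv w - (\<lambda>z. \<theta> z *
    (cfun_scale (cnj (deriv \<theta> w)) (szego w) + cfun_scale (cnj (\<theta> w)) (szego_deriv w)) z)"

text \<open>
  The kernel is \<open>u - \<theta> g\<close>, where \<open>u\<close> reproduces the derivative at \<open>w\<close> in the whole Hardy
  space and \<open>g\<close> is chosen with \<open>\<langle>h, g\<rangle> = (\<theta> h)'(w)\<close>. Elements of the model space are orthogonal to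
  \<open>\<theta> g\<close>, so they do not feel the correction. Moreover \<open>\<langle>\<theta> g, u\<rangle> = (\<theta> g)'(w) = \<parallel>g\<parallel>\<^sup>2\<close>,
  and \<open>\<parallel>\<theta> g\<parallel> \<le> \<parallel>g\<parallel>\<close> gives \<open>\<parallel>u - \<theta> g\<parallel>\<^sup>2 \<le> \<parallel>u\<parallel>\<^sup>2 - \<parallel>g\<parallel>\<^sup>2 = u'(w) - (\<theta> g)'(w)\<close>, which is computed
  explicitly.
\<close>

lemma derivative_kernel_properties:
  assumes w: "w \<in> \<bbbD>"
  shows "derivative_kernel w \<in> hcarrier hardy_space"
    and "f \<in> hcarrier (model_space \<theta>) \<Longrightarrow> hinner hardy_space f (derivative_kernel w) = deriv f w"
    and "(hnorm hardy_space (derivative_kernel w))\<^sup>2 \<le> derivative_kernel_bound \<theta> w"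
proof -
  define u where "u = szego_deriv w"
  define g where "g = cfun_scale (cnj (deriv \<theta> w)) (szego w) + cfun_scale (cnj (\<theta> w)) (szego_deriv w)"
  define tg where "tg = (\<lambda>z. \<theta> z * g z)"
  have k: "derivative_kernel w = u - tg" by (simp add: derivative_kernel_def u_def tg_def g_def)
  have u: "u \<in> hcarrier hardy_space" unfolding u_def by (rule szego_deriv_mem[OF w])
  have g: "g \<in> hcarrier hardy_space" unfolding g_def
    by (intro hardy.add_mem hardy.scale_mem szego_deriv_mem szego_mem w)
  have tg: "tg \<in> hcarrier hardy_space" unfolding tg_def by (rule hardy_multiplier(1)[OF hol le_1 g])
  show "derivative_kernel w \<in> hcarrier hardy_space" unfolding k by (rule hardy.diff_mem[OF u tg])
  show "hinner hardy_space f (derivative_kernel w) = deriv f w" if f: "f \<in> hcarrier (model_space \<theta>)"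
  proof -
    have "f \<in> hcarrier hardy_space" "hinner hardy_space f tg = 0"
      using f g by (auto simp: model_iff tg_def)
    then show ?thesis unfolding k
      using u tg szego_deriv_reproducing[OF w] by (simp add: hardy.inner_diff_right u_def)
  qed
  define M where "M = 1 - (cmod w)\<^sup>2"
  have "(cmod w)\<^sup>2 < 1" using w by (simp add: power_less_one_iff abs_square_less_1)
  then have M: "M > 0" by (simp add: M_def)
  have cM: "1 - cnj w * w = of_real M" by (simp add: M_def complex_norm_square mult.commute del: of_real_power)
  have w2: "cnj w * w = of_real ((cmod w)\<^sup>2)" by (simp only: complex_norm_square mult.commute)
  have sv: "szego w w = of_real (1 / M)" "szego_deriv w w = w / of_real (M\<^sup>2)"
    using w by (simp_all add: szego_def szego_deriv_def cM)
  note ds = szego_has_derivative[OF w w, unfolded cM]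
  define X where "X = 1 / M\<^sup>2 + 2 * (cmod w)\<^sup>2 / M ^ 3"
  have X: "1 / (complex_of_real M)\<^sup>2 + 2 * cnj w * w / of_real M ^ 3 = of_real X"
    by (simp add: X_def w2 mult.assoc)
  have du: "deriv u w = of_real X"
    unfolding u_def using DERIV_imp_deriv[OF ds(2)] X by simp
  have gw: "g w = cnj (deriv \<theta> w) * of_real (1 / M) + cnj (\<theta> w) * (w / of_real (M\<^sup>2))"
    by (simp add: g_def cfun_scale_def sv)
  have "(g has_field_derivative (cnj (deriv \<theta> w) * (cnj w / (of_real M)\<^sup>2) + cnj (\<theta> w) * of_real X)) (at w)"
    unfolding g_def cfun_scale_def plus_fun_def X[symmetric]
    by (intro DERIV_add DERIV_cmult ds)
  then have dg: "deriv g w = cnj (deriv \<theta> w) * (cnj w / (of_real M)\<^sup>2) + cnj (\<theta> w) * of_real X"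
    and gd: "(g has_field_derivative deriv g w) (at w)"
    by (auto dest: DERIV_imp_deriv simp: DERIV_imp_deriv)
  have td: "(\<theta> has_field_derivative deriv \<theta> w) (at w)"
    using hol w by (intro holomorphic_derivI[of _ \<bbbD>]) auto
  \<comment> \<open>By the choice of \<open>g\<close> this value of \<open>(\<theta> g)'(w)\<close> is also \<open>\<parallel>g\<parallel>\<^sup>2\<close>.\<close>
  define Y where "Y = deriv \<theta> w * g w + \<theta> w * deriv g w"
  have dtg: "deriv tg w = Y"
    unfolding tg_def Y_def using DERIV_mult[OF td gd] by (simp add: DERIV_imp_deriv mult.commute)
  have "hinner hardy_space g g = Y"
  proof -
    have "hinner hardy_space g g = deriv \<theta> w * hinner hardy_space g (szego w) + \<theta> w * hinner hardy_space g (szego_deriv w)"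
      by (subst (2) g_def) (use g w in \<open>simp add: hardy.inner_add_right hardy.inner_scale_right hardy.scale_mem szego_mem szego_deriv_mem\<close>)
    then show ?thesis using g w by (simp add: szego_reproducing szego_deriv_reproducing Y_def)
  qed
  then have Y: "Y = of_real ((hnorm hardy_space g)\<^sup>2)" using hardy.inner_self[OF g] by simp
  have "(hnorm hardy_space (u - tg))\<^sup>2 = (hnorm hardy_space u)\<^sup>2 - 2 * Re (hinner hardy_space u tg) + (hnorm hardy_space tg)\<^sup>2"
    by (rule hardy.hnorm_diff_square[OF u tg])
  also have "(hnorm hardy_space u)\<^sup>2 = X"
  proof -
    have "complex_of_real ((hnorm hardy_space u)\<^sup>2) = deriv u w"
      using hardy.inner_self[OF u] szego_deriv_reproducing[OF w u] by (simp add: u_def)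
    then show ?thesis unfolding du by (simp only: of_real_eq_iff)
  qed
  also have "Re (hinner hardy_space u tg) = Re Y"
  proof -
    have "hinner hardy_space tg u = Y"
      using szego_deriv_reproducing[OF w tg] dtg by (simp add: u_def)
    then show ?thesis using hardy.inner_commute[OF tg u] by simp
  qed
  also have "X - 2 * Re Y + (hnorm hardy_space tg)\<^sup>2 \<le> X - Re Y"
  proof -
    have "(hnorm hardy_space tg)\<^sup>2 \<le> (hnorm hardy_space g)\<^sup>2"
      unfolding tg_def using hardy_multiplier[OF hol le_1 g] by (intro power_mono hardy.hnorm_nonneg)
    then show ?thesis by (simp add: Y)
  qed
  also have "\<dots> = derivative_kernel_bound \<theta> w"
  proof -
    have "Y = of_real ((cmod (deriv \<theta> w))\<^sup>2 / M) + (cnj (\<theta> w) * deriv \<theta> w * w + cnj (cnj (\<theta> w) * deriv \<theta> w * w)) / of_real (M\<^sup>2)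
        + of_real ((cmod (\<theta> w))\<^sup>2 * X)"
      unfolding Y_def gw dg of_real_divide of_real_mult complex_norm_square
      by (simp add: algebra_simps add_divide_distrib)
    then have ReY: "Re Y = (cmod (deriv \<theta> w))\<^sup>2 / M + 2 * Re (cnj (\<theta> w) * deriv \<theta> w * w) / M\<^sup>2 + (cmod (\<theta> w))\<^sup>2 * X"
      unfolding complex_add_cnj of_real_divide[symmetric] of_real_mult[symmetric] of_real_add[symmetric]
      by (simp only: Re_complex_of_real)
    have "derivative_kernel_bound \<theta> w = (1 - (cmod (\<theta> w))\<^sup>2) * X - (cmod (deriv \<theta> w))\<^sup>2 / M
        - 2 * Re (cnj (\<theta> w) * deriv \<theta> w * w) / M\<^sup>2"
      by (simp only: derivative_kernel_bound_def X_def M_def)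
    then show ?thesis unfolding ReY by (simp only: left_diff_distrib)
  qed
  finally show "(hnorm hardy_space (derivative_kernel w))\<^sup>2 \<le> derivative_kernel_bound \<theta> w" unfolding k .
qed

end


section \<open>Inner functions are contractive\<close>

text \<open>
  The radius ending at a boundary point lies in every Stolz region of aperture greater than one at
  this point.
\<close>

lemma tendsto_radial_limit:
  assumes lim: "nontangential_limit f (cis t) l"
  shows "(\<lambda>m. f (exp (Complex (- 1 / real (Suc m)) t))) \<longlonglongrightarrow> l"
proof -
  define x where "x m = - 1 / real (Suc m)" for m
  define p where "p m = exp (Complex (x m) t)" for m
  have x: "x m < 0" for m by (simp add: x_def)
  have p: "p m = of_real (exp (x m)) * cis t" for m by (simp add: p_def exp_eq_polar)
  have pt: "p m - cis t = of_real (exp (x m) - 1) * cis t" for m by (simp add: p algebra_simps)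
  have "p m \<in> stolz_region 2 (cis t)" for m
  proof -
    have "cmod (p m - cis t) = 1 - exp (x m)" unfolding pt norm_mult norm_of_real using x[of m] by simp
    moreover have "cmod (p m) = exp (x m)" by (simp add: p norm_mult)
    ultimately show ?thesis using x[of m] by (simp add: stolz_region_def)
  qed
  moreover have "p m \<noteq> cis t" for m
    using pt[of m] x[of m] by (metis exp_eq_one_iff less_irrefl mult_eq_0_iff of_real_eq_0_iff cis_neq_zero eq_iff_diff_eq_0)
  moreover have "p \<longlonglongrightarrow> cis t"
  proof -
    have "x \<longlonglongrightarrow> - 0" unfolding x_def
      using tendsto_minus[OF LIMSEQ_inverse_real_of_nat] by (simp add: inverse_eq_divide)
    then have "(\<lambda>m. of_real (exp (x m)) * cis t) \<longlonglongrightarrow> of_real (exp (- 0)) * cis t"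
      by (intro tendsto_intros)
    then show ?thesis unfolding p[symmetric] by simp
  qed
  ultimately have "filterlim p (at (cis t) within stolz_region 2 (cis t)) sequentially"
    by (auto simp: filterlim_at)
  moreover have "(f \<longlongrightarrow> l) (at (cis t) within stolz_region 2 (cis t))"
    using lim by (simp add: nontangential_limit_def)
  ultimately show ?thesis unfolding p_def x_def by (rule filterlim_compose[rotated])
qed

text \<open>
  By Parseval's identity the coefficient sum is a limit of means of \<open>\<bar>\<theta>\<bar>\<^sup>2\<^sup>n\<close> over circles whose radii
  tend to one. Since \<open>\<theta>\<close> is bounded and has radial limits of modulus one almost everywhere, these means tend
  to one.
\<close>

lemma inner_function_power_taylor:
  assumes inner: "inner_function \<theta>"
  shows "(\<Sum>k<N. (cmod (taylor_coeff (\<lambda>z. \<theta> z ^ n) k))\<^sup>2) \<le> 1"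
proof -
  have hol: "\<theta> holomorphic_on \<bbbD>" using inner by (simp add: inner_function_def)
  define f where "f z = \<theta> z ^ n" for z
  have f: "f holomorphic_on \<bbbD>" unfolding f_def using hol by (rule holomorphic_on_power)
  obtain B where B: "\<And>z. z \<in> \<bbbD> \<Longrightarrow> cmod (\<theta> z) \<le> B"
    using inner unfolding inner_function_def bounded_iff by blast
  define x where "x m = - 1 / real (Suc m)" for m
  have x: "x m < 0" for m by (simp add: x_def)
  have z: "exp (Complex (x m) y) \<in> \<bbbD>" for m y using x[of m] by (simp add: norm_exp_eq_Re)
  define F where "F m y = ennreal ((cmod (f (exp (Complex (x m) y))))\<^sup>2) * indicator {0<..<2 * pi} y" for m y
  have Fm[measurable]: "F m \<in> borel_measurable lborel" for m
  proof -
    have "continuous_on UNIV (\<lambda>y. f (exp (Complex (x m) y)))"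
      using z by (intro continuous_on_compose2[OF holomorphic_on_imp_continuous_on[OF f]])
        (auto simp: Complex_eq intro!: continuous_intros)
    then have "(\<lambda>y. (cmod (f (exp (Complex (x m) y))))\<^sup>2) \<in> borel_measurable borel"
      by (intro borel_measurable_continuous_onI continuous_intros)
    then show ?thesis unfolding F_def by measurable
  qed
  have "AE t in lborel. t \<in> {0..2 * pi} \<longrightarrow> (\<exists>l. cmod l = 1 \<and> nontangential_limit \<theta> (cis t) l)"
    using inner unfolding inner_function_def
    by (simp add: AE_restrict_space_iff AE_completion_iff)
  then have ae: "AE t in lborel. (\<lambda>m. F m t) \<longlonglongrightarrow> indicator {0<..<2 * pi} t"
  proof eventually_elim
    case (elim t)
    show ?case
    proof (cases "t \<in> {0<..<2 * pi}")
      case True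
      then obtain l where l: "cmod l = 1" "nontangential_limit \<theta> (cis t) l" using elim by auto
      have "(\<lambda>m. (cmod (f (exp (Complex (x m) t))))\<^sup>2) \<longlonglongrightarrow> (cmod (l ^ n))\<^sup>2"
        unfolding f_def x_def by (intro tendsto_intros tendsto_radial_limit l)
      then have "(\<lambda>m. ennreal ((cmod (f (exp (Complex (x m) t))))\<^sup>2)) \<longlonglongrightarrow> ennreal ((cmod (l ^ n))\<^sup>2)"
        by (rule tendsto_ennrealI)
      then show ?thesis using True l by (simp add: F_def norm_power)
    next
      case False
      then show ?thesis by (simp add: F_def)
    qed
  qed
  have lim: "(\<lambda>m. \<integral>\<^sup>+y. F m y \<partial>lborel) \<longlonglongrightarrow> (\<integral>\<^sup>+y. indicator {0<..<2 * pi} y \<partial>lborel)"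
  proof (rule nn_integral_dominated_convergence[where w = "\<lambda>y. ennreal ((B ^ n)\<^sup>2) * indicator {0<..<2 * pi} y"])
    show "AE y in lborel. F m y \<le> ennreal ((B ^ n)\<^sup>2) * indicator {0<..<2 * pi} y" for m
      unfolding F_def f_def norm_power
      by (intro AE_I2 mult_right_mono ennreal_leI power_mono B z) auto
    show "(\<integral>\<^sup>+y. ennreal ((B ^ n)\<^sup>2) * indicator {0<..<2 * pi} y \<partial>lborel) < \<infinity>"
      by (simp add: nn_integral_cmult ennreal_mult_less_top)
  qed (use ae in auto)
  \<comment> \<open>Only finitely many coefficients are kept, so that the limit may be taken term by term.\<close>
  have low: "ennreal (2 * pi * (\<Sum>k<N. (cmod (taylor_coeff f k))\<^sup>2 * exp (x m) ^ (2 * k))) \<le> (\<integral>\<^sup>+y. F m y \<partial>lborel)" for m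
    unfolding F_def nn_integral_circle_square[OF f x]
    using summable_taylor_square_circle[OF f, of "exp (x m)"] x[of m]
    by (intro ennreal_leI mult_left_mono sum_le_suminf) auto
  have "x \<longlonglongrightarrow> - 0" unfolding x_def
    using tendsto_minus[OF LIMSEQ_inverse_real_of_nat] by (simp add: inverse_eq_divide)
  then have "(\<lambda>m. ennreal (2 * pi * (\<Sum>k<N. (cmod (taylor_coeff f k))\<^sup>2 * exp (x m) ^ (2 * k))))
      \<longlonglongrightarrow> ennreal (2 * pi * (\<Sum>k<N. (cmod (taylor_coeff f k))\<^sup>2 * exp (- 0) ^ (2 * k)))"
    by (intro tendsto_ennrealI tendsto_intros)
  from LIMSEQ_le[OF this lim] low
  have "ennreal (2 * pi * (\<Sum>k<N. (cmod (taylor_coeff f k))\<^sup>2)) \<le> ennreal (2 * pi)"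
    by (auto simp: mult.assoc)
  then have "2 * pi * (\<Sum>k<N. (cmod (taylor_coeff f k))\<^sup>2) \<le> 2 * pi" by (simp add: ennreal_le_iff)
  then show ?thesis by (simp add: f_def[abs_def])
qed

text \<open>
  All powers of \<open>\<theta>\<close> lie in the unit ball of the Hardy space. Hence \<open>\<bar>\<theta>(w)\<bar>\<^sup>n\<close> is bounded in \<open>n\<close> by the norm
  of the kernel at \<open>w\<close>, which is impossible if \<open>\<bar>\<theta>(w)\<bar> > 1\<close>.
\<close>

lemma inner_function_contractive:
  assumes inner: "inner_function \<theta>"
  shows "contractive_symbol \<theta>"
proof
  show hol: "\<theta> holomorphic_on \<bbbD>" using inner by (simp add: inner_function_def)
  fix w assume w: "w \<in> \<bbbD>"
  have bound: "cmod (\<theta> w) ^ n \<le> hnorm hardy_space (szego w)" for n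
  proof -
    define f where "f z = (if z \<in> \<bbbD> then \<theta> z ^ n else 0)" for z
    have pw: "(\<lambda>z. \<theta> z ^ n) holomorphic_on \<bbbD>" using hol by (rule holomorphic_on_power)
    have fh: "f holomorphic_on \<bbbD>" by (rule holomorphic_transform[OF pw]) (simp add: f_def)
    have tc: "taylor_coeff f k = taylor_coeff (\<lambda>z. \<theta> z ^ n) k" for k
      by (rule taylor_coeff_cong[OF pw]) (simp add: f_def)
    have le: "(\<Sum>k<N. (cmod (taylor_coeff f k))\<^sup>2) \<le> 1" for N
      unfolding tc by (rule inner_function_power_taylor[OF inner])
    have sf: "summable (\<lambda>k. (cmod (taylor_coeff f k))\<^sup>2)"
      by (rule summableI_nonneg_bounded[OF _ le]) simp
    have fH: "f \<in> hcarrier hardy_space" using fh sf by (simp add: hardy_iff f_def)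
    have "(hnorm hardy_space f)\<^sup>2 \<le> 1"
      unfolding hnorm_hardy_square[OF fH] by (rule suminf_le_const[OF sf le])
    then have f1: "hnorm hardy_space f \<le> 1"
      using hardy.hnorm_nonneg[OF fH] by (simp add: power_le_one_iff)
    have "cmod (\<theta> w) ^ n = cmod (hinner hardy_space f (szego w))"
      using szego_reproducing[OF w fH] w by (simp add: f_def norm_power)
    also have "\<dots> \<le> hnorm hardy_space f * hnorm hardy_space (szego w)"
      by (rule hardy.cauchy_schwarz[OF fH szego_mem[OF w]])
    also have "\<dots> \<le> hnorm hardy_space (szego w)"
      using f1 hardy.hnorm_nonneg[OF szego_mem[OF w]] hardy.hnorm_nonneg[OF fH] by (intro mult_left_le_one_le)
    finally show ?thesis .
  qed
  show "cmod (\<theta> w) \<le> 1"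
  proof (rule ccontr)
    assume "\<not> ?thesis"
    then obtain n where "hnorm hardy_space (szego w) < cmod (\<theta> w) ^ n"
      using real_arch_pow[of "cmod (\<theta> w)"] by auto
    with bound[of n] show False by simp
  qed
qed


section \<open>The Laplacian of the model kernel\<close>

lemma second_deriv_quotient:
  fixes N N1 M M1 :: "real \<Rightarrow> real"
  assumes S: "open S" "t \<in> S"
    and N: "\<And>s. s \<in> S \<Longrightarrow> (N has_real_derivative N1 s) (at s)" "(N1 has_real_derivative N2) (at t)"
    and M: "\<And>s. s \<in> S \<Longrightarrow> (M has_real_derivative M1 s) (at s)" "(M1 has_real_derivative M2) (at t)"
    and nz: "\<And>s. s \<in> S \<Longrightarrow> M s \<noteq> 0"
  shows "(deriv ^^ 2) (\<lambda>s. N s / M s) t =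
    N2 / M t - 2 * N1 t * M1 t / (M t)\<^sup>2 - N t * M2 / (M t)\<^sup>2 + 2 * N t * (M1 t)\<^sup>2 / (M t) ^ 3"
proof -
  define D where "D s = (N1 s * M s - N s * M1 s) / (M s * M s)" for s
  have 1: "deriv (\<lambda>s. N s / M s) s = D s" if "s \<in> S" for s
    unfolding D_def by (rule DERIV_imp_deriv[OF DERIV_divide[OF N(1)[OF that] M(1)[OF that] nz[OF that]]])
  have ev: "eventually (\<lambda>s. deriv (\<lambda>s. N s / M s) s = D s) (nhds t)"
    using eventually_nhds_in_open[OF S] by eventually_elim (rule 1)
  have nzt: "M t \<noteq> 0" "M t * M t \<noteq> 0" using nz S by auto
  note dN = N(1)[OF S(2)] and dM = M(1)[OF S(2)]
  have "(D has_real_derivative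
     ((N2 * M t + M1 t * N1 t - (N1 t * M1 t + M2 * N t)) * (M t * M t)
       - (N1 t * M t - N t * M1 t) * (M1 t * M t + M1 t * M t)) / ((M t * M t) * (M t * M t))) (at t)"
    unfolding D_def[abs_def]
    by (intro DERIV_divide DERIV_diff DERIV_mult N(2) M(2) dN dM nzt)
  then have "deriv D t = ((N2 * M t + M1 t * N1 t - (N1 t * M1 t + M2 * N t)) * (M t * M t)
       - (N1 t * M t - N t * M1 t) * (M1 t * M t + M1 t * M t)) / ((M t * M t) * (M t * M t))"
    by (rule DERIV_imp_deriv)
  also have "\<dots> = N2 / M t - 2 * N1 t * M1 t / (M t)\<^sup>2 - N t * M2 / (M t)\<^sup>2 + 2 * N t * (M1 t)\<^sup>2 / (M t) ^ 3"
    using nzt(1) by (simp add: field_simps power2_eq_square power3_eq_cube)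
  finally show ?thesis using deriv_cong_ev[OF ev refl] by (simp add: numeral_2_eq_2)
qed

lemma has_derivative_cmod_square:
  assumes "(F has_vector_derivative F1) (at t)"
  shows "((\<lambda>s. (cmod (F s))\<^sup>2) has_real_derivative 2 * Re (cnj (F t) * F1)) (at t)"
proof -
  note d = has_field_derivative_Re[OF assms] has_field_derivative_Im[OF assms]
  have "((\<lambda>s. Re (F s) * Re (F s) + Im (F s) * Im (F s)) has_real_derivative
      (Re F1 * Re (F t) + Re F1 * Re (F t)) + (Im F1 * Im (F t) + Im F1 * Im (F t))) (at t)"
    by (intro DERIV_add DERIV_mult d)
  then show ?thesis unfolding cmod_power2 by (simp add: power2_eq_square algebra_simps)
qed

lemma has_derivative_Re_cnj_mult:
  assumes "(F has_vector_derivative F1) (at t)" "(G has_vector_derivative G1) (at t)"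
  shows "((\<lambda>s. Re (cnj (F s) * G s)) has_real_derivative Re (cnj F1 * G t + cnj (F t) * G1)) (at t)"
proof -
  note d = has_field_derivative_Re[OF assms(1)] has_field_derivative_Im[OF assms(1)]
    has_field_derivative_Re[OF assms(2)] has_field_derivative_Im[OF assms(2)]
  have "((\<lambda>s. Re (F s) * Re (G s) + Im (F s) * Im (G s)) has_real_derivative
      (Re F1 * Re (G t) + Re G1 * Re (F t)) + (Im F1 * Im (G t) + Im G1 * Im (F t))) (at t)"
    by (intro DERIV_add DERIV_mult d)
  then show ?thesis by (simp add: algebra_simps)
qed

text \<open>
  Adding these formulas for the directions \<open>d = 1\<close> and \<open>d = \<i>\<close> gives the Laplacian; the terms with
  the second derivative of \<open>\<theta>\<close> cancel because of the factor \<open>d\<^sup>2\<close>.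
\<close>

lemma second_deriv_kernel_line:
  fixes \<gamma> :: "real \<Rightarrow> complex"
  assumes hol: "\<theta> holomorphic_on \<bbbD>" and \<gamma>: "\<And>s. (\<gamma> has_vector_derivative d) (at s)" and t: "\<gamma> t \<in> \<bbbD>"
    and d: "cmod d = 1"
  defines "a \<equiv> cnj (\<theta> (\<gamma> t)) * deriv \<theta> (\<gamma> t)"
    and "n \<equiv> 1 - (cmod (\<theta> (\<gamma> t)))\<^sup>2" and "m \<equiv> 1 - (cmod (\<gamma> t))\<^sup>2"
  shows "(deriv ^^ 2) (\<lambda>s. (1 - (cmod (\<theta> (\<gamma> s)))\<^sup>2) / (1 - (cmod (\<gamma> s))\<^sup>2)) t =
    - 2 * ((cmod (deriv \<theta> (\<gamma> t)))\<^sup>2 + Re (cnj (\<theta> (\<gamma> t)) * deriv (deriv \<theta>) (\<gamma> t) * d\<^sup>2)) / m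
    - 8 * Re (a * d) * Re (cnj (\<gamma> t) * d) / m\<^sup>2 + 2 * n / m\<^sup>2 + 8 * n * (Re (cnj (\<gamma> t) * d))\<^sup>2 / m ^ 3"
proof -
  define S where "S = \<gamma> -` \<bbbD>"
  have "continuous_on UNIV \<gamma>"
    using \<gamma> by (meson continuous_at_imp_continuous_on has_vector_derivative_continuous)
  then have S: "open S" "t \<in> S" unfolding S_def using t by (auto intro: open_vimage)
  have hol': "deriv \<theta> holomorphic_on \<bbbD>" using hol by (intro holomorphic_deriv) auto
  have chain: "((\<lambda>s. f (\<gamma> s)) has_vector_derivative (d * deriv f (\<gamma> s))) (at s)"
    if "f holomorphic_on \<bbbD>" "s \<in> S" for f s
    using field_vector_diff_chain_at[OF \<gamma> holomorphic_derivI[OF that(1) open_ball], of s] that(2)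
    by (simp add: S_def o_def)
  define F1 where "F1 s = d * deriv \<theta> (\<gamma> s)" for s
  have F: "((\<lambda>s. \<theta> (\<gamma> s)) has_vector_derivative F1 s) (at s)" if "s \<in> S" for s
    unfolding F1_def by (rule chain[OF hol that])
  have F1: "(F1 has_vector_derivative (d * (d * deriv (deriv \<theta>) (\<gamma> t)))) (at t)"
    unfolding F1_def[abs_def] by (intro has_vector_derivative_mult_right chain[OF hol' S(2)])
  have N: "((\<lambda>s. 1 - (cmod (\<theta> (\<gamma> s)))\<^sup>2) has_real_derivative (- (2 * Re (cnj (\<theta> (\<gamma> s)) * F1 s)))) (at s)" if "s \<in> S" for s
    using DERIV_diff[OF DERIV_const has_derivative_cmod_square[OF F[OF that]], of 1] by simp
  have N1: "((\<lambda>s. - (2 * Re (cnj (\<theta> (\<gamma> s)) * F1 s))) has_real_derivative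
      - (2 * Re (cnj (F1 t) * F1 t + cnj (\<theta> (\<gamma> t)) * (d * (d * deriv (deriv \<theta>) (\<gamma> t)))))) (at t)"
    by (intro DERIV_minus DERIV_cmult has_derivative_Re_cnj_mult F S F1)
  have M: "((\<lambda>s. 1 - (cmod (\<gamma> s))\<^sup>2) has_real_derivative (- (2 * Re (cnj (\<gamma> s) * d)))) (at s)" for s
    using DERIV_diff[OF DERIV_const has_derivative_cmod_square[OF \<gamma>], of 1] by simp
  have M1: "((\<lambda>s. - (2 * Re (cnj (\<gamma> s) * d))) has_real_derivative - (2 * Re (cnj d * d + cnj (\<gamma> t) * 0))) (at t)"
    by (intro DERIV_minus DERIV_cmult has_derivative_Re_cnj_mult \<gamma> has_vector_derivative_const)
  have nz: "1 - (cmod (\<gamma> s))\<^sup>2 \<noteq> 0" if "s \<in> S" for s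
    using that by (simp add: S_def abs_square_eq_1)
  have e1: "Re (cnj (F1 t) * F1 t) = (cmod (deriv \<theta> (\<gamma> t)))\<^sup>2"
  proof -
    have "cnj (F1 t) * F1 t = of_real ((cmod (F1 t))\<^sup>2)" by (simp only: complex_norm_square mult.commute)
    then show ?thesis using d by (simp only: Re_complex_of_real) (simp add: F1_def norm_mult)
  qed
  have e2: "Re (cnj d * d) = 1"
  proof -
    have "cnj d * d = of_real ((cmod d)\<^sup>2)" by (simp only: complex_norm_square mult.commute)
    then show ?thesis using d by (simp only: Re_complex_of_real) simp
  qed
  have e3: "cnj (\<theta> (\<gamma> t)) * F1 t = a * d" by (simp add: F1_def a_def)
  have e4: "cnj (\<theta> (\<gamma> t)) * (d * (d * deriv (deriv \<theta>) (\<gamma> t))) = cnj (\<theta> (\<gamma> t)) * deriv (deriv \<theta>) (\<gamma> t) * d\<^sup>2"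
    by (simp add: power2_eq_square)
  have "(deriv ^^ 2) (\<lambda>s. (1 - (cmod (\<theta> (\<gamma> s)))\<^sup>2) / (1 - (cmod (\<gamma> s))\<^sup>2)) t =
      - (2 * Re (cnj (F1 t) * F1 t + cnj (\<theta> (\<gamma> t)) * (d * (d * deriv (deriv \<theta>) (\<gamma> t))))) / m
      - 2 * - (2 * Re (cnj (\<theta> (\<gamma> t)) * F1 t)) * - (2 * Re (cnj (\<gamma> t) * d)) / m\<^sup>2
      - n * - (2 * Re (cnj d * d + cnj (\<gamma> t) * 0)) / m\<^sup>2 + 2 * n * (- (2 * Re (cnj (\<gamma> t) * d)))\<^sup>2 / m ^ 3"
    unfolding n_def m_def by (rule second_deriv_quotient[OF S N N1 M M1 nz])
  then show ?thesis
    unfolding plus_complex.sel(1) e1 e2 e3 e4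
    by (simp add: power2_eq_square mult_ac del: times_complex.sel)
qed

lemma laplacian_model_kernel:
  assumes hol: "\<theta> holomorphic_on \<bbbD>" and z: "z \<in> \<bbbD>"
  shows "laplacian (\<lambda>w. Re (model_kernel \<theta> w w)) z = 4 * derivative_kernel_bound \<theta> z"
proof -
  have kernel: "Re (model_kernel \<theta> w w) = (1 - (cmod (\<theta> w))\<^sup>2) / (1 - (cmod w)\<^sup>2)" for w
  proof -
    have "cnj v * v = of_real ((cmod v)\<^sup>2)" for v by (simp only: complex_norm_square mult.commute)
    then have "model_kernel \<theta> w w = of_real ((1 - (cmod (\<theta> w))\<^sup>2) / (1 - (cmod w)\<^sup>2))"
      unfolding model_kernel_def by simp
    then show ?thesis by (simp only: Re_complex_of_real)
  qed
  define a where "a = cnj (\<theta> z) * deriv \<theta> z"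
  define b where "b = cnj (\<theta> z) * deriv (deriv \<theta>) z"
  define n where "n = 1 - (cmod (\<theta> z))\<^sup>2"
  define m where "m = 1 - (cmod z)\<^sup>2"
  define e where "e = (cmod (deriv \<theta> z))\<^sup>2"
  have dx: "((\<lambda>x. Complex x (Im z)) has_vector_derivative 1) (at s)" for s
    unfolding has_vector_derivative_complex_iff by (auto intro!: derivative_eq_intros)
  have dy: "((\<lambda>y. Complex (Re z) y) has_vector_derivative \<i>) (at s)" for s
    unfolding has_vector_derivative_complex_iff by (auto intro!: derivative_eq_intros)
  have Lx: "(deriv ^^ 2) (\<lambda>x. Re (model_kernel \<theta> (Complex x (Im z)) (Complex x (Im z)))) (Re z)
      = - 2 * (e + Re b) / m - 8 * Re a * Re z / m\<^sup>2 + 2 * n / m\<^sup>2 + 8 * n * (Re z)\<^sup>2 / m ^ 3"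
    unfolding kernel using second_deriv_kernel_line[OF hol dx, of "Re z"] z
    by (simp add: a_def b_def n_def m_def e_def)
  have Ly: "(deriv ^^ 2) (\<lambda>y. Re (model_kernel \<theta> (Complex (Re z) y) (Complex (Re z) y))) (Im z)
      = - 2 * (e - Re b) / m + 8 * Im a * Im z / m\<^sup>2 + 2 * n / m\<^sup>2 + 8 * n * (Im z)\<^sup>2 / m ^ 3"
  proof -
    have "Re (cnj (\<theta> z) * deriv \<theta> z * \<i>) = - Im a" by (simp add: a_def)
    moreover have "Re (cnj (\<theta> z) * deriv (deriv \<theta>) z * \<i>\<^sup>2) = - Re b" by (simp add: b_def)
    moreover have "Re (cnj z * \<i>) = Im z" by simp
    ultimately show ?thesis
      unfolding kernel using second_deriv_kernel_line[OF hol dy, of "Im z"] z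
      by (simp add: n_def m_def e_def del: times_complex.sel)
  qed
  have "laplacian (\<lambda>w. Re (model_kernel \<theta> w w)) z =
     - 4 * e / m - 8 * (Re a * Re z - Im a * Im z) / m\<^sup>2 + 4 * n / m\<^sup>2 + 8 * n * ((Re z)\<^sup>2 + (Im z)\<^sup>2) / m ^ 3"
    unfolding laplacian_def Lx Ly by (simp add: algebra_simps add_divide_distrib diff_divide_distrib)
  also have "\<dots> = 4 * (n * (1 / m\<^sup>2 + 2 * (cmod z)\<^sup>2 / m ^ 3) - e / m - 2 * Re (a * z) / m\<^sup>2)"
    by (simp add: cmod_power2 algebra_simps add_divide_distrib diff_divide_distrib)
  finally show ?thesis by (simp add: derivative_kernel_bound_def a_def n_def m_def e_def)
qed


section \<open>Area integrals and the counting function\<close>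

lemma infsum_mono_subset_ennreal:
  fixes f g :: "'a \<Rightarrow> ennreal"
  assumes "A \<subseteq> B" "\<And>x. x \<in> A \<Longrightarrow> f x \<le> g x"
  shows "infsum f A \<le> infsum g B"
proof -
  have "sum f F \<le> infsum g B" if F: "finite F" "F \<subseteq> A" for F
  proof -
    have "sum f F \<le> sum g F" using F assms by (intro sum_mono) auto
    also have "\<dots> \<le> infsum g B"
      using F assms(1) by (subst nonneg_infsum_complete) (auto intro!: SUP_upper)
    finally show ?thesis .
  qed
  then show ?thesis by (subst nonneg_infsum_complete) (auto intro!: SUP_least)
qed

lemma sets_area_measure [measurable_cong]: "sets area_measure = sets (lebesgue_on \<bbbD>)"
  by (simp add: area_measure_def)

lemma space_area_measure: "space area_measure = \<bbbD>"
  using sets_eq_imp_space_eq[OF sets_area_measure] by (simp add: space_restrict_space)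

lemma nn_integral_area_measure:
  assumes F: "F \<in> borel_measurable (lebesgue_on \<bbbD>)"
  shows "(\<integral>\<^sup>+z. F z \<partial>area_measure) = ennreal (1 / pi) * (\<integral>\<^sup>+z. F z * indicator \<bbbD> z \<partial>lborel)"
  unfolding area_measure_def
  by (simp add: nn_integral_scale_measure[OF F] nn_integral_restrict_space nn_integral_completion)

lemma borel_measurable_lebesgue_on:
  fixes F :: "complex \<Rightarrow> ennreal"
  assumes "F \<in> borel_measurable borel"
  shows "F \<in> borel_measurable (lebesgue_on S)"
  using assms by (intro measurable_restrict_space1 measurable_completion) simp

text \<open>
  A regular point counts once; in particular the multiplicity is not the infinite one of constant maps,
  which have no regular points.
\<close>

lemma value_multiplicity_regular:
  assumes hol: "\<phi> holomorphic_on \<bbbD>" and z: "\<zeta> \<in> \<bbbD>" and d: "deriv \<phi> \<zeta> \<noteq> 0"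
  shows "value_multiplicity \<phi> \<zeta> = 1"
proof -
  have der: "(\<phi> has_field_derivative deriv \<phi> \<zeta>) (at \<zeta>)"
    using hol z by (intro holomorphic_derivI[of _ \<bbbD>]) auto
  have "\<not> \<phi> constant_on \<bbbD>"
  proof
    assume "\<phi> constant_on \<bbbD>"
    then obtain c where c: "\<And>w. w \<in> \<bbbD> \<Longrightarrow> \<phi> w = c" by (auto simp: constant_on_def)
    have "(\<phi> has_field_derivative 0) (at \<zeta>)"
      by (rule has_field_derivative_transform_within_open[OF DERIV_const[of c] open_ball z]) (simp add: c)
    then show False using d DERIV_imp_deriv by blast
  qed
  moreover have "zorder (\<lambda>w. \<phi> w - \<phi> \<zeta>) \<zeta> = 1"
  proof (rule zorder_zero_eqI[of _ \<bbbD>])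
    show "(\<lambda>w. \<phi> w - \<phi> \<zeta>) holomorphic_on \<bbbD>" using hol by (intro holomorphic_intros)
    have "((\<lambda>w. \<phi> w - \<phi> \<zeta>) has_field_derivative deriv \<phi> \<zeta>) (at \<zeta>)"
      using DERIV_diff[OF der DERIV_const] by simp
    then show "(deriv ^^ nat 1) (\<lambda>w. \<phi> w - \<phi> \<zeta>) \<zeta> \<noteq> 0" using d by (simp add: DERIV_imp_deriv)
  qed (use z in auto)
  ultimately show ?thesis by (simp add: value_multiplicity_def)
qed

text \<open>
  The derivative of \<open>f \<circ> \<phi>\<close> contributes the factor \<open>\<bar>\<phi>'\<bar>\<^sup>2\<close>, which is the Jacobian in the area formula,
  and the logarithmic weight summed over preimages is a lower bound of the counting function. The factor 2 instead of \<open>2 / \<pi>\<close> comes from the normalization of the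
  area measure.
\<close>

lemma littlewood_paley_composition:
  assumes hol: "\<phi> holomorphic_on \<bbbD>" and range: "\<phi> ` \<bbbD> \<subseteq> \<bbbD>"
  obtains N where "N \<in> borel_measurable borel" "\<And>z. N z \<le> nevanlinna_counting \<phi> z"
    "\<And>f. f holomorphic_on \<bbbD> \<Longrightarrow>
      (\<Sum>n. ennreal ((cmod (taylor_coeff (composition_operator \<phi> f) (Suc n)))\<^sup>2))
        \<le> 2 * (\<integral>\<^sup>+z. N z * ennreal ((cmod (deriv f z))\<^sup>2) \<partial>area_measure)"
proof -
  define W where "W \<zeta> = ennreal (ln (1 / cmod \<zeta>))" for \<zeta> :: complex
  have W: "W \<in> borel_measurable borel" unfolding W_def by measurable
  obtain N where N[measurable]: "N \<in> borel_measurable borel"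
    and le: "\<And>z. N z \<le> (\<Sum>\<^sub>\<infinity>\<zeta>\<in>{\<zeta> \<in> \<bbbD>. \<phi> \<zeta> = z \<and> deriv \<phi> \<zeta> \<noteq> 0}. W \<zeta>)"
    and sub: "\<And>F. F \<in> borel_measurable borel \<Longrightarrow>
      (\<integral>\<^sup>+\<zeta>. F (\<phi> \<zeta>) * (W \<zeta> * (ennreal ((cmod (deriv \<phi> \<zeta>))\<^sup>2) * indicator \<bbbD> \<zeta>)) \<partial>lborel)
        = (\<integral>\<^sup>+z. F z * N z \<partial>lborel)"
    by (rule area_formula_weighted_counting[OF open_ball hol W], rule that)
  show ?thesis
  proof (rule that[OF N])
    fix z
    have "(\<Sum>\<^sub>\<infinity>\<zeta>\<in>{\<zeta> \<in> \<bbbD>. \<phi> \<zeta> = z \<and> deriv \<phi> \<zeta> \<noteq> 0}. W \<zeta>) \<le> nevanlinna_counting \<phi> z"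
      unfolding nevanlinna_counting_def
    proof (rule infsum_mono_subset_ennreal)
      fix \<zeta> assume "\<zeta> \<in> {\<zeta> \<in> \<bbbD>. \<phi> \<zeta> = z \<and> deriv \<phi> \<zeta> \<noteq> 0}"
      then have "value_multiplicity \<phi> \<zeta> = 1" by (intro value_multiplicity_regular[OF hol]) auto
      then show "W \<zeta> \<le> value_multiplicity \<phi> \<zeta> * (if \<zeta> = 0 then \<infinity> else ennreal (ln (1 / cmod \<zeta>)))"
        by (simp add: W_def)
    qed auto
    with le[of z] show "N z \<le> nevanlinna_counting \<phi> z" by (rule order_trans)
  next
    fix f assume f: "f holomorphic_on \<bbbD>"
    let ?G = "composition_operator \<phi> f"
    define F where "F z = ennreal ((cmod (deriv f z))\<^sup>2) * indicator \<bbbD> z" for z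
    have F: "F \<in> borel_measurable borel"
      unfolding F_def by (rule borel_measurable_deriv_on_open(1)[OF open_ball f]) auto
    have comp: "(f \<circ> \<phi>) holomorphic_on \<bbbD>" by (rule holomorphic_on_compose_gen[OF hol f range])
    have G: "?G holomorphic_on \<bbbD>"
      by (rule holomorphic_transform[OF comp]) (simp add: composition_operator_def)
    have dG: "deriv ?G \<zeta> = deriv f (\<phi> \<zeta>) * deriv \<phi> \<zeta>" if z: "\<zeta> \<in> \<bbbD>" for \<zeta>
    proof (rule DERIV_imp_deriv, rule has_field_derivative_transform_within_open[OF _ open_ball z])
      have "\<phi> \<zeta> \<in> \<bbbD>" using range z by blast
      then show "((\<lambda>z. f (\<phi> z)) has_field_derivative deriv f (\<phi> \<zeta>) * deriv \<phi> \<zeta>) (at \<zeta>)"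
        by (intro DERIV_chain2 holomorphic_derivI[OF f open_ball] holomorphic_derivI[OF hol open_ball] z)
      show "f (\<phi> x) = ?G x" if "x \<in> \<bbbD>" for x using that by (simp add: composition_operator_def)
    qed
    have "(\<Sum>n. ennreal ((cmod (taylor_coeff ?G (Suc n)))\<^sup>2))
      \<le> ennreal (2 / pi) * (\<integral>\<^sup>+z. ennreal ((cmod (deriv ?G z))\<^sup>2) * (ennreal (ln (1 / cmod z)) * indicator \<bbbD> z) \<partial>lborel)"
      by (rule littlewood_paley_inequality[OF G])
    also have "(\<integral>\<^sup>+z. ennreal ((cmod (deriv ?G z))\<^sup>2) * (ennreal (ln (1 / cmod z)) * indicator \<bbbD> z) \<partial>lborel)
      = (\<integral>\<^sup>+\<zeta>. F (\<phi> \<zeta>) * (W \<zeta> * (ennreal ((cmod (deriv \<phi> \<zeta>))\<^sup>2) * indicator \<bbbD> \<zeta>)) \<partial>lborel)"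
    proof (rule nn_integral_cong)
      fix \<zeta>
      show "ennreal ((cmod (deriv ?G \<zeta>))\<^sup>2) * (ennreal (ln (1 / cmod \<zeta>)) * indicator \<bbbD> \<zeta>)
        = F (\<phi> \<zeta>) * (W \<zeta> * (ennreal ((cmod (deriv \<phi> \<zeta>))\<^sup>2) * indicator \<bbbD> \<zeta>))"
      proof (cases "\<zeta> \<in> \<bbbD>")
        case True
        then have "\<phi> \<zeta> \<in> \<bbbD>" using range by blast
        then show ?thesis using True unfolding dG[OF True]
          by (simp add: F_def W_def norm_mult power_mult_distrib ennreal_mult mult_ac)
      qed simp
    qed
    also have "\<dots> = (\<integral>\<^sup>+z. F z * N z \<partial>lborel)" by (rule sub[OF F])
    also have "ennreal (2 / pi) * (\<integral>\<^sup>+z. F z * N z \<partial>lborel) = 2 * (\<integral>\<^sup>+z. N z * F z \<partial>area_measure)"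
    proof -
      have m: "(\<lambda>z. N z * F z) \<in> borel_measurable (lebesgue_on \<bbbD>)"
        by (rule borel_measurable_lebesgue_on) (use N F in measurable)
      have "ennreal (2 / pi) = 2 * ennreal (1 / pi)"
        by (simp add: ennreal_mult[symmetric] flip: ennreal_numeral)
      moreover have "(\<integral>\<^sup>+z. F z * N z \<partial>lborel) = (\<integral>\<^sup>+z. N z * F z * indicator \<bbbD> z \<partial>lborel)"
        by (intro nn_integral_cong) (auto simp: F_def indicator_def mult.commute)
      ultimately show ?thesis unfolding nn_integral_area_measure[OF m] by (simp add: mult.assoc)
    qed
    also have "(\<integral>\<^sup>+z. N z * F z \<partial>area_measure) = (\<integral>\<^sup>+z. N z * ennreal ((cmod (deriv f z))\<^sup>2) \<partial>area_measure)"
      by (intro nn_integral_cong) (simp add: F_def space_area_measure)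
    finally show "(\<Sum>n. ennreal ((cmod (taylor_coeff ?G (Suc n)))\<^sup>2))
      \<le> 2 * (\<integral>\<^sup>+z. N z * ennreal ((cmod (deriv f z))\<^sup>2) \<partial>area_measure)" .
  qed
qed


section \<open>Schatten norms of composition operators\<close>

text \<open>
  The graph of \<open>x\<^sup>q\<close> lies above its tangent at \<open>c\<close>; written without subtraction, so that it extends to
  infinite values of \<open>x\<close>.
\<close>

lemma power_tangent_inequality:
  fixes x c q :: real
  assumes q: "1 \<le> q" and x: "0 \<le> x" and c: "0 < c"
  shows "q * c powr (q - 1) * x \<le> x powr q + (q - 1) * c powr q"
proof (cases "q = 1")
  case True
  then show ?thesis using x c by simp
next
  case False
  with q have q1: "1 < q" by simp
  have "x * c powr (q - 1) \<le> x powr q / q + (c powr (q - 1)) powr (q / (q - 1)) / (q / (q - 1))"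
    using x q1 by (intro Youngs_inequality) (auto simp: field_simps)
  also have "(c powr (q - 1)) powr (q / (q - 1)) = c powr q"
    using q1 by (simp add: powr_powr)
  finally have "q * (x * c powr (q - 1)) \<le> q * (x powr q / q + c powr q / (q / (q - 1)))"
    using q1 by (intro mult_left_mono) auto
  also have "\<dots> = x powr q + (q - 1) * c powr q" using q1 by (simp add: field_simps)
  finally show ?thesis by (simp add: mult_ac)
qed

lemma ennreal_power_tangent_inequality:
  fixes q c :: real and g :: ennreal
  assumes q: "1 \<le> q" and c: "0 < c"
  shows "ennreal (q * c powr (q - 1)) * g \<le> ennreal_powr g q + ennreal ((q - 1) * c powr q)"
proof (cases g)
  case (real x)
  have "ennreal (q * c powr (q - 1)) * g = ennreal (q * c powr (q - 1) * x)"
    using real q by (simp add: ennreal_mult)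
  also have "\<dots> \<le> ennreal (x powr q + (q - 1) * c powr q)"
    by (rule ennreal_leI[OF power_tangent_inequality[OF q real(1) c]])
  also have "\<dots> = ennreal_powr g q + ennreal ((q - 1) * c powr q)"
    using real q by (simp add: ennreal_powr_def)
  finally show ?thesis .
next
  case top
  then show ?thesis by (simp add: ennreal_powr_def)
qed

lemma measurable_ennreal_powr[measurable]: "(\<lambda>x. ennreal_powr x a) \<in> borel_measurable borel"
  unfolding ennreal_powr_def by measurable

text \<open>
  Jensen's inequality for a measure of mass at most \<open>C\<close>, which need not be a probability measure: the
  tangent inequality is integrated for the tangent point \<open>x / C\<close>, where \<open>x\<close> is the integral of \<open>g\<close>. The
  tangent point \<open>1\<close> shows beforehand that this integral is finite.
\<close>

lemma nn_integral_power_mean: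
  fixes g w :: "'a \<Rightarrow> ennreal" and q C i :: real
  assumes g[measurable]: "g \<in> borel_measurable M" and w[measurable]: "w \<in> borel_measurable M"
    and q: "1 \<le> q" and C: "0 < C" and total: "(\<integral>\<^sup>+x. w x \<partial>M) \<le> ennreal C"
    and I: "(\<integral>\<^sup>+x. ennreal_powr (g x) q * w x \<partial>M) \<le> ennreal i" and i: "0 \<le> i"
  obtains x where "0 \<le> x" "(\<integral>\<^sup>+x. g x * w x \<partial>M) = ennreal x" "x powr q \<le> C powr (q - 1) * i"
proof -
  let ?X = "\<integral>\<^sup>+x. g x * w x \<partial>M"
  have main: "ennreal (q * c powr (q - 1)) * ?X \<le> ennreal (i + (q - 1) * c powr q * C)" if c: "0 < c" for c
  proof -
    have "ennreal (q * c powr (q - 1)) * ?X = (\<integral>\<^sup>+x. (ennreal (q * c powr (q - 1)) * g x) * w x \<partial>M)"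
      by (simp add: nn_integral_cmult mult.assoc)
    also have "\<dots> \<le> (\<integral>\<^sup>+x. (ennreal_powr (g x) q + ennreal ((q - 1) * c powr q)) * w x \<partial>M)"
      by (intro nn_integral_mono mult_right_mono ennreal_power_tangent_inequality q c) simp
    also have "\<dots> = (\<integral>\<^sup>+x. ennreal_powr (g x) q * w x \<partial>M) + ennreal ((q - 1) * c powr q) * (\<integral>\<^sup>+x. w x \<partial>M)"
      by (simp add: distrib_right nn_integral_add nn_integral_cmult)
    also have "\<dots> \<le> ennreal i + ennreal ((q - 1) * c powr q) * ennreal C"
      by (intro add_mono mult_left_mono I total) simp
    also have "\<dots> = ennreal (i + (q - 1) * c powr q * C)"
      using q C i by (simp add: ennreal_mult[symmetric])
    finally show ?thesis .
  qed
  have "?X \<noteq> \<infinity>"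
  proof
    assume "?X = \<infinity>"
    with main[of 1] q show False by (simp add: ennreal_mult_top top_unique)
  qed
  then obtain x where x: "0 \<le> x" "?X = ennreal x" by (cases ?X) auto
  have "x powr q \<le> C powr (q - 1) * i"
  proof (cases "x = 0")
    case True
    then show ?thesis using i by simp
  next
    case False
    with x have x0: "0 < x" by simp
    \<comment> \<open>The mean value of \<open>g\<close> if the mass were exactly \<open>C\<close>.\<close>
    define c where "c = x / C"
    have c: "0 < c" using x0 C by (simp add: c_def)
    have "ennreal (q * c powr (q - 1) * x) \<le> ennreal (i + (q - 1) * c powr q * C)"
      using main[OF c] x q by (simp add: ennreal_mult)
    then have "q * c powr (q - 1) * x \<le> i + (q - 1) * c powr q * C"
      using q C i by (subst (asm) ennreal_le_iff) auto
    moreover have "c powr q * C = c powr (q - 1) * x"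
    proof -
      have "c powr q = c powr (q - 1) * c" using c powr_add[of c "q - 1" 1] by simp
      then show ?thesis using C by (simp add: c_def)
    qed
    ultimately have "q * (c powr (q - 1) * x) \<le> i + (q - 1) * (c powr (q - 1) * x)" by (simp add: mult.assoc)
    then have "c powr (q - 1) * x \<le> i" by (simp add: algebra_simps)
    moreover have "c powr (q - 1) * x = x powr q / C powr (q - 1)"
    proof -
      have "x powr q = x powr (q - 1) * x" using x0 powr_add[of x "q - 1" 1] by simp
      then show ?thesis using x0 C by (simp add: c_def powr_divide)
    qed
    ultimately show ?thesis using C by (simp add: divide_le_eq mult.commute)
  qed
  with x that show ?thesis by blast
qed

text \<open>
  \<open>q\<close> is half the Schatten exponent and \<open>N\<close> the Borel lower bound of the counting function.
\<close>

locale schatten_composition = contractive_symbol \<theta> for \<theta> +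
  fixes \<phi> :: "complex \<Rightarrow> complex" and \<Phi> :: "complex \<Rightarrow> real" and N :: "complex \<Rightarrow> ennreal" and C q :: real
  assumes \<phi>_hol: "\<phi> holomorphic_on \<bbbD>" and \<phi>_range: "\<phi> ` \<bbbD> \<subseteq> \<bbbD>"
    and \<Phi>_measurable: "\<Phi> \<in> borel_measurable (lebesgue_on \<bbbD>)" and \<Phi>_pos: "\<And>z. z \<in> \<bbbD> \<Longrightarrow> 0 < \<Phi> z"
    and q_ge_1: "1 \<le> q" and C_pos: "0 < C"
    and differentiation: "\<And>f. f \<in> hcarrier (model_space \<theta>) \<Longrightarrow>
      (\<integral>\<^sup>+z. ennreal ((cmod (deriv f z))\<^sup>2 * \<Phi> z) \<partial>area_measure) \<le> ennreal (C * (hnorm hardy_space f)\<^sup>2)"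
    and N_measurable: "N \<in> borel_measurable borel"
    and littlewood_paley: "\<And>f. f holomorphic_on \<bbbD> \<Longrightarrow>
      (\<Sum>n. ennreal ((cmod (taylor_coeff (composition_operator \<phi> f) (Suc n)))\<^sup>2))
        \<le> 2 * (\<integral>\<^sup>+z. N z * ennreal ((cmod (deriv f z))\<^sup>2) \<partial>area_measure)"
    and finite_integral: "(\<integral>\<^sup>+z. ennreal_powr (N z / ennreal (\<Phi> z)) q * ennreal (\<Phi> z)
        * ennreal (derivative_kernel_bound \<theta> z) \<partial>area_measure) < \<infinity>"
begin

definition weight :: "complex \<Rightarrow> ennreal"
  where "weight z = ennreal_powr (N z / ennreal (\<Phi> z)) q * ennreal (\<Phi> z)"

abbreviation weighted_integral :: "(complex \<Rightarrow> complex) \<Rightarrow> ennreal"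
  where "weighted_integral f \<equiv> \<integral>\<^sup>+z. weight z * ennreal ((cmod (deriv f z))\<^sup>2) \<partial>area_measure"

lemma model_hol: "f \<in> hcarrier (model_space \<theta>) \<Longrightarrow> f holomorphic_on \<bbbD>"
  by (simp add: model_iff hardy_iff)

lemma measurable_integrands:
  shows "N \<in> borel_measurable area_measure" "\<Phi> \<in> borel_measurable area_measure"
    "weight \<in> borel_measurable area_measure"
    "f holomorphic_on \<bbbD> \<Longrightarrow> (\<lambda>z. (cmod (deriv f z))\<^sup>2) \<in> borel_measurable area_measure"
    "(\<lambda>z. derivative_kernel_bound \<theta> z) \<in> borel_measurable area_measure"
proof -
  have sets: "borel_measurable area_measure = borel_measurable (lebesgue_on \<bbbD>)"
    by (rule measurable_cong_sets[OF sets_area_measure refl])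
  show N: "N \<in> borel_measurable area_measure" unfolding sets
    by (rule borel_measurable_lebesgue_on[OF N_measurable])
  show P: "\<Phi> \<in> borel_measurable area_measure" unfolding sets by (rule \<Phi>_measurable)
  show "weight \<in> borel_measurable area_measure"
    unfolding weight_def using N P by measurable
  have der: "continuous_on \<bbbD> (deriv f)" if "f holomorphic_on \<bbbD>" for f
    using that by (intro holomorphic_on_imp_continuous_on holomorphic_deriv) auto
  show "(\<lambda>z. (cmod (deriv f z))\<^sup>2) \<in> borel_measurable area_measure" if "f holomorphic_on \<bbbD>"
    unfolding sets by (intro continuous_imp_measurable_on_sets_lebesgue continuous_intros der that) simp
  have nz: "1 - (cmod z)\<^sup>2 \<noteq> 0" if "z \<in> \<bbbD>" for z using that by (simp add: abs_square_eq_1)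
  show "(\<lambda>z. derivative_kernel_bound \<theta> z) \<in> borel_measurable area_measure"
    unfolding sets derivative_kernel_bound_def
    by (intro continuous_imp_measurable_on_sets_lebesgue continuous_intros der hol holomorphic_on_imp_continuous_on)
      (use nz in auto)
qed

text \<open>
  Bessel's inequality in the Hardy space, applied to the derivative kernel at \<open>z\<close>.
\<close>

lemma derivative_bessel:
  assumes z: "z \<in> \<bbbD>" and I: "finite I"
    and e: "\<And>i. i \<in> I \<Longrightarrow> e i \<in> hcarrier (model_space \<theta>)" "\<And>i. i \<in> I \<Longrightarrow> hnorm hardy_space (e i) \<le> 1"
    and orth: "\<And>i j. i \<in> I \<Longrightarrow> j \<in> I \<Longrightarrow> i \<noteq> j \<Longrightarrow> hinner hardy_space (e i) (e j) = 0"
  shows "(\<Sum>i\<in>I. (cmod (deriv (e i) z))\<^sup>2) \<le> derivative_kernel_bound \<theta> z"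
proof -
  note k = derivative_kernel_properties[OF z]
  have eH: "e i \<in> hcarrier hardy_space" if "i \<in> I" for i using e(1)[OF that] by (simp add: model_iff)
  have "(\<Sum>i\<in>I. (cmod (deriv (e i) z))\<^sup>2) = (\<Sum>i\<in>I. (cmod (hinner hardy_space (derivative_kernel z) (e i)))\<^sup>2)"
  proof (rule sum.cong[OF refl])
    fix i assume i: "i \<in> I"
    have "hinner hardy_space (derivative_kernel z) (e i) = cnj (deriv (e i) z)"
      unfolding k(2)[OF e(1)[OF i], symmetric] by (rule hardy.inner_commute[OF eH[OF i] k(1)])
    then show "(cmod (deriv (e i) z))\<^sup>2 = (cmod (hinner hardy_space (derivative_kernel z) (e i)))\<^sup>2" by simp
  qed
  also have "\<dots> \<le> (hnorm hardy_space (derivative_kernel z))\<^sup>2"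
    by (rule hardy.bessel_inequality[OF I k(1) eH e(2) orth])
  also have "\<dots> \<le> derivative_kernel_bound \<theta> z" by (rule k(3))
  finally show ?thesis .
qed

lemma derivative_bound:
  assumes z: "z \<in> \<bbbD>" and f: "f \<in> hcarrier (model_space \<theta>)"
  shows "(cmod (deriv f z))\<^sup>2 \<le> (hnorm hardy_space f)\<^sup>2 * derivative_kernel_bound \<theta> z"
proof -
  note k = derivative_kernel_properties[OF z]
  have fH: "f \<in> hcarrier hardy_space" using f by (simp add: model_iff)
  have "cmod (deriv f z) \<le> hnorm hardy_space f * hnorm hardy_space (derivative_kernel z)"
    using hardy.cauchy_schwarz[OF fH k(1)] by (simp add: k(2)[OF f])
  then have "(cmod (deriv f z))\<^sup>2 \<le> (hnorm hardy_space f * hnorm hardy_space (derivative_kernel z))\<^sup>2"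
    by (rule power_mono) simp
  also have "\<dots> \<le> (hnorm hardy_space f)\<^sup>2 * derivative_kernel_bound \<theta> z"
    unfolding power_mult_distrib by (intro mult_left_mono k(3)) simp
  finally show ?thesis .
qed

lemma weighted_integral_finite:
  assumes f: "f \<in> hcarrier (model_space \<theta>)"
  shows "weighted_integral f < \<infinity>"
proof -
  note [measurable] = measurable_integrands(3,5) measurable_integrands(4)[OF model_hol[OF f]]
  have "weighted_integral f \<le> (\<integral>\<^sup>+z. ennreal ((hnorm hardy_space f)\<^sup>2) * (weight z * ennreal (derivative_kernel_bound \<theta> z)) \<partial>area_measure)"
  proof (intro nn_integral_mono)
    fix z assume "z \<in> space area_measure"
    then have z: "z \<in> \<bbbD>" by (simp only: space_area_measure)
    have "ennreal ((cmod (deriv f z))\<^sup>2) \<le> ennreal ((hnorm hardy_space f)\<^sup>2) * ennreal (derivative_kernel_bound \<theta> z)"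
      using ennreal_leI[OF derivative_bound[OF z f]] by (simp add: ennreal_mult')
    from mult_left_mono[OF this, of "weight z"]
    show "weight z * ennreal ((cmod (deriv f z))\<^sup>2) \<le> ennreal ((hnorm hardy_space f)\<^sup>2) * (weight z * ennreal (derivative_kernel_bound \<theta> z))"
      by (simp add: mult_ac)
  qed
  also have "\<dots> = ennreal ((hnorm hardy_space f)\<^sup>2) * (\<integral>\<^sup>+z. weight z * ennreal (derivative_kernel_bound \<theta> z) \<partial>area_measure)"
    by (rule nn_integral_cmult) measurable
  also have "\<dots> < \<infinity>" using finite_integral by (simp add: weight_def ennreal_mult_less_top)
  finally show ?thesis .
qed

text \<open>
  Littlewood-Paley for the composition, followed by Jensen's inequality for \<open>N / \<Phi>\<close> and the measure
  \<open>\<bar>f'\<bar>\<^sup>2 \<Phi> dA\<close>, whose mass is at most \<open>C B\<^sup>2\<close>. The bound \<open>B\<close> is kept apart from the norm of \<open>f\<close> so that a whole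
  sequence can share it.
\<close>

lemma composition_estimate:
  assumes f: "f \<in> hcarrier (model_space \<theta>)" and B: "hnorm hardy_space f \<le> B" "0 < B"
    and i: "weighted_integral f = ennreal i" "0 \<le> i"
  obtains x where "0 \<le> x" "x powr q \<le> (C * B\<^sup>2) powr (q - 1) * i"
    "composition_operator \<phi> f \<in> hcarrier hardy_space"
    "(hnorm hardy_space (composition_operator \<phi> f))\<^sup>2 \<le> (cmod (f (\<phi> 0)))\<^sup>2 + 2 * x"
proof -
  let ?G = "composition_operator \<phi> f"
  have fhol: "f holomorphic_on \<bbbD>" by (rule model_hol[OF f])
  note [measurable] = measurable_integrands(1,2) measurable_integrands(4)[OF fhol]
  have fH: "f \<in> hcarrier hardy_space" using f by (simp add: model_iff)
  have "(\<integral>\<^sup>+z. ennreal ((cmod (deriv f z))\<^sup>2 * \<Phi> z) \<partial>area_measure) \<le> ennreal (C * (hnorm hardy_space f)\<^sup>2)"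
    by (rule differentiation[OF f])
  also have "\<dots> \<le> ennreal (C * B\<^sup>2)"
    using B C_pos hardy.hnorm_nonneg[OF fH] by (intro ennreal_leI mult_left_mono power_mono) auto
  finally have total: "(\<integral>\<^sup>+z. ennreal ((cmod (deriv f z))\<^sup>2 * \<Phi> z) \<partial>area_measure) \<le> ennreal (C * B\<^sup>2)" .
  have I: "(\<integral>\<^sup>+z. ennreal_powr (N z / ennreal (\<Phi> z)) q * ennreal ((cmod (deriv f z))\<^sup>2 * \<Phi> z) \<partial>area_measure) \<le> ennreal i"
  proof -
    have "(\<integral>\<^sup>+z. ennreal_powr (N z / ennreal (\<Phi> z)) q * ennreal ((cmod (deriv f z))\<^sup>2 * \<Phi> z) \<partial>area_measure) = weighted_integral f"
    proof (rule nn_integral_cong)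
      fix z
      have "ennreal ((cmod (deriv f z))\<^sup>2 * \<Phi> z) = ennreal ((cmod (deriv f z))\<^sup>2) * ennreal (\<Phi> z)"
        by (rule ennreal_mult') simp
      then show "ennreal_powr (N z / ennreal (\<Phi> z)) q * ennreal ((cmod (deriv f z))\<^sup>2 * \<Phi> z)
        = weight z * ennreal ((cmod (deriv f z))\<^sup>2)"
        by (simp only: weight_def mult_ac)
    qed
    then show ?thesis using i by simp
  qed
  obtain x where x: "0 \<le> x" "(\<integral>\<^sup>+z. N z / ennreal (\<Phi> z) * ennreal ((cmod (deriv f z))\<^sup>2 * \<Phi> z) \<partial>area_measure) = ennreal x"
    "x powr q \<le> (C * B\<^sup>2) powr (q - 1) * i"
    by (rule nn_integral_power_mean[OF _ _ q_ge_1 _ total I i(2)]) (use C_pos B in \<open>auto intro: that\<close>)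
  have "(\<integral>\<^sup>+z. N z / ennreal (\<Phi> z) * ennreal ((cmod (deriv f z))\<^sup>2 * \<Phi> z) \<partial>area_measure)
      = (\<integral>\<^sup>+z. N z * ennreal ((cmod (deriv f z))\<^sup>2) \<partial>area_measure)"
  proof (rule nn_integral_cong)
    fix z assume "z \<in> space area_measure"
    then have P: "0 < \<Phi> z" using \<Phi>_pos by (simp only: space_area_measure)
    have "ennreal ((cmod (deriv f z))\<^sup>2 * \<Phi> z) = ennreal ((cmod (deriv f z))\<^sup>2) * ennreal (\<Phi> z)"
      by (rule ennreal_mult') simp
    then have "N z / ennreal (\<Phi> z) * ennreal ((cmod (deriv f z))\<^sup>2 * \<Phi> z)
        = (N z / ennreal (\<Phi> z) * ennreal (\<Phi> z)) * ennreal ((cmod (deriv f z))\<^sup>2)"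
      by (simp only: mult_ac)
    also have "N z / ennreal (\<Phi> z) * ennreal (\<Phi> z) = N z"
      using P by (simp add: ennreal_divide_times)
    finally show "N z / ennreal (\<Phi> z) * ennreal ((cmod (deriv f z))\<^sup>2 * \<Phi> z) = N z * ennreal ((cmod (deriv f z))\<^sup>2)" .
  qed
  with littlewood_paley[OF fhol] x
  have lp: "(\<Sum>n. ennreal ((cmod (taylor_coeff ?G (Suc n)))\<^sup>2)) \<le> ennreal (2 * x)"
    by (simp add: ennreal_mult)
  have tail: "(\<Sum>n<k. (cmod (taylor_coeff ?G (Suc n)))\<^sup>2) \<le> 2 * x" for k
  proof -
    have "ennreal (\<Sum>n<k. (cmod (taylor_coeff ?G (Suc n)))\<^sup>2) = (\<Sum>n<k. ennreal ((cmod (taylor_coeff ?G (Suc n)))\<^sup>2))"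
      by (rule sum_ennreal[symmetric]) simp
    also have "\<dots> \<le> (\<Sum>n. ennreal ((cmod (taylor_coeff ?G (Suc n)))\<^sup>2))" by (rule sum_le_suminf) auto
    also note lp
    finally show ?thesis using x(1) by (simp add: ennreal_le_iff)
  qed
  have ts: "summable (\<lambda>n. (cmod (taylor_coeff ?G (Suc n)))\<^sup>2)"
    by (rule summableI_nonneg_bounded[OF _ tail]) simp
  then have Gs: "summable (\<lambda>n. (cmod (taylor_coeff ?G n))\<^sup>2)" by (rule summable_Suc_iff[THEN iffD1])
  have "(f \<circ> \<phi>) holomorphic_on \<bbbD>" by (rule holomorphic_on_compose_gen[OF \<phi>_hol fhol \<phi>_range])
  then have "?G holomorphic_on \<bbbD>"
    by (rule holomorphic_transform) (simp add: composition_operator_def)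
  with Gs have G: "?G \<in> hcarrier hardy_space" by (simp add: hardy_iff composition_operator_def)
  have "(hnorm hardy_space ?G)\<^sup>2 = (cmod (taylor_coeff ?G 0))\<^sup>2 + (\<Sum>n. (cmod (taylor_coeff ?G (Suc n)))\<^sup>2)"
    unfolding hnorm_hardy_square[OF G] using suminf_split_head[OF Gs] by simp
  also have "(\<Sum>n. (cmod (taylor_coeff ?G (Suc n)))\<^sup>2) \<le> 2 * x" by (rule suminf_le_const[OF ts tail])
  also have "taylor_coeff ?G 0 = f (\<phi> 0)" by (simp add: taylor_coeff_def composition_operator_def)
  finally have "(hnorm hardy_space ?G)\<^sup>2 \<le> (cmod (f (\<phi> 0)))\<^sup>2 + 2 * x" by simp
  with x G that show ?thesis by blast
qed

lemma composition_mem: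
  assumes f: "f \<in> hcarrier (model_space \<theta>)"
  shows "composition_operator \<phi> f \<in> hcarrier hardy_space"
proof -
  have fH: "f \<in> hcarrier hardy_space" using f by (simp add: model_iff)
  obtain i where i: "weighted_integral f = ennreal i" "0 \<le> i"
    using weighted_integral_finite[OF f] by (cases "weighted_integral f") auto
  have B: "hnorm hardy_space f \<le> hnorm hardy_space f + 1" "0 < hnorm hardy_space f + 1"
    using hardy.hnorm_nonneg[OF fH] by auto
  show ?thesis by (rule composition_estimate[OF f B i])
qed

lemma linear_composition: "linear_operator (model_space \<theta>) hardy_space (composition_operator \<phi>)"
  unfolding linear_operator_def
  by (auto simp: composition_mem) (auto simp: composition_operator_def cfun_scale_def fun_eq_iff)

text \<open>
  Weak convergence gives pointwise convergence of the functions and of their derivatives, and the weighted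
  integrals tend to zero by dominated convergence. The weight may be infinite where the derivative kernel
  vanishes; there all derivatives vanish.
\<close>

lemma composition_null_sequence:
  assumes d: "\<And>n. d n \<in> hcarrier (model_space \<theta>)" "\<And>n. hnorm hardy_space (d n) \<le> 2"
    and weak: "\<And>h. h \<in> hcarrier hardy_space \<Longrightarrow> (\<lambda>n. hinner hardy_space (d n) h) \<longlonglongrightarrow> 0"
  shows "(\<lambda>n. hnorm hardy_space (composition_operator \<phi> (d n))) \<longlonglongrightarrow> 0"
proof -
  have dH: "d n \<in> hcarrier hardy_space" for n using d(1) by (simp add: model_iff)
  note [measurable] = measurable_integrands(3,5) measurable_integrands(4)[OF model_hol[OF d(1)]]
  let ?L = "derivative_kernel_bound \<theta>"
  have dom: "(\<integral>\<^sup>+z. weight z * ennreal (4 * ?L z) \<partial>area_measure) < \<infinity>"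
  proof -
    have "(\<integral>\<^sup>+z. weight z * ennreal (4 * ?L z) \<partial>area_measure) = (\<integral>\<^sup>+z. 4 * (weight z * ennreal (?L z)) \<partial>area_measure)"
    proof (rule nn_integral_cong)
      fix z
      have "ennreal (4 * ?L z) = 4 * ennreal (?L z)" using ennreal_mult'[of 4 "?L z"] by simp
      then show "weight z * ennreal (4 * ?L z) = 4 * (weight z * ennreal (?L z))" by (simp only: mult_ac)
    qed
    also have "\<dots> = 4 * (\<integral>\<^sup>+z. weight z * ennreal (?L z) \<partial>area_measure)"
      by (rule nn_integral_cmult) measurable
    also have "\<dots> < \<infinity>" using finite_integral by (simp add: weight_def ennreal_mult_less_top)
    finally show ?thesis .
  qed
  have le: "(cmod (deriv (d n) z))\<^sup>2 \<le> 4 * ?L z" if z: "z \<in> \<bbbD>" for n z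
  proof -
    have "(cmod (deriv (d n) z))\<^sup>2 \<le> (hnorm hardy_space (d n))\<^sup>2 * ?L z" by (rule derivative_bound[OF z d(1)])
    also have "\<dots> \<le> 2\<^sup>2 * ?L z"
      using d(2) hardy.hnorm_nonneg[OF dH] order_trans[OF zero_le_power2 derivative_kernel_properties(3)[OF z]]
      by (intro mult_right_mono power_mono) auto
    finally show ?thesis by simp
  qed
  have "(\<lambda>n. weighted_integral (d n)) \<longlonglongrightarrow> (\<integral>\<^sup>+z. 0 \<partial>area_measure)"
  proof (rule nn_integral_dominated_convergence[where w = "\<lambda>z. weight z * ennreal (4 * ?L z)"])
    show "AE z in area_measure. weight z * ennreal ((cmod (deriv (d n) z))\<^sup>2) \<le> weight z * ennreal (4 * ?L z)" for n
      by (intro AE_I2 mult_left_mono ennreal_leI le) (simp_all only: space_area_measure zero_le)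
    have "AE z in area_measure. weight z * ennreal (4 * ?L z) \<noteq> \<infinity>"
      using dom by (intro nn_integral_noteq_infinite) auto
    then show "AE z in area_measure. (\<lambda>n. weight z * ennreal ((cmod (deriv (d n) z))\<^sup>2)) \<longlonglongrightarrow> 0"
    proof (rule AE_mp, intro AE_I2 impI)
      fix z assume "z \<in> space area_measure" and fin: "weight z * ennreal (4 * ?L z) \<noteq> \<infinity>"
      then have z: "z \<in> \<bbbD>" by (simp only: space_area_measure)
      show "(\<lambda>n. weight z * ennreal ((cmod (deriv (d n) z))\<^sup>2)) \<longlonglongrightarrow> 0"
      proof (cases "weight z = \<infinity>")
        case True
        have "ennreal (4 * ?L z) = 0"
          using fin unfolding True infinity_ennreal_def ennreal_top_mult by (simp split: if_splits)
        then have L0: "4 * ?L z \<le> 0" by (simp only: ennreal_eq_0_iff)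
        have "(cmod (deriv (d n) z))\<^sup>2 \<le> 0" for n using le[OF z, of n] L0 by linarith
        then show ?thesis by simp
      next
        case False
        then obtain r where r: "weight z = ennreal r" "0 \<le> r" by (cases "weight z") auto
        have "(\<lambda>n. hinner hardy_space (d n) (szego_deriv z)) \<longlonglongrightarrow> 0" by (rule weak[OF szego_deriv_mem[OF z]])
        then have "(\<lambda>n. deriv (d n) z) \<longlonglongrightarrow> 0" by (simp only: szego_deriv_reproducing[OF z dH])
        then have "(\<lambda>n. ennreal (r * (cmod (deriv (d n) z))\<^sup>2)) \<longlonglongrightarrow> ennreal (r * (cmod 0)\<^sup>2)"
          by (intro tendsto_intros tendsto_ennrealI)
        then show ?thesis using r by (simp add: ennreal_mult)
      qed
    qed
  qed (use dom in auto)
  then have I0: "(\<lambda>n. weighted_integral (d n)) \<longlonglongrightarrow> 0" by simp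
  define i where "i n = enn2real (weighted_integral (d n))" for n
  have i: "weighted_integral (d n) = ennreal (i n)" "0 \<le> i n" for n
    using weighted_integral_finite[OF d(1)] by (auto simp: i_def less_top)
  have i0: "i \<longlonglongrightarrow> 0" using tendsto_enn2real[OF I0[folded ennreal_0]] by (simp add: i_def[abs_def])
  define P where "P n x \<longleftrightarrow> 0 \<le> x \<and> x powr q \<le> (C * 2\<^sup>2) powr (q - 1) * i n \<and>
      (hnorm hardy_space (composition_operator \<phi> (d n)))\<^sup>2 \<le> (cmod (d n (\<phi> 0)))\<^sup>2 + 2 * x" for n x
  have ex: "\<exists>x. P n x" for n
    unfolding P_def by (rule composition_estimate[OF d(1) d(2) _ i, of n]) auto
  define x where "x n = (SOME x. P n x)" for n
  have "P n (x n)" for n unfolding x_def by (rule someI_ex[OF ex])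
  then have x: "\<And>n. 0 \<le> x n" "\<And>n. x n powr q \<le> (C * 2\<^sup>2) powr (q - 1) * i n"
    and nx: "\<And>n. (hnorm hardy_space (composition_operator \<phi> (d n)))\<^sup>2 \<le> (cmod (d n (\<phi> 0)))\<^sup>2 + 2 * x n"
    unfolding P_def by blast+
  have "(\<lambda>n. (C * 2\<^sup>2) powr (q - 1) * i n) \<longlonglongrightarrow> (C * 2\<^sup>2) powr (q - 1) * 0" by (intro tendsto_intros i0)
  then have "(\<lambda>n. (C * 2\<^sup>2) powr (q - 1) * i n) \<longlonglongrightarrow> 0" by (simp only: mult_zero_right)
  then have "(\<lambda>n. x n powr q) \<longlonglongrightarrow> 0"
  proof (rule tendsto_sandwich[OF _ _ tendsto_const, rotated 2])
    show "\<forall>\<^sub>F n in sequentially. x n powr q \<le> (C * 2\<^sup>2) powr (q - 1) * i n"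
      by (intro always_eventually allI x(2))
  qed simp_all
  then have "(\<lambda>n. (x n powr q) powr (1 / q)) \<longlonglongrightarrow> 0"
    using q_ge_1 tendsto_powr'[of "\<lambda>n. x n powr q" 0 sequentially "\<lambda>n. 1 / q" "1 / q"] by simp
  then have x0: "x \<longlonglongrightarrow> 0" using q_ge_1 x(1) by (simp add: powr_powr)
  have \<phi>0: "\<phi> 0 \<in> \<bbbD>" by (rule subsetD[OF \<phi>_range imageI]) simp
  have "(\<lambda>n. hinner hardy_space (d n) (szego (\<phi> 0))) \<longlonglongrightarrow> 0" by (rule weak[OF szego_mem[OF \<phi>0]])
  then have "(\<lambda>n. d n (\<phi> 0)) \<longlonglongrightarrow> 0" by (simp only: szego_reproducing[OF \<phi>0 dH])
  then have "(\<lambda>n. (cmod (d n (\<phi> 0)))\<^sup>2 + 2 * x n) \<longlonglongrightarrow> (cmod 0)\<^sup>2 + 2 * 0" by (intro tendsto_intros x0)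
  then have "(\<lambda>n. (cmod (d n (\<phi> 0)))\<^sup>2 + 2 * x n) \<longlonglongrightarrow> 0" by simp
  then have "(\<lambda>n. (hnorm hardy_space (composition_operator \<phi> (d n)))\<^sup>2) \<longlonglongrightarrow> 0"
  proof (rule tendsto_sandwich[OF _ _ tendsto_const, rotated 2])
    show "\<forall>\<^sub>F n in sequentially. (hnorm hardy_space (composition_operator \<phi> (d n)))\<^sup>2 \<le> (cmod (d n (\<phi> 0)))\<^sup>2 + 2 * x n"
      by (intro always_eventually allI nx)
  qed simp_all
  then have "(\<lambda>n. sqrt ((hnorm hardy_space (composition_operator \<phi> (d n)))\<^sup>2)) \<longlonglongrightarrow> sqrt 0" by (rule tendsto_real_sqrt)
  then show ?thesis using hardy.hnorm_nonneg[OF composition_mem[OF d(1)]] by simp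
qed

sublocale weakly_compact_operator "model_space \<theta>" hardy_space "composition_operator \<phi>"
proof
  show "linear_operator (model_space \<theta>) hardy_space (composition_operator \<phi>)" by (rule linear_composition)
  fix f :: "nat \<Rightarrow> complex \<Rightarrow> complex"
  assume f: "\<And>n. f n \<in> hcarrier (model_space \<theta>) \<and> hnorm (model_space \<theta>) (f n) \<le> 1"
  have fK: "f n \<in> hcarrier (model_space \<theta>)" and fH: "f n \<in> hcarrier hardy_space" and f1: "hnorm hardy_space (f n) \<le> 1" for n
    using f[of n] by (auto simp: model_iff hnorm_model)
  obtain r g where r: "strict_mono (r :: nat \<Rightarrow> nat)" and gH: "g \<in> hcarrier hardy_space" and g1: "hnorm hardy_space g \<le> 1"
    and weak: "\<And>h. h \<in> hcarrier hardy_space \<Longrightarrow> (\<lambda>n. hinner hardy_space (f (r n) - g) h) \<longlonglongrightarrow> 0"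
    by (rule hardy_ball_weakly_compact[OF fH f1], rule that)
  have weak': "(\<lambda>n. hinner hardy_space (f (r n)) h) \<longlonglongrightarrow> hinner hardy_space g h" if h: "h \<in> hcarrier hardy_space" for h
  proof -
    have "(\<lambda>n. hinner hardy_space (f (r n)) h - hinner hardy_space g h) \<longlonglongrightarrow> 0"
      using weak[OF h] by (simp only: hardy.inner_diff_left[OF fH gH h])
    then show ?thesis by (simp only: LIM_zero_iff)
  qed
  have gK: "g \<in> hcarrier (model_space \<theta>)"
    unfolding model_iff
  proof (intro conjI ballI gH)
    fix h assume h: "h \<in> hcarrier hardy_space"
    have "(\<lambda>n. hinner hardy_space (f (r n)) (\<lambda>z. \<theta> z * h z)) = (\<lambda>n. 0)"
      using fK h unfolding model_iff by simp
    then show "hinner hardy_space g (\<lambda>z. \<theta> z * h z) = 0"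
      using weak'[OF multiplier_mem[OF h]] by (simp only: LIMSEQ_const_iff)
  qed
  have "(\<lambda>n. hnorm hardy_space (composition_operator \<phi> (f (r n) - g))) \<longlonglongrightarrow> 0"
  proof (rule composition_null_sequence[OF _ _ weak])
    show "f (r n) - g \<in> hcarrier (model_space \<theta>)" for n by (rule model.diff_mem[OF fK gK])
    show "hnorm hardy_space (f (r n) - g) \<le> 2" for n
    proof -
      have "hnorm hardy_space (f (r n) - g) \<le> hnorm hardy_space (f (r n)) + hnorm hardy_space (cfun_scale (-1) g)"
        unfolding hardy.diff_conv by (rule hardy.hnorm_triangle[OF fH hardy.scale_mem[OF gH]])
      also have "\<dots> \<le> 1 + 1"
        using f1 g1 hardy.hnorm_scale[OF gH, of "-1"] by (intro add_mono) auto
      finally show ?thesis by simp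
    qed
  qed
  moreover have "composition_operator \<phi> (f (r n) - g) = composition_operator \<phi> (f (r n)) - composition_operator \<phi> g" for n
    by (auto simp: composition_operator_def fun_eq_iff)
  ultimately show "\<exists>r g. strict_mono (r :: nat \<Rightarrow> nat) \<and> g \<in> hcarrier (model_space \<theta>) \<and>
      (\<forall>h\<in>hcarrier (model_space \<theta>). (\<lambda>n. hinner (model_space \<theta>) (f (r n)) h) \<longlonglongrightarrow> hinner (model_space \<theta>) g h) \<and>
      (\<lambda>n. hnorm hardy_space (composition_operator \<phi> (f (r n)) - composition_operator \<phi> g)) \<longlonglongrightarrow> 0"
    using r gK weak' unfolding hinner_model by (intro exI[of _ r] exI[of _ g]) (auto simp: model_iff)
qed

text \<open>
  The three inequalities of the introduction, for the squares \<open>s\<^sub>n\<^sup>2 \<le> a\<^sub>n + 2 x\<^sub>n\<close>, where \<open>a\<^sub>n\<close> is the point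
  value and \<open>x\<^sub>n\<close> the integral. The sequence \<open>a\<^sub>n\<close> is summable and bounded, hence \<open>a\<^sub>n\<^sup>q\<close> is summable, and \<open>x\<^sub>n\<^sup>q\<close> is
  bounded by a multiple of the summable sequence of weighted integrals.
\<close>

lemma summable_singular_values: "summable (\<lambda>n. singular_value n powr (2 * q))"
proof -
  let ?e = singular_vector
  let ?L = "derivative_kernel_bound \<theta>"
  have eK: "?e n \<in> hcarrier (model_space \<theta>)" and eH: "?e n \<in> hcarrier hardy_space" for n
    using singular_vector_mem[of n] by (auto simp: model_iff)
  have e1: "hnorm hardy_space (?e n) \<le> 1" for n using singular_vector_norm_le[of n] by (simp add: hnorm_model)
  have orth: "hinner hardy_space (?e m) (?e n) = 0" if "m \<noteq> n" for m n
    using singular_vector_orthogonal[OF that] by (simp add: hinner_model)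
  note [measurable] = measurable_integrands(3,5) measurable_integrands(4)[OF model_hol[OF eK]]
  define i where "i n = enn2real (weighted_integral (?e n))" for n
  have i: "weighted_integral (?e n) = ennreal (i n)" "0 \<le> i n" for n
    using weighted_integral_finite[OF eK] by (auto simp: i_def less_top)
  have "(\<Sum>n. ennreal (i n)) \<le> (\<integral>\<^sup>+z. weight z * ennreal (?L z) \<partial>area_measure)"
  proof -
    have "(\<Sum>n. ennreal (i n)) = (\<Sum>n. weighted_integral (?e n))" by (simp add: i)
    also have "\<dots> = (\<integral>\<^sup>+z. (\<Sum>n. weight z * ennreal ((cmod (deriv (?e n) z))\<^sup>2)) \<partial>area_measure)"
      by (rule nn_integral_suminf[symmetric]) measurable
    also have "\<dots> \<le> (\<integral>\<^sup>+z. weight z * ennreal (?L z) \<partial>area_measure)"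
    proof (rule nn_integral_mono)
      fix z assume "z \<in> space area_measure"
      then have z: "z \<in> \<bbbD>" by (simp only: space_area_measure)
      have "(\<Sum>n. ennreal ((cmod (deriv (?e n) z))\<^sup>2)) \<le> ennreal (?L z)"
        unfolding suminf_eq_SUP
      proof (rule SUP_least)
        fix k
        have "(\<Sum>n<k. (cmod (deriv (?e n) z))\<^sup>2) \<le> ?L z"
          by (rule derivative_bessel[OF z]) (use eK e1 orth in auto)
        then show "(\<Sum>n<k. ennreal ((cmod (deriv (?e n) z))\<^sup>2)) \<le> ennreal (?L z)"
          by (simp add: sum_ennreal ennreal_leI)
      qed
      then show "(\<Sum>n. weight z * ennreal ((cmod (deriv (?e n) z))\<^sup>2)) \<le> weight z * ennreal (?L z)"
        unfolding ennreal_suminf_cmult by (rule mult_left_mono) simp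
    qed
    finally show ?thesis .
  qed
  also have "\<dots> < \<infinity>" using finite_integral by (simp add: weight_def)
  finally have "(\<Sum>n. ennreal (i n)) \<noteq> top" by (simp add: less_top)
  then have si: "summable i" by (rule summable_suminf_not_top[OF i(2)])
  have \<phi>0: "\<phi> 0 \<in> \<bbbD>" by (rule subsetD[OF \<phi>_range imageI]) simp
  define a where "a n = (cmod (singular_vector n (\<phi> 0)))\<^sup>2" for n
  define A where "A = (hnorm hardy_space (szego (\<phi> 0)))\<^sup>2"
  have a0: "0 \<le> a n" for n by (simp add: a_def)
  have asum: "(\<Sum>n<k. a n) \<le> A" for k
  proof -
    have "(\<Sum>n<k. a n) = (\<Sum>n<k. (cmod (hinner hardy_space (szego (\<phi> 0)) (?e n)))\<^sup>2)"
    proof (rule sum.cong[OF refl])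
      fix n
      show "a n = (cmod (hinner hardy_space (szego (\<phi> 0)) (?e n)))\<^sup>2"
        unfolding hardy.inner_commute[OF eH szego_mem[OF \<phi>0]] szego_reproducing[OF \<phi>0 eH] by (simp add: a_def)
    qed
    also have "\<dots> \<le> A" unfolding A_def
      by (rule hardy.bessel_inequality[OF finite_lessThan szego_mem[OF \<phi>0] eH e1 orth])
    finally show ?thesis .
  qed
  have sa: "summable a" by (rule summableI_nonneg_bounded[OF a0 asum])
  have aA: "a n \<le> A" for n
    using asum[of "Suc n"] sum_nonneg[of "{..<n}" a] a0 by simp
  define P where "P n x \<longleftrightarrow> 0 \<le> x \<and> x powr q \<le> C powr (q - 1) * i n \<and> (singular_value n)\<^sup>2 \<le> a n + 2 * x" for n x
  have ex: "\<exists>x. P n x" for n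
    unfolding P_def a_def singular_value_def by (rule composition_estimate[OF eK e1 _ i, of n]) auto
  define x where "x n = (SOME x. P n x)" for n
  have "P n (x n)" for n unfolding x_def by (rule someI_ex[OF ex])
  then have x: "\<And>n. 0 \<le> x n" "\<And>n. x n powr q \<le> C powr (q - 1) * i n"
    and sx: "\<And>n. (singular_value n)\<^sup>2 \<le> a n + 2 * x n"
    unfolding P_def by blast+
  show ?thesis
  proof (rule summable_comparison_test)
    show "summable (\<lambda>n. 2 powr q * (A powr (q - 1) * a n + 2 powr q * (C powr (q - 1) * i n)))"
      by (intro summable_mult summable_add sa si)
    show "\<exists>k. \<forall>n\<ge>k. norm (singular_value n powr (2 * q)) \<le> 2 powr q * (A powr (q - 1) * a n + 2 powr q * (C powr (q - 1) * i n))"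
    proof (intro exI[of _ 0] allI impI)
      fix n
      have an: "a n powr q \<le> A powr (q - 1) * a n"
      proof (cases "a n = 0")
        case False
        then have "a n powr q = a n powr (q - 1) * a n"
          using a0[of n] powr_add[of "a n" "q - 1" 1] by simp
        also have "\<dots> \<le> A powr (q - 1) * a n"
          using aA[of n] a0[of n] q_ge_1 by (intro mult_right_mono powr_mono2) auto
        finally show ?thesis .
      qed simp
      have "(2 * x n) powr q = 2 powr q * x n powr q" using x(1)[of n] by (simp add: powr_mult)
      also have "\<dots> \<le> 2 powr q * (C powr (q - 1) * i n)" by (intro mult_left_mono x(2)) simp
      finally have xn: "(2 * x n) powr q \<le> 2 powr q * (C powr (q - 1) * i n)" .
      have "(singular_value n)\<^sup>2 = singular_value n powr 2"
        by (rule powr_numeral[OF singular_value_nonneg, symmetric])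
      then have "singular_value n powr (2 * q) = ((singular_value n)\<^sup>2) powr q" by (simp only: powr_powr)
      also have "\<dots> \<le> (2 * max (a n) (2 * x n)) powr q"
        using sx[of n] q_ge_1 by (intro powr_mono2) auto
      also have "\<dots> = 2 powr q * (max (a n) (2 * x n)) powr q"
        using a0[of n] by (subst powr_mult) auto
      also have "\<dots> \<le> 2 powr q * (a n powr q + (2 * x n) powr q)"
        by (intro mult_left_mono) (auto simp: max_def)
      also have "\<dots> \<le> 2 powr q * (A powr (q - 1) * a n + 2 powr q * (C powr (q - 1) * i n))"
        by (intro mult_left_mono add_mono an xn) simp
      finally show "norm (singular_value n powr (2 * q)) \<le> 2 powr q * (A powr (q - 1) * a n + 2 powr q * (C powr (q - 1) * i n))"
        by simp
    qed
  qed
qed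

lemma composition_schatten: "composition_operator \<phi> \<in> schatten_class (2 * q) (model_space \<theta>) hardy_space"
proof -
  have "(\<lambda>n. singular_value n powr (2 * q)) \<longlonglongrightarrow> 0" by (rule summable_LIMSEQ_zero[OF summable_singular_values])
  then have "(\<lambda>n. (singular_value n powr (2 * q)) powr (1 / (2 * q))) \<longlonglongrightarrow> 0"
    using q_ge_1 tendsto_powr'[of "\<lambda>n. singular_value n powr (2 * q)" 0 sequentially "\<lambda>n. 1 / (2 * q)" "1 / (2 * q)"] by simp
  then have "singular_value \<longlonglongrightarrow> 0" using q_ge_1 singular_value_nonneg by (simp add: powr_powr)
  then show ?thesis unfolding schatten_class_def
    using compact singular_numbers_singular_value summable_singular_values by blast
qed

end

theorem proposition5p3:
  fixes \<theta> \<phi> :: "complex \<Rightarrow> complex" and \<Phi> :: "complex \<Rightarrow> real" and p :: real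
  assumes "inner_function \<theta>"
    and "\<phi> holomorphic_on \<bbbD>" and "\<phi> ` \<bbbD> \<subseteq> \<bbbD>"
    and "p \<ge> 2"
    and "\<Phi> \<in> borel_measurable (lebesgue_on \<bbbD>)" and "\<And>z. z \<in> \<bbbD> \<Longrightarrow> \<Phi> z > 0"
    and "differentiation_bounded (model_space \<theta>) \<Phi>"
    and "(\<integral>\<^sup>+z. ennreal_powr (nevanlinna_counting \<phi> z / ennreal (\<Phi> z)) (p / 2)
             * ennreal (laplacian (\<lambda>w. Re (model_kernel \<theta> w w)) z) * ennreal (\<Phi> z)
           \<partial>area_measure) < \<infinity>"
  shows "composition_operator \<phi> \<in> schatten_class p (model_space \<theta>) hardy_space"
proof -
  interpret contractive_symbol \<theta> by (rule inner_function_contractive[OF assms(1)])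
  obtain N where N: "N \<in> borel_measurable borel" "\<And>z. N z \<le> nevanlinna_counting \<phi> z"
    and LP: "\<And>f. f holomorphic_on \<bbbD> \<Longrightarrow>
      (\<Sum>n. ennreal ((cmod (taylor_coeff (composition_operator \<phi> f) (Suc n)))\<^sup>2))
        \<le> 2 * (\<integral>\<^sup>+z. N z * ennreal ((cmod (deriv f z))\<^sup>2) \<partial>area_measure)"
    by (rule littlewood_paley_composition[OF assms(2,3)], rule that)
  obtain C0 where C0: "\<And>f. f \<in> hcarrier (model_space \<theta>) \<Longrightarrow>
       (\<integral>\<^sup>+z. ennreal ((cmod (deriv f z))\<^sup>2 * \<Phi> z) \<partial>area_measure) \<le> ennreal (C0 * (hnorm hardy_space f)\<^sup>2)"
    using assms(7) unfolding differentiation_bounded_def hnorm_model by blast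
  \<comment> \<open>The bound of the hypothesis may be zero or negative, if all derivatives vanish.\<close>
  define C where "C = max C0 1"
  have mono_powr: "ennreal_powr x a \<le> ennreal_powr y a" if "x \<le> y" "0 \<le> a" for x y a
    using that unfolding ennreal_powr_def
    by (auto simp: top_unique less_top intro!: ennreal_leI powr_mono2 enn2real_mono)
  have "(\<integral>\<^sup>+z. ennreal_powr (N z / ennreal (\<Phi> z)) (p / 2) * ennreal (\<Phi> z)
        * ennreal (derivative_kernel_bound \<theta> z) \<partial>area_measure)
      \<le> (\<integral>\<^sup>+z. ennreal_powr (nevanlinna_counting \<phi> z / ennreal (\<Phi> z)) (p / 2)
             * ennreal (laplacian (\<lambda>w. Re (model_kernel \<theta> w w)) z) * ennreal (\<Phi> z) \<partial>area_measure)"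
  proof (rule nn_integral_mono)
    fix z assume "z \<in> space area_measure"
    then have z: "z \<in> \<bbbD>" by (simp only: space_area_measure)
    have L: "derivative_kernel_bound \<theta> z \<le> laplacian (\<lambda>w. Re (model_kernel \<theta> w w)) z"
      unfolding laplacian_model_kernel[OF hol z]
      using order_trans[OF zero_le_power2 derivative_kernel_properties(3)[OF z]] by simp
    have "ennreal_powr (N z / ennreal (\<Phi> z)) (p / 2) \<le> ennreal_powr (nevanlinna_counting \<phi> z / ennreal (\<Phi> z)) (p / 2)"
      using N(2) assms(4) by (intro mono_powr divide_right_mono_ennreal) auto
    from mult_mono[OF this ennreal_leI[OF L]]
    have "ennreal_powr (N z / ennreal (\<Phi> z)) (p / 2) * ennreal (derivative_kernel_bound \<theta> z) \<le>
      ennreal_powr (nevanlinna_counting \<phi> z / ennreal (\<Phi> z)) (p / 2) * ennreal (laplacian (\<lambda>w. Re (model_kernel \<theta> w w)) z)"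
      by simp
    from mult_right_mono[OF this, of "ennreal (\<Phi> z)"]
    show "ennreal_powr (N z / ennreal (\<Phi> z)) (p / 2) * ennreal (\<Phi> z) * ennreal (derivative_kernel_bound \<theta> z)
      \<le> ennreal_powr (nevanlinna_counting \<phi> z / ennreal (\<Phi> z)) (p / 2)
         * ennreal (laplacian (\<lambda>w. Re (model_kernel \<theta> w w)) z) * ennreal (\<Phi> z)"
      by (simp add: mult_ac)
  qed
  also note assms(8)
  finally have fin: "(\<integral>\<^sup>+z. ennreal_powr (N z / ennreal (\<Phi> z)) (p / 2) * ennreal (\<Phi> z)
        * ennreal (derivative_kernel_bound \<theta> z) \<partial>area_measure) < \<infinity>" .
  interpret schatten_composition \<theta> \<phi> \<Phi> N C "p / 2"
  proof
    show "(\<integral>\<^sup>+z. ennreal ((cmod (deriv f z))\<^sup>2 * \<Phi> z) \<partial>area_measure) \<le> ennreal (C * (hnorm hardy_space f)\<^sup>2)"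
      if "f \<in> hcarrier (model_space \<theta>)" for f
      using C0[OF that] by (rule order_trans) (intro ennreal_leI mult_right_mono, auto simp: C_def)
  qed (use assms N LP fin in \<open>auto simp: C_def\<close>)
  show ?thesis using composition_schatten by simp
qed

end
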